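(* Let $H$ be a stationary energy function with finite range $R>0$ and let $\Gamma$ be an infinite volume Gibbs point process with energy $H$, activity $z^*>0$ and inverse temperature $\beta^*\ge0$. Let $\mathcal{D}\subset(0,+\infty)\times[0,+\infty)$ be a bounded domain containing $(z^*,\beta^* )$ and define the maximum pseudo-likelihood estimator $$(\hat z_n,\hat\beta_n)\in\operatorname{argmin}_{(z,\beta)\in\mathcal{D}}\Big[\big(C_{\Lambda_n}^{z,\beta}(1,\Gamma)\big)^2+\big(C_{\Lambda_n}^{z,\beta}(h,\Gamma)\big)^2\Big],$$ where $C_{\Lambda_n}^{z,\beta}(f,\gamma)=\sum_{x\in\gamma_{\Lambda_n}}f(x,\gamma\setminus\{x\})-z\int_{\Lambda_n}e^{-\beta h(x,\gamma)}f(x,\gamma)\,dx$, applied with $f\equiv1$ and $f=h$. Assume $$E\Big(\big(1+h(0,\Gamma)^2\big)\sup_{(z,\beta)\in\mathcal{D}}e^{-\beta h(0,\Gamma)}\Big)<+\infty\quad\text{and}\quad P\big(h(0,\Gamma)=h(0,\emptyset)\big)<1.$$ Then $(\hat z_n,\hat\beta_n)$ converges almost surely to $(z^*,\beta^* )$.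
   Context: $\mathcal{C}$ is the set of locally finite subsets of $\mathbb{R}^d$, $\mathcal{C}_f$ the finite ones; $\gamma_\Lambda=\gamma\cap\Lambda$, $N_\Lambda(\gamma)=\#\gamma_\Lambda$; $\lambda^d$ Lebesgue measure; $\Lambda_n=[-n,n]^d$; $\pi_\Delta$ the law of the Poisson process on $\Delta$ with intensity $\lambda^d$ restricted to $\Delta$. An energy function is a measurable $H:\mathcal{C}_f\to\mathbb{R}\cup\{+\infty\}$ with $H(\emptyset)<\infty$, hereditary and stable. $\tau_u\gamma=\{x+u:x\in\gamma\}$; $H$ stationary: $H(\tau_u\gamma)=H(\gamma)$. $H_\Delta(\gamma)=H(\gamma)-H(\gamma_{\Delta^c})$ (convention $\infty-\infty=0$); finite range $R$: $H_\Delta(\gamma)=H(\gamma_{\Delta\oplus B(0,R)})-H(\gamma_{(\Delta\oplus B(0,R))\setminus\Delta})$ for bounded $\Delta$, $\gamma\in\mathcal{C}_f$, extended by $H_\Delta(\gamma):=H_\Delta(\gamma_{\Delta\oplus B(0,R)})$. Local energy $h(x,\gamma)=H(\{x\}\cup\gamma)-H(\gamma)$ (convention $\infty-\infty=0$) for finite $\gamma$, $h(x,\gamma):=h(x,\gamma_{B(x,R)})$ for $\gamma\in\mathcal{C}$. An infinite volume Gibbs point process with parameters $z,\beta$ is a point process whose law $P$ is stationary and satisfies, for every bounded $\Delta$ with $\lambda^d(\Delta)>0$ and $P$-a.e. $\gamma_{\Delta^c}$, $P(d\gamma_\Delta|\gamma_{\Delta^c})=\frac{1}{Z_\Delta^{z,\beta}(\gamma_{\Delta^c})}z^{N_\Delta(\gamma)}e^{-\beta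 H_\Delta(\gamma)}\pi_\Delta(d\gamma_\Delta)$. *)

theory Defs
  imports "HOL-Probability.Probability"
begin

definition locally_finite_conf :: "'a::euclidean_space set \<Rightarrow> bool" where
  "locally_finite_conf \<gamma> \<longleftrightarrow> (\<forall>K. bounded K \<longrightarrow> finite (\<gamma> \<inter> K))"

definition config_space :: "'a::euclidean_space set measure" where
  "config_space = sigma {\<gamma>. locally_finite_conf \<gamma>}
     {{\<gamma>. locally_finite_conf \<gamma> \<and> card (\<gamma> \<inter> B) = n} | B n. B \<in> sets lborel \<and> bounded B}"

definition fconfig_space :: "'a::euclidean_space set measure" where
  "fconfig_space = restrict_space config_space {\<gamma>. finite \<gamma>}"

definition translate_conf :: "'a::euclidean_space \<Rightarrow> 'a set \<Rightarrow> 'a set" where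
  "translate_conf u \<gamma> = (\<lambda>x. x + u) ` \<gamma>"

definition Lambda :: "nat \<Rightarrow> 'a::euclidean_space set" where
  "Lambda n = cbox (- (real n *\<^sub>R One)) (real n *\<^sub>R One)"

definition enlarge :: "'a::euclidean_space set \<Rightarrow> real \<Rightarrow> 'a set" where
  "enlarge \<Delta> R = (\<Union>x\<in>\<Delta>. cball x R)"

definition ediff :: "ereal \<Rightarrow> ereal \<Rightarrow> ereal" where
  "ediff a b = (if a = \<infinity> \<and> b = \<infinity> then 0 else a - b)"

definition energy_function :: "('a::euclidean_space set \<Rightarrow> ereal) \<Rightarrow> bool" where
  "energy_function H \<longleftrightarrow>
     H \<in> borel_measurable fconfig_space \<and>
     H {} < \<infinity> \<and>
     (\<forall>\<gamma> \<gamma>'. finite \<gamma> \<and> \<gamma>' \<subseteq> \<gamma> \<and> H \<gamma> < \<infinity> \<longrightarrow> H \<gamma>' < \<infinity>) \<and>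
     (\<exists>A::real. A \<ge> 0 \<and> (\<forall>\<gamma>. finite \<gamma> \<longrightarrow> H \<gamma> \<ge> ereal (- A * real (card \<gamma>))))"

definition stationary_energy :: "('a::euclidean_space set \<Rightarrow> ereal) \<Rightarrow> bool" where
  "stationary_energy H \<longleftrightarrow> (\<forall>u \<gamma>. finite \<gamma> \<longrightarrow> H (translate_conf u \<gamma>) = H \<gamma>)"

definition finite_range :: "('a::euclidean_space set \<Rightarrow> ereal) \<Rightarrow> real \<Rightarrow> bool" where
  "finite_range H R \<longleftrightarrow>
     (\<forall>\<Delta> \<gamma>. bounded \<Delta> \<and> finite \<gamma> \<longrightarrow>
        ediff (H \<gamma>) (H (\<gamma> - \<Delta>)) =
        ediff (H (\<gamma> \<inter> enlarge \<Delta> R)) (H (\<gamma> \<inter> enlarge \<Delta> R - \<Delta>)))"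

text \<open>Local energy H_Delta of a (possibly infinite) configuration, via the finite range extension.\<close>
definition H_Delta :: "('a::euclidean_space set \<Rightarrow> ereal) \<Rightarrow> real \<Rightarrow> 'a set \<Rightarrow> 'a set \<Rightarrow> ereal" where
  "H_Delta H R \<Delta> \<gamma> = ediff (H (\<gamma> \<inter> enlarge \<Delta> R)) (H (\<gamma> \<inter> enlarge \<Delta> R - \<Delta>))"

definition h_loc :: "('a::euclidean_space set \<Rightarrow> ereal) \<Rightarrow> real \<Rightarrow> 'a \<Rightarrow> 'a set \<Rightarrow> ereal" where
  "h_loc H R x \<gamma> = ediff (H (insert x (\<gamma> \<inter> cball x R))) (H (\<gamma> \<inter> cball x R))"

text \<open>exp(-beta * e) for an extended real e > -infinity, with exp(-beta*infinity) = 0 for beta > 0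
  and exp(-0*infinity) = 1 (convention 0 * infinity = 0).\<close>
definition ewt :: "real \<Rightarrow> ereal \<Rightarrow> real" where
  "ewt \<beta> e = (if e = \<infinity> then (if \<beta> = 0 then 1 else 0) else exp (- \<beta> * real_of_ereal e))"

text \<open>Integral of a nonnegative functional F against pi_Delta, the Poisson process on Delta
  with intensity Lebesgue measure restricted to Delta:
  e^{-|Delta|} sum_n 1/n! int_{Delta^n} F({x_1,...,x_n}) dx_1...dx_n.\<close>
definition poisson_nn_integral :: "'a::euclidean_space set \<Rightarrow> ('a set \<Rightarrow> ennreal) \<Rightarrow> ennreal" where
  "poisson_nn_integral \<Delta> F =
     ennreal (exp (- measure lborel \<Delta>)) *
     (\<Sum>n. ennreal (1 / fact n) *
        (\<integral>\<^sup>+ x. (\<Prod>i<n. indicator \<Delta> (x i)) * F (x ` {..<n}) \<partial>(PiM {..<n} (\<lambda>_. lborel))))"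

definition gibbs_weight ::
  "('a::euclidean_space set \<Rightarrow> ereal) \<Rightarrow> real \<Rightarrow> real \<Rightarrow> real \<Rightarrow> 'a set \<Rightarrow> 'a set \<Rightarrow> ennreal" where
  "gibbs_weight H R z \<beta> \<Delta> \<gamma> =
     ennreal (z ^ card (\<gamma> \<inter> \<Delta>) * ewt \<beta> (H_Delta H R \<Delta> \<gamma>))"

definition partition_fun ::
  "('a::euclidean_space set \<Rightarrow> ereal) \<Rightarrow> real \<Rightarrow> real \<Rightarrow> real \<Rightarrow> 'a set \<Rightarrow> 'a set \<Rightarrow> ennreal" where
  "partition_fun H R z \<beta> \<Delta> \<gamma> =
     poisson_nn_integral \<Delta> (\<lambda>\<xi>. gibbs_weight H R z \<beta> \<Delta> (\<xi> \<union> (\<gamma> - \<Delta>)))"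

text \<open>P is the law of an infinite volume Gibbs point process with energy H (finite range R),
  activity z, inverse temperature beta: P is a stationary probability on configurations and
  the DLR equations hold, written in integrated form: for every bounded Borel Delta with
  positive volume, Z_Delta is a.s. in (0,infinity) and for every measurable F >= 0,
  E_P[F] = E_P[ 1/Z_Delta(gamma_{Delta^c}) int F(xi u gamma_{Delta^c}) z^{N} e^{-beta H_Delta} pi_Delta(dxi) ],
  i.e. the given kernel is the conditional law of gamma_Delta given gamma_{Delta^c}.\<close>
definition gibbs_pp ::
  "('a::euclidean_space set \<Rightarrow> ereal) \<Rightarrow> real \<Rightarrow> real \<Rightarrow> real \<Rightarrow> 'a set measure \<Rightarrow> bool" where
  "gibbs_pp H R z \<beta> P \<longleftrightarrow>
     prob_space P \<and> sets P = sets config_space \<and>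
     (\<forall>u. distr P P (translate_conf u) = P) \<and>
     (\<forall>\<Delta>. \<Delta> \<in> sets lborel \<and> bounded \<Delta> \<and> emeasure lborel \<Delta> > 0 \<longrightarrow>
        (AE \<gamma> in P. 0 < partition_fun H R z \<beta> \<Delta> \<gamma> \<and> partition_fun H R z \<beta> \<Delta> \<gamma> < \<infinity>) \<and>
        (\<forall>F \<in> borel_measurable P.
           (\<integral>\<^sup>+ \<gamma>. F \<gamma> \<partial>P) =
           (\<integral>\<^sup>+ \<gamma>. poisson_nn_integral \<Delta>
                (\<lambda>\<xi>. F (\<xi> \<union> (\<gamma> - \<Delta>)) * gibbs_weight H R z \<beta> \<Delta> (\<xi> \<union> (\<gamma> - \<Delta>)))
              / partition_fun H R z \<beta> \<Delta> \<gamma> \<partial>P)))"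

definition ext_integral :: "'b measure \<Rightarrow> ('b \<Rightarrow> ereal) \<Rightarrow> ereal" where
  "ext_integral M g =
     enn2ereal (\<integral>\<^sup>+ x. e2ennreal (g x) \<partial>M) - enn2ereal (\<integral>\<^sup>+ x. e2ennreal (- g x) \<partial>M)"

definition innov ::
  "('a::euclidean_space set \<Rightarrow> ereal) \<Rightarrow> real \<Rightarrow> 'a set \<Rightarrow> real \<Rightarrow> real \<Rightarrow> ('a \<Rightarrow> 'a set \<Rightarrow> ereal)
     \<Rightarrow> 'a set \<Rightarrow> ereal" where
  "innov H R \<Lambda> z \<beta> f \<gamma> =
     (\<Sum>x\<in>\<gamma> \<inter> \<Lambda>. f x (\<gamma> - {x})) -
     ereal z * ext_integral (restrict_space lborel \<Lambda>)
                 (\<lambda>x. ereal (ewt \<beta> (h_loc H R x \<gamma>)) * f x \<gamma>)"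

definition pl_contrast ::
  "('a::euclidean_space set \<Rightarrow> ereal) \<Rightarrow> real \<Rightarrow> nat \<Rightarrow> real \<times> real \<Rightarrow> 'a set \<Rightarrow> ereal" where
  "pl_contrast H R n p \<gamma> =
     (innov H R (Lambda n) (fst p) (snd p) (\<lambda>_ _. 1) \<gamma>)\<^sup>2 +
     (innov H R (Lambda n) (fst p) (snd p) (h_loc H R) \<gamma>)\<^sup>2"

end

theory Submission
  imports Defs "HOL-Library.Discrete_Functions" "HOL-Real_Asymp.Real_Asymp"
begin

text \<open>
  Write \<open>L t = (\<beta> - \<beta>\<^sup>*) t - ln (z / z\<^sup>*)\<close>. Subtracting the innovations at \<open>(z\<^sup>*, \<beta>\<^sup>*)\<close> from those at
  \<open>(z, \<beta>)\<close> and taking the combination with coefficients \<open>\<beta> - \<beta>\<^sup>*\<close> and \<open>- ln (z / z\<^sup>*)\<close> gives the integral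
  over \<open>\<Lambda>\<^sub>n\<close> of the nonnegative function \<open>z\<^sup>* exp (- \<beta>\<^sup>* h) L h (1 - exp (- L h))\<close>. The innovations at the true
  parameter are \<open>o(n\<^sup>d)\<close>, hence by minimality so are those at the estimator. If \<open>h\<close> takes the value \<open>h(0, {})\<close>,
  and also values away from it, on subsets of \<open>\<Lambda>\<^sub>n\<close> of positive lower density, then the affine function \<open>L\<close>
  must be small at two separated points, so that \<open>\<beta>\<close> is close to \<open>\<beta>\<^sup>*\<close> and \<open>z\<close> to \<open>z\<^sup>*\<close>.

  Neither the law of large numbers for the innovations nor the positive density needs the ergodic theorem
  or a decomposition into ergodic components. For a functional \<open>F\<close> of the points in a window, subtract
  its conditional expectation \<open>K F\<close> given the configuration outside the window. The lattice translates of
  \<open>F - K F\<close> are uncorrelated at large distance, so their averages vanish when \<open>F\<close> is bounded; a maximal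
  inequality for the lattice extends this to integrable \<open>F\<close>. The Mecke formula says that both terms of
  an innovation have the same image under \<open>K\<close>.
\<close>

section \<open>Measurability of operations on configurations\<close>

text \<open>The moment assumption controls first moments only: sums over the points of a unit cube
  have finite mean, but it gives no bound on their variance. Hence the variance argument is confined
  to bounded functionals, where the second moment of a sum over a box is of the order of the number
  of sites, and the passage to integrable functionals needs a weak type inequality that rests on
  stationarity alone. Unit cubes enter because a cube together with its
  \<open>R\<close>-neighbourhood fits into one window, so that conditioning on the outside of that
  window treats the sum and the integral over the cube at once; boxes are then tiled by cubes. Two
  further obstacles shape the proof. Energy differences are handled as real numbers, which is
  possible because the finite range identity, read with its convention, excludes infinite energies.
  And \<open>D\<close> may contain activities arbitrarily close to \<open>0\<close>, so the
  logarithm of the activity ratio is unbounded; both sides of the final comparison are measured in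
  multiples of one plus its absolute value, which cancels.\<close>

lemma space_config_space: "space config_space = {\<gamma>. locally_finite_conf \<gamma>}"
  unfolding config_space_def by (rule space_measure_of) auto

lemma locally_finite_confD: "locally_finite_conf \<gamma> \<Longrightarrow> bounded K \<Longrightarrow> finite (\<gamma> \<inter> K)"
  by (simp add: locally_finite_conf_def)

lemma locally_finite_conf_subset: "locally_finite_conf \<gamma> \<Longrightarrow> \<xi> \<subseteq> \<gamma> \<Longrightarrow> locally_finite_conf \<xi>"
  unfolding locally_finite_conf_def by (meson Int_mono finite_subset order_refl)

lemma locally_finite_conf_finite: "finite \<gamma> \<Longrightarrow> locally_finite_conf \<gamma>"
  by (simp add: locally_finite_conf_def)

lemma locally_finite_conf_insert: "locally_finite_conf \<gamma> \<Longrightarrow> locally_finite_conf (insert x \<gamma>)"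
  unfolding locally_finite_conf_def
  by (metis Int_insert_left finite_insert)

lemma locally_finite_conf_Un:
  "finite \<xi> \<Longrightarrow> locally_finite_conf \<gamma> \<Longrightarrow> locally_finite_conf (\<xi> \<union> \<gamma>)"
  by (induction rule: finite_induct) (auto intro: locally_finite_conf_insert)

lemma measurable_card_config:
  assumes "B \<in> sets borel" "bounded B"
  shows "(\<lambda>\<gamma>. card (\<gamma> \<inter> B)) \<in> measurable config_space (count_space UNIV)"
proof (rule measurable_count_space_eq2_countable[THEN iffD2])
  show "(\<lambda>\<gamma>. card (\<gamma> \<inter> B)) \<in> space config_space \<rightarrow> UNIV \<and>
    (\<forall>n\<in>UNIV. (\<lambda>\<gamma>. card (\<gamma> \<inter> B)) -` {n} \<inter> space config_space \<in> sets config_space)"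
  proof safe
    fix n
    have "(\<lambda>\<gamma>. card (\<gamma> \<inter> B)) -` {n} \<inter> space config_space
      = {\<gamma>. locally_finite_conf \<gamma> \<and> card (\<gamma> \<inter> B) = n}"
      by (auto simp: space_config_space)
    also have "\<dots> \<in> sets config_space"
      unfolding config_space_def using assms by (auto intro!: in_measure_of)
    finally show "(\<lambda>\<gamma>. card (\<gamma> \<inter> B)) -` {n} \<inter> space config_space \<in> sets config_space" .
  qed auto
qed

text \<open>The counts in bounded Borel sets generate the \<sigma>-algebra, so a map into
  configurations is tested on them alone. The operations below reduce to this, directly or through
  selection and insertion of points.\<close>

lemma measurable_configI:
  fixes f :: "'w \<Rightarrow> 'b::euclidean_space set"
  assumes "\<And>w. w \<in> space M \<Longrightarrow> locally_finite_conf (f w)"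
    and "\<And>B. B \<in> sets borel \<Longrightarrow> bounded B \<Longrightarrow>
           (\<lambda>w. card (f w \<inter> B)) \<in> measurable M (count_space UNIV)"
  shows "f \<in> measurable M config_space"
  unfolding config_space_def
proof (rule measurable_measure_of)
  fix y :: "'b set set" assume "y \<in> {{\<gamma>. locally_finite_conf \<gamma> \<and> card (\<gamma> \<inter> B) = n} | B n. B \<in> sets lborel \<and> bounded B}"
  then obtain B n where B: "B \<in> sets borel" "bounded B"
    and y: "y = {\<gamma>. locally_finite_conf \<gamma> \<and> card (\<gamma> \<inter> B) = n}" by auto
  have "f -` y \<inter> space M = (\<lambda>w. card (f w \<inter> B)) -` {n} \<inter> space M"
    using assms(1) by (auto simp: y)
  also have "\<dots> \<in> sets M"
    by (rule measurable_sets[OF assms(2)[OF B]]) simp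
  finally show "f -` y \<inter> space M \<in> sets M" .
qed (use assms(1) in auto)

text \<open>After normalisation, the counting measure of a configuration in a bounded window is a
  subprobability kernel, so the measurability of sums over the configuration is an instance of
  that of integrals against kernels.\<close>

lemma measurable_sum_config:
  fixes g :: "'w \<Rightarrow> 'a::euclidean_space \<Rightarrow> ennreal"
  assumes f: "f \<in> measurable M config_space"
    and B: "B \<in> sets borel" "bounded B"
    and g: "(\<lambda>(w, y). g w y) \<in> borel_measurable (M \<Otimes>\<^sub>M borel)"
  shows "(\<lambda>w. \<Sum>y\<in>f w \<inter> B. g w y) \<in> borel_measurable M"
proof -
  define N where "N w = distr (count_space (f w \<inter> B)) borel (\<lambda>x. x)" for w
  define c where "c w = real (card (f w \<inter> B))" for w
  \<comment> \<open>Dividing by \<open>1 + c w\<close> rather than \<open>c w\<close> keeps the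
    kernel defined where the window is empty; the factor is multiplied back at the end.\<close>
  define L where "L w = scale_measure (ennreal (1 / (1 + c w))) (N w)" for w
  have lf: "finite (f w \<inter> B)" if "w \<in> space M" for w
    using measurable_space[OF f that] B by (simp add: space_config_space locally_finite_conf_def)
  have em: "emeasure (N w) A = ennreal (real (card (f w \<inter> (A \<inter> B))))"
    if "w \<in> space M" "A \<in> sets borel" for w A
  proof -
    have "emeasure (N w) A = emeasure (count_space (f w \<inter> B)) (A \<inter> (f w \<inter> B))"
      using that unfolding N_def by (subst emeasure_distr) auto
    also have "A \<inter> (f w \<inter> B) = f w \<inter> (A \<inter> B)" by blast
    also have "emeasure (count_space (f w \<inter> B)) \<dots> = ennreal (real (card (f w \<inter> (A \<inter> B))))"
    proof -
      have "finite (f w \<inter> (A \<inter> B))" using lf[OF that(1)] by (rule rev_finite_subset) auto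
      then show ?thesis
        by (subst emeasure_count_space_finite) (auto simp: ennreal_of_nat_eq_real_of_nat)
    qed
    finally show ?thesis .
  qed
  have cm: "(\<lambda>w. real (card (f w \<inter> A))) \<in> borel_measurable M" if "A \<in> sets borel" "bounded A" for A
  proof -
    have "(\<lambda>w. card (f w \<inter> A)) \<in> measurable M (count_space UNIV)"
      using measurable_comp[OF f measurable_card_config[OF that]] by (simp add: comp_def)
    then show ?thesis by measurable
  qed
  have c: "c \<in> borel_measurable M" unfolding c_def by (rule cm[OF B])
  have "L \<in> measurable M (subprob_algebra borel)"
  proof (rule measurable_subprob_algebra)
    fix w assume w: "w \<in> space M"
    show "sets (L w) = sets borel" by (simp add: L_def N_def)
    show "subprob_space (L w)"
    proof
      have "emeasure (L w) (space (L w)) = ennreal (1 / (1 + c w)) * emeasure (N w) UNIV"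
        by (simp add: L_def space_scale_measure N_def)
      also have "\<dots> = ennreal (c w / (1 + c w))"
        using w by (subst em) (auto simp: c_def ennreal_mult[symmetric])
      also have "\<dots> \<le> 1" by (auto simp: c_def)
      finally show "emeasure (L w) (space (L w)) \<le> 1" .
      show "space (L w) \<noteq> {}" by (simp add: L_def space_scale_measure N_def)
    qed
  next
    fix A :: "'a set" assume A: "A \<in> sets borel"
    have "(\<lambda>w. emeasure (L w) A) \<in> borel_measurable M \<longleftrightarrow>
       (\<lambda>w. ennreal (1 / (1 + c w)) * ennreal (real (card (f w \<inter> (A \<inter> B))))) \<in> borel_measurable M"
      by (rule measurable_cong) (simp add: L_def em[OF _ A])
    moreover have "(\<lambda>w. real (card (f w \<inter> (A \<inter> B)))) \<in> borel_measurable M"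
      using A B by (intro cm) (auto intro: bounded_subset)
    ultimately show "(\<lambda>w. emeasure (L w) A) \<in> borel_measurable M"
      using c by simp
  qed
  then have m: "(\<lambda>w. \<integral>\<^sup>+ y. g w y \<partial>L w) \<in> borel_measurable M"
    by (rule nn_integral_measurable_subprob_algebra2[OF g])
  have "(\<Sum>y\<in>f w \<inter> B. g w y) = ennreal (1 + c w) * (\<integral>\<^sup>+ y. g w y \<partial>L w)" if w: "w \<in> space M" for w
  proof -
    have gw: "g w \<in> borel_measurable borel"
      using measurable_Pair2[OF g w] by simp
    have "(\<integral>\<^sup>+ y. g w y \<partial>L w) = ennreal (1 / (1 + c w)) * (\<integral>\<^sup>+ y. g w y \<partial>N w)"
      unfolding L_def using gw by (intro nn_integral_scale_measure) (simp add: N_def)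
    also have "(\<integral>\<^sup>+ y. g w y \<partial>N w) = (\<Sum>y\<in>f w \<inter> B. g w y)"
      unfolding N_def using gw lf[OF w]
      by (subst nn_integral_distr) (auto simp: nn_integral_count_space_finite)
    finally have "(\<integral>\<^sup>+ y. g w y \<partial>L w) = ennreal (1 / (1 + c w)) * (\<Sum>y\<in>f w \<inter> B. g w y)" .
    moreover have "ennreal (1 + c w) * ennreal (1 / (1 + c w)) = 1"
      by (subst ennreal_mult[symmetric]) (auto simp: c_def add_nonneg_eq_0_iff)
    ultimately show ?thesis
      by (metis mult.assoc mult_1)
  qed
  then show ?thesis
    using m c by (simp cong: measurable_cong)
qed

section \<open>Selecting and adding points measurably\<close>

lemma measurable_of_ennreal_of_nat:
  assumes "(\<lambda>w. of_nat (c w) :: ennreal) \<in> borel_measurable M"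
  shows "c \<in> measurable M (count_space UNIV)"
proof (rule measurable_count_space_eq2_countable[THEN iffD2])
  have "c -` {n} \<inter> space M = (\<lambda>w. of_nat (c w) :: ennreal) -` {of_nat n} \<inter> space M" for n
    by auto
  then show "c \<in> space M \<rightarrow> UNIV \<and> (\<forall>n\<in>UNIV. c -` {n} \<inter> space M \<in> sets M)"
    using measurable_sets[OF assms, of "{of_nat _}"] by auto
qed

text \<open>The number of selected points is a sum of zeros and ones over the configuration. The
  predicate may depend on \<open>w\<close>, which covers restriction to a ball with moving centre
  and deletion of a moving point.\<close>

lemma measurable_filter_config:
  assumes f: "f \<in> measurable M config_space"
    and E: "Measurable.pred (M \<Otimes>\<^sub>M borel) (\<lambda>(w, y). E w y)"
  shows "(\<lambda>w. {y \<in> f w. E w y}) \<in> measurable M config_space"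
proof (rule measurable_configI)
  fix w assume "w \<in> space M"
  then show "locally_finite_conf {y \<in> f w. E w y}"
    using measurable_space[OF f] by (auto simp: space_config_space intro: locally_finite_conf_subset)
next
  fix B :: "'b set" assume B: "B \<in> sets borel" "bounded B"
  show "(\<lambda>w. card ({y \<in> f w. E w y} \<inter> B)) \<in> measurable M (count_space UNIV)"
  proof (rule measurable_of_ennreal_of_nat)
    have "(\<lambda>(w, y). if E w y then 1 else 0 :: ennreal) \<in> borel_measurable (M \<Otimes>\<^sub>M borel)"
      using E by (simp add: split_beta')
    from measurable_sum_config[OF f B this]
    have "(\<lambda>w. \<Sum>y\<in>f w \<inter> B. (if E w y then 1 else 0 :: ennreal)) \<in> borel_measurable M" .
    moreover have "(\<Sum>y\<in>f w \<inter> B. (if E w y then 1 else 0 :: ennreal))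
        = of_nat (card ({y \<in> f w. E w y} \<inter> B))" if "w \<in> space M" for w
    proof -
      have "finite (f w \<inter> B)"
        using measurable_space[OF f that] B by (simp add: space_config_space locally_finite_conf_def)
      moreover have "f w \<inter> B \<inter> {y. E w y} = {y \<in> f w. E w y} \<inter> B" by blast
      ultimately show ?thesis
        by (simp add: sum.If_cases)
    qed
    ultimately show "(\<lambda>w. of_nat (card ({y \<in> f w. E w y} \<inter> B)) :: ennreal) \<in> borel_measurable M"
      by (subst measurable_cong[symmetric]) auto
  qed
qed

text \<open>Selecting the points equal to \<open>u w\<close> leaves the empty set or a singleton,
  and a singleton is detected by the count in a sufficiently large ball.\<close>

lemma measurable_member_config:
  assumes f: "f \<in> measurable M config_space" and u: "u \<in> borel_measurable M"
  shows "Measurable.pred M (\<lambda>w. u w \<in> f w)"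
proof -
  have "Measurable.pred (M \<Otimes>\<^sub>M borel) (\<lambda>(w, y). y = u w)"
    using u by measurable
  from measurable_filter_config[OF f this]
  have g: "(\<lambda>w. {y \<in> f w. y = u w}) \<in> measurable M config_space" .
  have "(u w \<in> f w) \<longleftrightarrow> (\<exists>n::nat. card ({y \<in> f w. y = u w} \<inter> cball 0 (real n)) \<noteq> 0)" for w
  proof -
    have *: "{y \<in> f w. y = u w} = (if u w \<in> f w then {u w} else {})" by auto
    obtain n where "norm (u w) \<le> real n" using real_arch_simple by blast
    then show ?thesis unfolding * by (auto intro!: exI[of _ n])
  qed
  moreover have "(\<lambda>w. card ({y \<in> f w. y = u w} \<inter> cball 0 (real n))) \<in> measurable M (count_space UNIV)" for n
    using measurable_comp[OF g measurable_card_config[of "cball 0 (real n)"]] by (simp add: comp_def)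
  ultimately show ?thesis by (simp del: card_0_eq)
qed

lemma measurable_insert_config:
  assumes f: "f \<in> measurable M config_space" and u: "u \<in> borel_measurable M"
  shows "(\<lambda>w. insert (u w) (f w)) \<in> measurable M config_space"
proof (rule measurable_configI)
  fix w assume "w \<in> space M"
  then show "locally_finite_conf (insert (u w) (f w))"
    using measurable_space[OF f] by (auto simp: space_config_space intro: locally_finite_conf_insert)
next
  fix B :: "'b set" assume B: "B \<in> sets borel" "bounded B"
  have [measurable]: "Measurable.pred M (\<lambda>w. u w \<in> f w)"
    "(\<lambda>w. card (f w \<inter> B)) \<in> measurable M (count_space UNIV)"
    using measurable_member_config[OF f u] measurable_comp[OF f measurable_card_config[OF B]]
    by (simp_all add: comp_def)
  note [measurable] = u B(1)
  have "(\<lambda>w. if u w \<in> f w \<or> u w \<notin> B then card (f w \<inter> B) else Suc (card (f w \<inter> B)))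
    \<in> measurable M (count_space UNIV)" by measurable
  moreover have "(if u w \<in> f w \<or> u w \<notin> B then card (f w \<inter> B) else Suc (card (f w \<inter> B)))
    = card (insert (u w) (f w) \<inter> B)" if "w \<in> space M" for w
  proof -
    have "finite (f w \<inter> B)"
      using measurable_space[OF f that] B by (simp add: space_config_space locally_finite_conf_def)
    then show ?thesis by (auto simp: insert_absorb Int_insert_left)
  qed
  ultimately show "(\<lambda>w. card (insert (u w) (f w) \<inter> B)) \<in> measurable M (count_space UNIV)"
    by (simp cong: measurable_cong)
qed

lemma measurable_union_config:
  assumes f: "f \<in> measurable M config_space" and "finite I"
    and u: "\<And>i. i \<in> I \<Longrightarrow> u i \<in> borel_measurable M"
  shows "(\<lambda>w. (\<lambda>i. u i w) ` I \<union> f w) \<in> measurable M config_space"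
  using assms(2,3)
proof (induction I rule: finite_induct)
  case empty
  then show ?case using f by simp
next
  case (insert i I)
  then have "(\<lambda>w. insert (u i w) ((\<lambda>i. u i w) ` I \<union> f w)) \<in> measurable M config_space"
    by (intro measurable_insert_config) auto
  then show ?case by simp
qed

section \<open>Translations of configurations\<close>

lemma mem_translate_conf: "x \<in> translate_conf u \<gamma> \<longleftrightarrow> x - u \<in> \<gamma>"
  unfolding translate_conf_def by (auto intro: image_eqI[of _ _ "x - u"])

lemma translate_conf_simps:
  "translate_conf u (translate_conf v \<gamma>) = translate_conf (v + u) \<gamma>"
  "translate_conf 0 \<gamma> = \<gamma>"
  "translate_conf u (\<xi> \<union> \<gamma>) = translate_conf u \<xi> \<union> translate_conf u \<gamma>"
  "translate_conf u (\<xi> \<inter> \<gamma>) = translate_conf u \<xi> \<inter> translate_conf u \<gamma>"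
  "translate_conf u (\<xi> - \<gamma>) = translate_conf u \<xi> - translate_conf u \<gamma>"
  "translate_conf u (insert x \<gamma>) = insert (x + u) (translate_conf u \<gamma>)"
  "translate_conf u {} = {}"
  by (auto simp: set_eq_iff mem_translate_conf algebra_simps)

lemma card_translate_conf: "card (translate_conf u \<gamma>) = card \<gamma>"
  unfolding translate_conf_def by (rule card_image) (auto simp: inj_on_def)

lemma finite_translate_conf: "finite (translate_conf u \<gamma>) \<longleftrightarrow> finite \<gamma>"
  unfolding translate_conf_def by (intro finite_image_iff) (auto simp: inj_on_def)

lemma bounded_translate_conf: "bounded B \<Longrightarrow> bounded (translate_conf u B)"
  using bounded_translation[of B u] by (simp add: translate_conf_def add.commute)

lemma locally_finite_conf_translate:
  assumes "locally_finite_conf \<gamma>"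
  shows "locally_finite_conf (translate_conf u \<gamma>)"
  unfolding locally_finite_conf_def
proof safe
  fix K :: "'a set" assume "bounded K"
  then have "finite (\<gamma> \<inter> translate_conf (- u) K)"
    using assms by (intro locally_finite_confD bounded_translate_conf)
  then have "finite (translate_conf u (\<gamma> \<inter> translate_conf (- u) K))"
    by (simp add: finite_translate_conf)
  then show "finite (translate_conf u \<gamma> \<inter> K)" by (simp add: translate_conf_simps)
qed

lemma measurable_translate_conf: "translate_conf u \<in> measurable config_space config_space"
proof (rule measurable_configI)
  fix \<gamma> :: "'a set" assume "\<gamma> \<in> space config_space"
  then show "locally_finite_conf (translate_conf u \<gamma>)"
    by (simp add: space_config_space locally_finite_conf_translate)
next
  fix B :: "'a set" assume B: "B \<in> sets borel" "bounded B"
  have "translate_conf (- u) B = (\<lambda>x. x + u) -` B"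
    by (auto simp: mem_translate_conf)
  also have "\<dots> \<in> sets borel"
    using measurable_sets[of "\<lambda>x. x + u" borel borel B] B by simp
  finally have "(\<lambda>\<gamma>. card (\<gamma> \<inter> translate_conf (- u) B)) \<in> measurable config_space (count_space UNIV)"
    using B by (intro measurable_card_config bounded_translate_conf)
  moreover have "card (\<gamma> \<inter> translate_conf (- u) B) = card (translate_conf u \<gamma> \<inter> B)" for \<gamma>
    by (subst card_translate_conf[of u, symmetric]) (simp add: translate_conf_simps)
  ultimately show "(\<lambda>\<gamma>. card (translate_conf u \<gamma> \<inter> B)) \<in> measurable config_space (count_space UNIV)"
    by simp
qed

section \<open>Lattice averages of stationary configurations\<close>

text \<open>Leaving out the upper end in each coordinate makes the cubes \<open>k + [0,1)^d\<close>
  tile the half-open box without overlap and gives exactly \<open>(2n)^d\<close> sites, the volume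
  of \<open>Lambda n\<close>.\<close>

definition lattice_box :: "nat \<Rightarrow> 'a::euclidean_space set" where
  "lattice_box n = {k. \<forall>b\<in>Basis. k \<bullet> b \<in> \<int> \<and> - real n \<le> k \<bullet> b \<and> k \<bullet> b < real n}"

text \<open>The sign brings the cube anchored at \<open>k\<close> to the origin: a functional of the
  unit cube evaluated at \<open>shift_conf k \<gamma>\<close> reads \<open>\<gamma>\<close> near
  \<open>k\<close>.\<close>

abbreviation shift_conf :: "'a::euclidean_space \<Rightarrow> 'a set \<Rightarrow> 'a set" where
  "shift_conf k \<equiv> translate_conf (- k)"

lemma bij_betw_lattice_box:
  "bij_betw (\<lambda>f. \<Sum>b\<in>Basis. of_int (f b) *\<^sub>R b)
     (Basis \<rightarrow>\<^sub>E {- int n..<int n}) (lattice_box n :: 'a::euclidean_space set)"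
proof -
  let ?v = "\<lambda>f. \<Sum>b\<in>Basis. of_int (f b) *\<^sub>R b :: 'a"
  have v: "?v f \<bullet> b = of_int (f b)" if "b \<in> Basis" for f and b :: 'a
    using that by (simp add: inner_sum_left inner_Basis if_distrib cong: if_cong)
  show ?thesis
  proof (rule bij_betw_byWitness[where f' = "\<lambda>x. \<lambda>b\<in>Basis. \<lfloor>x \<bullet> b\<rfloor>"])
    show "\<forall>f\<in>Basis \<rightarrow>\<^sub>E {- int n..<int n}. (\<lambda>b\<in>Basis. \<lfloor>?v f \<bullet> b\<rfloor>) = f"
      by (auto simp: v PiE_def extensional_def fun_eq_iff cong: restrict_cong)
    show "\<forall>x\<in>lattice_box n. ?v (\<lambda>b\<in>Basis. \<lfloor>x \<bullet> b\<rfloor>) = x"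
    proof
      fix x :: 'a assume x: "x \<in> lattice_box n"
      show "?v (\<lambda>b\<in>Basis. \<lfloor>x \<bullet> b\<rfloor>) = x"
      proof (rule euclidean_eqI)
        fix b :: 'a assume b: "b \<in> Basis"
        then have "x \<bullet> b \<in> \<int>" using x by (simp add: lattice_box_def)
        then show "?v (\<lambda>b\<in>Basis. \<lfloor>x \<bullet> b\<rfloor>) \<bullet> b = x \<bullet> b"
          using b by (simp add: v)
      qed
    qed
    show "?v ` (Basis \<rightarrow>\<^sub>E {- int n..<int n}) \<subseteq> lattice_box n"
    proof (safe, unfold lattice_box_def, safe)
      fix f :: "'a \<Rightarrow> int" and b :: 'a assume f: "f \<in> Basis \<rightarrow>\<^sub>E {- int n..<int n}" and b: "b \<in> Basis"
      then have fb: "- int n \<le> f b" "f b < int n" by auto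
      show "?v f \<bullet> b \<in> \<int>" using b by (simp add: v)
      show "- real n \<le> ?v f \<bullet> b" "?v f \<bullet> b < real n"
        using b fb by (simp_all add: v)
    qed
    show "(\<lambda>x. \<lambda>b\<in>Basis. \<lfloor>x \<bullet> b\<rfloor>) ` lattice_box n \<subseteq> (Basis :: 'a set) \<rightarrow>\<^sub>E {- int n..<int n}"
      by (auto simp: lattice_box_def le_floor_iff floor_less_iff)
  qed
qed

lemma card_lattice_box: "card (lattice_box n :: 'a set) = (2 * n) ^ DIM('a::euclidean_space)"
proof -
  have "card (lattice_box n :: 'a set) = card ((Basis :: 'a set) \<rightarrow>\<^sub>E {- int n..<int n})"
    using bij_betw_lattice_box by (rule bij_betw_same_card[symmetric])
  also have "\<dots> = (2 * n) ^ DIM('a)"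
    by (simp add: card_PiE nat_mult_distrib)
  finally show ?thesis .
qed

lemma finite_lattice_box [simp]: "finite (lattice_box n :: 'a::euclidean_space set)"
proof -
  have "finite ((Basis :: 'a set) \<rightarrow>\<^sub>E {- int n..<int n})" by (simp add: finite_PiE)
  with bij_betw_lattice_box show ?thesis by (rule bij_betw_finite[THEN iffD1])
qed

lemma lattice_box_mono: "m \<le> n \<Longrightarrow> lattice_box m \<subseteq> lattice_box n"
  by (force simp: lattice_box_def)

lemma lattice_box_add: "j \<in> lattice_box m \<Longrightarrow> k \<in> lattice_box n \<Longrightarrow> j + k \<in> lattice_box (m + n)"
  by (fastforce simp: lattice_box_def inner_add_left)

text \<open>If the boxes anchored at \<open>i\<close> and \<open>i'\<close> share a point, the
  anchor of the smaller one lies in the doubled larger box. This is the geometric part of the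
  covering argument.\<close>

lemma lattice_box_diff:
  assumes "i + j = i' + j'" "j \<in> lattice_box n" "j' \<in> lattice_box n'" "n' \<le> n"
  shows "i' - i \<in> lattice_box (2 * n)"
proof -
  have "i' - i = j - j'" using assms(1) by (metis add_diff_cancel_left' add_diff_eq diff_diff_eq2)
  moreover have "j - j' \<in> lattice_box (2 * n)"
    unfolding lattice_box_def
  proof safe
    fix b :: 'a assume "b \<in> Basis"
    then have "j \<bullet> b \<in> \<int>" "- real n \<le> j \<bullet> b" "j \<bullet> b < real n"
        "j' \<bullet> b \<in> \<int>" "- real n' \<le> j' \<bullet> b" "j' \<bullet> b < real n'"
      using assms(2,3) by (auto simp: lattice_box_def)
    then show "(j - j') \<bullet> b \<in> \<int>" "- real (2 * n) \<le> (j - j') \<bullet> b" "(j - j') \<bullet> b < real (2 * n)"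
      using assms(4) by (auto simp: inner_diff_left)
  qed
  ultimately show ?thesis by simp
qed

text \<open>Greedy selection of the largest box, as in the Vitali covering lemma.\<close>

lemma lattice_covering:
  fixes z :: "'a::euclidean_space \<Rightarrow> real"
  assumes "finite B" "finite U" "t \<ge> 0" "\<And>k. k \<in> U \<Longrightarrow> z k \<ge> 0"
    and "\<And>j. j \<in> B \<Longrightarrow> \<nu> j > 0"
    and "\<And>j. j \<in> B \<Longrightarrow> (+) j ` lattice_box (\<nu> j) \<subseteq> U"
    and "\<And>j. j \<in> B \<Longrightarrow> t * (2 * real (\<nu> j)) ^ DIM('a) \<le> (\<Sum>k\<in>lattice_box (\<nu> j). z (j + k))"
  shows "t * real (card B) \<le> 2 ^ DIM('a) * (\<Sum>k\<in>U. z k)"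
  using assms
proof (induction "card B" arbitrary: B U rule: less_induct)
  case less
  show ?case
  proof (cases "B = {}")
    case True
    then show ?thesis using less.prems by (simp add: sum_nonneg)
  next
    case False
    obtain j where j: "j \<in> B" and jmax: "\<And>i. i \<in> B \<Longrightarrow> \<nu> i \<le> \<nu> j"
    proof -
      have "Max (\<nu> ` B) \<in> \<nu> ` B" using False less.prems by (intro Max_in) auto
      then obtain j where "j \<in> B" "\<nu> j = Max (\<nu> ` B)" by auto
      then show ?thesis using that[of j] less.prems by auto
    qed
    define V where "V = (+) j ` lattice_box (\<nu> j)"
    define B' where "B' = {i \<in> B. (+) i ` lattice_box (\<nu> i) \<inter> V = {}} - {j}"
    have B'_sub: "B' \<subseteq> B" by (auto simp: B'_def)
    have "card B' < card B"
      using less.prems j by (intro psubset_card_mono) (auto simp: B'_def)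
    then have IH: "t * real (card B') \<le> 2 ^ DIM('a) * (\<Sum>k\<in>U - V. z k)"
    proof (rule less.hyps)
      show "(+) i ` lattice_box (\<nu> i) \<subseteq> U - V" if "i \<in> B'" for i
      proof -
        have "(+) i ` lattice_box (\<nu> i) \<subseteq> U" "(+) i ` lattice_box (\<nu> i) \<inter> V = {}"
          using that less.prems by (simp_all add: B'_def)
        then show ?thesis by blast
      qed
    qed (use less.prems in \<open>auto simp: B'_def\<close>)
    \<comment> \<open>A discarded anchor is \<open>j\<close> itself or belongs to a box that meets
      the one at \<open>j\<close> and is not larger, so it lies in the doubled box. Counting
      anchors, and not the points covered by the boxes, gives the constant
      \<open>2^d\<close>.\<close>
    have sub: "B - B' \<subseteq> (+) j ` lattice_box (2 * \<nu> j)"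
    proof
      fix i assume i: "i \<in> B - B'"
      have "\<exists>a c. a \<in> lattice_box (\<nu> i) \<and> c \<in> lattice_box (\<nu> j) \<and> i + a = j + c"
      proof (cases "i = j")
        case True
        moreover have "0 \<in> lattice_box (\<nu> j)" using less.prems j by (auto simp: lattice_box_def)
        ultimately show ?thesis by blast
      next
        case False
        then show ?thesis using i by (auto simp: B'_def V_def)
      qed
      then obtain a c where "a \<in> lattice_box (\<nu> i)" "c \<in> lattice_box (\<nu> j)" "i + a = j + c" by blast
      then have "i - j \<in> lattice_box (2 * \<nu> j)"
        using jmax i by (intro lattice_box_diff[of j c i a]) auto
      then have "j + (i - j) \<in> (+) j ` lattice_box (2 * \<nu> j)" by blast
      then show "i \<in> (+) j ` lattice_box (2 * \<nu> j)" by simp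
    qed
      have "card (B - B') \<le> card ((+) j ` lattice_box (2 * \<nu> j))"
        by (intro card_mono sub) auto
      also have "\<dots> = (4 * \<nu> j) ^ DIM('a)"
        by (subst card_image) (auto simp: card_lattice_box)
      finally have "real (card (B - B')) \<le> real ((4 * \<nu> j) ^ DIM('a))" by (rule of_nat_mono)
      also have "\<dots> = 2 ^ DIM('a) * (2 * real (\<nu> j)) ^ DIM('a)"
        by (simp add: power_mult_distrib mult.assoc flip: power_mult_distrib[of "2::real" 2])
      finally have "real (card (B - B')) \<le> 2 ^ DIM('a) * (2 * real (\<nu> j)) ^ DIM('a)" .
      then have "t * real (card (B - B')) \<le> t * (2 ^ DIM('a) * (2 * real (\<nu> j)) ^ DIM('a))"
        using less.prems by (intro mult_left_mono) auto
      also have "\<dots> = 2 ^ DIM('a) * (t * (2 * real (\<nu> j)) ^ DIM('a))" by simp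
      also have "\<dots> \<le> 2 ^ DIM('a) * (\<Sum>k\<in>lattice_box (\<nu> j). z (j + k))"
        using less.prems j by (intro mult_left_mono) auto
      also have "(\<Sum>k\<in>lattice_box (\<nu> j). z (j + k)) = (\<Sum>k\<in>V. z k)"
        unfolding V_def by (subst sum.reindex) auto
      finally have "t * real (card (B - B')) \<le> 2 ^ DIM('a) * (\<Sum>k\<in>V. z k)" .
      moreover have "card B = card B' + card (B - B')"
        using less.prems(1) B'_sub card_mono[of B B'] card_Diff_subset[of B' B] finite_subset[of B' B]
      by simp
      moreover have "(\<Sum>k\<in>U. z k) = (\<Sum>k\<in>U - V. z k) + (\<Sum>k\<in>V. z k)"
        using less.prems j by (intro sum.subset_diff) (auto simp: V_def)
      ultimately show ?thesis using IH by (simp add: algebra_simps)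
  qed
qed

text \<open>Consecutive squares have ratio tending to \<open>1\<close>, so a box between two of them
  exceeds the smaller one by a vanishing fraction of its volume, and bounded values change the
  average by no more than that. Variances thus need to be summed along squares only.\<close>

lemma lattice_average_subsequence:
  fixes y :: "'a::euclidean_space \<Rightarrow> real"
  assumes M: "\<And>k. \<bar>y k\<bar> \<le> M"
    and lim: "(\<lambda>j. (\<Sum>k\<in>lattice_box (j\<^sup>2). y k) / (2 * real (j\<^sup>2)) ^ DIM('a)) \<longlonglongrightarrow> 0"
  shows "(\<lambda>n. (\<Sum>k\<in>lattice_box n. y k) / (2 * real n) ^ DIM('a)) \<longlonglongrightarrow> 0"
proof -
  let ?d = "DIM('a)"
  define A where "A n = (\<Sum>k\<in>lattice_box n. y k) / (2 * real n) ^ ?d" for n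
  define s where "s = floor_sqrt"
  have M0: "M \<ge> 0" using M[of 0] by linarith
  have s_lim: "filterlim s at_top sequentially"
    unfolding filterlim_at_top
  proof
    fix Z
    show "\<forall>\<^sub>F n in sequentially. Z \<le> s n"
      using eventually_ge_at_top[of "Z\<^sup>2"] by eventually_elim (simp add: s_def le_floor_sqrt_iff)
  qed
  have 1: "(\<lambda>n. \<bar>A ((s n)\<^sup>2)\<bar>) \<longlonglongrightarrow> 0"
    using filterlim_compose[OF lim s_lim] tendsto_rabs_zero unfolding A_def by blast
  have "(\<lambda>j. M * (1 - ((real j / (1 + real j))\<^sup>2) ^ ?d)) \<longlonglongrightarrow> M * (1 - (1\<^sup>2) ^ ?d)"
    by (intro tendsto_intros) real_asymp
  then have 2: "(\<lambda>n. M * (1 - ((real (s n) / (1 + real (s n)))\<^sup>2) ^ ?d)) \<longlonglongrightarrow> 0"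
    using filterlim_compose[OF _ s_lim] by fastforce
  \<comment> \<open>With \<open>s n\<close> the integer square root, \<open>n\<close> lies between
    the squares of \<open>s n\<close> and \<open>s n + 1\<close>. The ratio of the two volumes is at
    least the displayed power, and each remaining site contributes at most \<open>M\<close>.\<close>
  have A_bound: "\<bar>A n\<bar> \<le> \<bar>A ((s n)\<^sup>2)\<bar> + M * (1 - ((real (s n) / (1 + real (s n)))\<^sup>2) ^ ?d)" if n: "n > 0" for n
  proof -
    let ?j = "(s n)\<^sup>2"
    have j: "?j \<le> n" "n < (Suc (s n))\<^sup>2" by (simp_all add: s_def Suc_floor_sqrt_power2_gt)
    have j0: "?j > 0" using n by (simp add: s_def)
    have sub: "lattice_box ?j \<subseteq> (lattice_box n :: 'a set)" using j by (intro lattice_box_mono)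
    define a where "a = (2 * real n) ^ ?d"
    define b where "b = (2 * real ?j) ^ ?d"
    have "a > 0" "b > 0" using n j0 by (simp_all only: a_def b_def zero_less_power zero_less_mult_iff of_nat_0_less_iff) auto
    moreover have "b \<le> a" using j(1) unfolding a_def b_def by (intro power_mono) (auto simp del: of_nat_power)
    ultimately have ab: "a > 0" "b > 0" "b \<le> a" by auto
    have "(\<Sum>k\<in>lattice_box n. y k) = (\<Sum>k\<in>lattice_box n - lattice_box ?j. y k) + (\<Sum>k\<in>lattice_box ?j. y k)"
      using sub by (intro sum.subset_diff) auto
    moreover have "\<bar>\<Sum>k\<in>lattice_box n - lattice_box ?j. y k\<bar> \<le> M * (a - b)"
    proof -
      have "\<bar>\<Sum>k\<in>lattice_box n - lattice_box ?j. y k\<bar> \<le> (\<Sum>k\<in>(lattice_box n - lattice_box ?j :: 'a set). M)"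
        by (rule order_trans[OF sum_abs]) (rule sum_mono, rule M)
      also have "\<dots> = M * real (card (lattice_box n - lattice_box ?j :: 'a set))" by simp
      also have "card (lattice_box n - lattice_box ?j :: 'a set) = (2 * n) ^ ?d - (2 * ?j) ^ ?d"
        using sub by (simp only: card_Diff_subset finite_lattice_box card_lattice_box)
      also have "real \<dots> = a - b"
        using j by (subst of_nat_diff) (auto simp: a_def b_def intro!: power_mono)
      finally show ?thesis .
    qed
    ultimately have "\<bar>\<Sum>k\<in>lattice_box n. y k\<bar> \<le> \<bar>\<Sum>k\<in>lattice_box ?j. y k\<bar> + M * (a - b)" by linarith
    then have "\<bar>A n\<bar> \<le> (\<bar>\<Sum>k\<in>lattice_box ?j. y k\<bar> + M * (a - b)) / a"
      using ab unfolding A_def a_def[symmetric] by (simp add: abs_divide divide_right_mono)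
    also have "\<dots> \<le> \<bar>\<Sum>k\<in>lattice_box ?j. y k\<bar> / b + M * (1 - b / a)"
      using ab by (simp add: add_divide_distrib diff_divide_distrib right_diff_distrib frac_le)
    also have "\<bar>\<Sum>k\<in>lattice_box ?j. y k\<bar> / b = \<bar>A ?j\<bar>"
      using ab(2) unfolding A_def b_def[symmetric] by (simp add: abs_divide del: of_nat_power)
    also have "M * (1 - b / a) \<le> M * (1 - ((real (s n) / (1 + real (s n)))\<^sup>2) ^ ?d)"
    proof -
      have "(real (s n) / (1 + real (s n)))\<^sup>2 \<le> real ?j / real n"
      proof -
        have "real n \<le> (1 + real (s n))\<^sup>2"
          using j(2) by (metis less_imp_le of_nat_Suc of_nat_le_iff of_nat_power add.commute)
        then show ?thesis using n by (simp add: power_divide frac_le)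
      qed
      then have "((real (s n) / (1 + real (s n)))\<^sup>2) ^ ?d \<le> (real ?j / real n) ^ ?d"
        by (intro power_mono) auto
      also have "\<dots> = b / a" using n by (simp add: a_def b_def power_divide power_mult_distrib)
      finally show ?thesis using M0 by (intro mult_left_mono) auto
    qed
    finally show ?thesis by simp
  qed
  have "\<forall>\<^sub>F n in sequentially. norm (A n) \<le> \<bar>A ((s n)\<^sup>2)\<bar> + M * (1 - ((real (s n) / (1 + real (s n)))\<^sup>2) ^ ?d)"
    by (intro eventually_mono[OF eventually_gt_at_top[of 0]]) (use A_bound in auto)
  then have "A \<longlonglongrightarrow> 0"
    by (rule Lim_null_comparison) (use tendsto_add[OF 1 2] in simp)
  then show ?thesis unfolding A_def .
qed

section \<open>Maximal inequality and second-moment argument for a stationary law\<close>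

locale stationary_config = prob_space P for P :: "'a::euclidean_space set measure" +
  assumes sets_P [measurable_cong]: "sets P = sets config_space"
    and stationary: "distr P P (translate_conf u) = P"
begin

lemma space_P: "space P = {\<gamma>. locally_finite_conf \<gamma>}"
  using sets_eq_imp_space_eq[OF sets_P] by (simp add: space_config_space)

lemma measurable_translate [measurable]: "translate_conf u \<in> measurable P P"
  using measurable_translate_conf by (simp cong: measurable_cong_sets add: sets_P)

lemma translate_space: "\<gamma> \<in> space P \<Longrightarrow> translate_conf u \<gamma> \<in> space P"
  by (rule measurable_space[OF measurable_translate])

lemma nn_integral_translate:
  "f \<in> borel_measurable P \<Longrightarrow> (\<integral>\<^sup>+\<gamma>. f (translate_conf u \<gamma>) \<partial>P) = (\<integral>\<^sup>+\<gamma>. f \<gamma> \<partial>P)"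
  using nn_integral_distr[of "translate_conf u" P P f] by (simp add: stationary)

lemma integral_translate:
  fixes f :: "'a set \<Rightarrow> real"
  shows "f \<in> borel_measurable P \<Longrightarrow> (\<integral>\<gamma>. f (translate_conf u \<gamma>) \<partial>P) = (\<integral>\<gamma>. f \<gamma> \<partial>P)"
  using integral_distr[of "translate_conf u" P P f] by (simp add: stationary)

lemma integrable_translate:
  fixes f :: "'a set \<Rightarrow> real"
  shows "integrable P f \<Longrightarrow> integrable P (\<lambda>\<gamma>. f (translate_conf u \<gamma>))"
  using integrable_distr[of "translate_conf u" P P f] by (simp add: stationary)

lemma AE_translate: "AE \<gamma> in P. Q \<gamma> \<Longrightarrow> AE \<gamma> in P. Q (translate_conf u \<gamma>)"
  by (metis AE_distrD measurable_translate stationary)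

text \<open>Transference: for fixed \<open>\<gamma>\<close> the covering lemma bounds the number of
  bad sites in the box of radius \<open>N\<close> by a sum over the box of radius
  \<open>2 * N\<close>, and after integration every site contributes the same. The constant
  \<open>4^d\<close> is \<open>2^d\<close> from the covering times \<open>2^d\<close> from the ratio
  of the two boxes.\<close>

lemma maximal_inequality:
  fixes Z :: "'a set \<Rightarrow> real"
  assumes Z: "integrable P Z" "\<And>\<gamma>. Z \<gamma> \<ge> 0" and t: "t > 0"
  defines "avg \<equiv> \<lambda>n \<gamma>. \<Sum>k\<in>lattice_box n. Z (shift_conf k \<gamma>)"
  shows "prob {\<gamma> \<in> space P. \<exists>n>0. t * (2 * real n) ^ DIM('a) < avg n \<gamma>}
          \<le> 4 ^ DIM('a) * (\<integral>\<gamma>. Z \<gamma> \<partial>P) / t"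
proof -
  let ?d = "DIM('a)"
  \<comment> \<open>Radii are capped at \<open>N\<close> so that boxes around sites of
    \<open>lattice_box N\<close> stay inside \<open>lattice_box (2 * N)\<close>; monotone continuity
    removes the cap at the end.\<close>
  define E where "E N = {\<gamma> \<in> space P. \<exists>n\<in>{1..N}. t * (2 * real n) ^ ?d < avg n \<gamma>}" for N
  have [measurable]: "Z \<in> borel_measurable P" using Z by simp
  have [measurable]: "avg n \<in> borel_measurable P" for n
    unfolding avg_def by measurable
  have E[measurable]: "E N \<in> sets P" for N unfolding E_def by measurable
  have bound: "prob (E N) \<le> 4 ^ ?d * (\<integral>\<gamma>. Z \<gamma> \<partial>P) / t" if N: "N > 0" for N
  proof -
    have pw: "t * (\<Sum>j\<in>lattice_box N. indicator (E N) (shift_conf j \<gamma>))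
        \<le> 2 ^ ?d * (\<Sum>k\<in>lattice_box (2 * N). Z (shift_conf k \<gamma>))" for \<gamma>
    proof -
      define B where "B = {j \<in> lattice_box N. shift_conf j \<gamma> \<in> E N}"
      have "\<forall>j\<in>B. \<exists>n. 0 < n \<and> n \<le> N \<and> t * (2 * real n) ^ ?d < avg n (shift_conf j \<gamma>)"
        by (auto simp: B_def E_def Suc_le_eq)
      then obtain \<nu> where \<nu>: "\<And>j. j \<in> B \<Longrightarrow> 0 < \<nu> j \<and> \<nu> j \<le> N \<and>
          t * (2 * real (\<nu> j)) ^ ?d < avg (\<nu> j) (shift_conf j \<gamma>)" by metis
      have "t * real (card B) \<le> 2 ^ ?d * (\<Sum>k\<in>lattice_box (2 * N). Z (shift_conf k \<gamma>))"
      proof (rule lattice_covering[where \<nu> = \<nu>])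
        fix j assume j: "j \<in> B"
        show "\<nu> j > 0" using \<nu>[OF j] by simp
        show "(+) j ` lattice_box (\<nu> j) \<subseteq> lattice_box (2 * N)"
        proof
          fix x assume "x \<in> (+) j ` lattice_box (\<nu> j)"
          then obtain k where k: "k \<in> lattice_box (\<nu> j)" "x = j + k" by blast
          then have "k \<in> lattice_box N" using lattice_box_mono[of "\<nu> j" N] \<nu>[OF j] by blast
          then have "j + k \<in> lattice_box (N + N)" using j by (intro lattice_box_add) (auto simp: B_def)
          then show "x \<in> lattice_box (2 * N)" using k by (simp add: mult_2)
        qed
        have "avg (\<nu> j) (shift_conf j \<gamma>) = (\<Sum>k\<in>lattice_box (\<nu> j). Z (shift_conf (j + k) \<gamma>))"
          by (simp add: avg_def translate_conf_simps)
        then show "t * (2 * real (\<nu> j)) ^ ?d \<le> (\<Sum>k\<in>lattice_box (\<nu> j). Z (shift_conf (j + k) \<gamma>))"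
          using \<nu>[OF j] by simp
      qed (use t Z in \<open>auto simp: B_def\<close>)
      also have "real (card B) = (\<Sum>j\<in>lattice_box N. indicator (E N) (shift_conf j \<gamma>))"
        by (simp add: indicator_def sum.If_cases B_def Int_def)
      finally show ?thesis .
    qed
    have E_int: "integrable P (indicat_real (E N))"
      by (rule integrable_real_indicator) (simp_all add: emeasure_eq_measure)
    have "t * (\<Sum>j\<in>(lattice_box N :: 'a set). prob (E N))
        = t * (\<Sum>j\<in>lattice_box N. \<integral>\<gamma>. indicator (E N) (shift_conf (j::'a) \<gamma>) \<partial>P)"
      by (subst integral_translate) auto
    also have "\<dots> = (\<integral>\<gamma>. t * (\<Sum>j\<in>lattice_box N. indicator (E N) (shift_conf (j::'a) \<gamma>)) \<partial>P)"
      using E_int by (simp add: Bochner_Integration.integral_sum integrable_translate[OF E_int] del: integral_indicator)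
    also have "\<dots> \<le> (\<integral>\<gamma>. 2 ^ ?d * (\<Sum>k\<in>lattice_box (2 * N). Z (shift_conf k \<gamma>)) \<partial>P)"
      by (intro integral_mono pw integrable_mult_right Bochner_Integration.integrable_sum
          integrable_translate Z(1) integrable_translate[OF E_int])
    also have "\<dots> = 2 ^ ?d * (\<Sum>k\<in>(lattice_box (2 * N) :: 'a set). \<integral>\<gamma>. Z \<gamma> \<partial>P)"
      by (simp add: Bochner_Integration.integral_sum integrable_translate[OF Z(1)] integral_translate)
    finally have "t * (2 * real N) ^ ?d * prob (E N) \<le> 2 ^ ?d * (4 * real N) ^ ?d * (\<integral>\<gamma>. Z \<gamma> \<partial>P)"
      by (simp add: card_lattice_box)
    also have "(4 * real N) ^ ?d = 2 ^ ?d * (2 * real N) ^ ?d"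
      by (subst power_mult_distrib[symmetric]) simp
    also have "2 ^ ?d * (2 ^ ?d * (2 * real N) ^ ?d) * (\<integral>\<gamma>. Z \<gamma> \<partial>P)
       = (2 * real N) ^ ?d * (4 ^ ?d * (\<integral>\<gamma>. Z \<gamma> \<partial>P))"
    proof -
      have "(4::real) ^ ?d = 2 ^ ?d * 2 ^ ?d" by (subst power_mult_distrib[symmetric]) simp
      then show ?thesis by (simp only: mult_ac)
    qed
    finally have "(2 * real N) ^ ?d * (t * prob (E N)) \<le> (2 * real N) ^ ?d * (4 ^ ?d * (\<integral>\<gamma>. Z \<gamma> \<partial>P))"
      by (simp add: mult_ac)
    then have "t * prob (E N) \<le> 4 ^ ?d * (\<integral>\<gamma>. Z \<gamma> \<partial>P)"
      using N by (subst (asm) mult_le_cancel_left_pos) auto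
    then show ?thesis using t by (simp add: field_simps)
  qed
  have "(\<lambda>N. prob (E N)) \<longlonglongrightarrow> prob (\<Union>N. E N)"
    by (rule finite_Lim_measure_incseq) (auto simp: incseq_def E_def intro: order_trans)
  then have "prob (\<Union>N. E N) \<le> 4 ^ ?d * (\<integral>\<gamma>. Z \<gamma> \<partial>P) / t"
    by (rule LIMSEQ_le_const2) (use bound in \<open>auto intro!: exI[of _ 1]\<close>)
  also have "(\<Union>N. E N) = {\<gamma> \<in> space P. \<exists>n>0. t * (2 * real n) ^ ?d < avg n \<gamma>}"
    by (force simp: E_def Suc_le_eq)
  finally show ?thesis .
qed

text \<open>Each site is correlated with boundedly many others, so the sum over a box has second
  moment of the order of the number of sites. Along squares the normalised second moments are
  summable in every dimension, and boundedness fills the gaps.\<close>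

lemma bounded_orthogonal_lln:
  fixes Y :: "'a set \<Rightarrow> real"
  assumes Y [measurable]: "Y \<in> borel_measurable P" and M: "\<And>\<gamma>. \<bar>Y \<gamma>\<bar> \<le> M"
    and orth: "\<And>k. (\<forall>b\<in>Basis. k \<bullet> b \<in> \<int>) \<Longrightarrow> k \<notin> lattice_box m \<Longrightarrow>
                 (\<integral>\<gamma>. Y \<gamma> * Y (shift_conf k \<gamma>) \<partial>P) = 0"
  shows "AE \<gamma> in P. (\<lambda>n. (\<Sum>k\<in>lattice_box n. Y (shift_conf k \<gamma>)) / (2 * real n) ^ DIM('a)) \<longlonglongrightarrow> 0"
proof -
  let ?d = "DIM('a)"
  define S where "S n \<gamma> = (\<Sum>k\<in>lattice_box n. Y (shift_conf k \<gamma>))" for n \<gamma>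
  define C where "C = M\<^sup>2 * (2 * real m) ^ ?d"
  have [measurable]: "S n \<in> borel_measurable P" for n unfolding S_def by measurable
  have M0: "M \<ge> 0" using M[of undefined] by linarith
  have M2: "\<bar>Y \<gamma> * Y \<gamma>'\<bar> \<le> M\<^sup>2" for \<gamma> \<gamma>'
    unfolding abs_mult power2_eq_square by (intro mult_mono M M0) auto
  have int: "integrable P (\<lambda>\<gamma>. Y (shift_conf j \<gamma>) * Y (shift_conf k \<gamma>))" for j k
    by (rule integrable_const_bound[where B = "M\<^sup>2"]) (use M2 in auto)
  have second_moment: "(\<integral>\<gamma>. (S n \<gamma>)\<^sup>2 \<partial>P) \<le> C * (2 * real n) ^ ?d" for n
  proof -
    have cov: "(\<integral>\<gamma>. Y (shift_conf j \<gamma>) * Y (shift_conf k \<gamma>) \<partial>P) \<le> M\<^sup>2 * indicator (lattice_box m) (k - j)"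
      if "j \<in> lattice_box n" "k \<in> lattice_box n" for j k
    proof -
      have "(\<integral>\<gamma>. Y (shift_conf j \<gamma>) * Y (shift_conf k \<gamma>) \<partial>P)
         = (\<integral>\<gamma>. (\<lambda>\<gamma>. Y \<gamma> * Y (shift_conf (k - j) \<gamma>)) (shift_conf j \<gamma>) \<partial>P)"
        by (simp add: translate_conf_simps)
      also have "\<dots> = (\<integral>\<gamma>. Y \<gamma> * Y (shift_conf (k - j) \<gamma>) \<partial>P)"
        by (rule integral_translate) measurable
      finally have eq: "(\<integral>\<gamma>. Y (shift_conf j \<gamma>) * Y (shift_conf k \<gamma>) \<partial>P) = \<dots>" .
      show ?thesis
      proof (cases "k - j \<in> lattice_box m")
        case True
        have "(\<integral>\<gamma>. Y \<gamma> * Y (shift_conf (k - j) \<gamma>) \<partial>P) \<le> M\<^sup>2"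
          using int[of 0 "k - j"] M2 by (intro integral_le_const) (auto simp: translate_conf_simps abs_le_iff)
        then show ?thesis using eq True by simp
      next
        case False
        then show ?thesis
          using that by (subst eq, subst orth) (auto simp: lattice_box_def inner_diff_left)
      qed
    qed
    have "(\<integral>\<gamma>. (S n \<gamma>)\<^sup>2 \<partial>P)
       = (\<integral>\<gamma>. (\<Sum>j\<in>lattice_box n. \<Sum>k\<in>lattice_box n. Y (shift_conf j \<gamma>) * Y (shift_conf k \<gamma>)) \<partial>P)"
      by (simp add: S_def power2_eq_square sum_product)
    also have "\<dots> = (\<Sum>j\<in>lattice_box n. \<Sum>k\<in>lattice_box n. \<integral>\<gamma>. Y (shift_conf j \<gamma>) * Y (shift_conf k \<gamma>) \<partial>P)"
      by (simp add: Bochner_Integration.integral_sum int Bochner_Integration.integrable_sum)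
    also have "\<dots> \<le> (\<Sum>j\<in>lattice_box n. \<Sum>k\<in>lattice_box n. M\<^sup>2 * indicator (lattice_box m) (k - j :: 'a))"
      by (rule sum_mono, rule sum_mono, rule cov)
    also have "\<dots> \<le> (\<Sum>j\<in>(lattice_box n :: 'a set). C)"
    proof (rule sum_mono)
      fix j :: 'a
      have "(\<Sum>k\<in>lattice_box n. M\<^sup>2 * indicator (lattice_box m) (k - j))
         = M\<^sup>2 * real (card {k \<in> lattice_box n. k - j \<in> lattice_box m})"
        by (simp add: indicator_def sum.If_cases Int_def flip: sum_distrib_left)
      also have "\<dots> \<le> M\<^sup>2 * real (card (lattice_box m :: 'a set))"
        by (intro mult_left_mono of_nat_mono card_inj_on_le[of "\<lambda>k. k - j"]) (auto simp: inj_on_def)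
      also have "\<dots> = C" by (simp add: card_lattice_box C_def)
      finally show "(\<Sum>k\<in>lattice_box n. M\<^sup>2 * indicator (lattice_box m) (k - j)) \<le> C" .
    qed
    also have "\<dots> = C * (2 * real n) ^ ?d" by (simp add: card_lattice_box)
    finally show ?thesis .
  qed
  define A where "A n \<gamma> = S n \<gamma> / (2 * real n) ^ ?d" for n \<gamma>
  have [measurable]: "A n \<in> borel_measurable P" for n unfolding A_def by measurable
  have Sb: "\<bar>S n \<gamma>\<bar> \<le> M * (2 * real n) ^ ?d" for n \<gamma>
  proof -
    have "\<bar>S n \<gamma>\<bar> \<le> (\<Sum>k\<in>(lattice_box n :: 'a set). M)"
      unfolding S_def by (rule order_trans[OF sum_abs]) (rule sum_mono, rule M)
    then show ?thesis by (simp add: card_lattice_box mult.commute)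
  qed
  have C0: "C \<ge> 0" by (simp add: C_def)
  \<comment> \<open>A series of nonnegative variables with finite expectation converges almost
    surely, so its terms tend to \<open>0\<close>. The index \<open>Suc j\<close> avoids the empty
    box.\<close>
  have "(\<integral>\<^sup>+\<gamma>. (\<Sum>j. ennreal ((A ((Suc j)\<^sup>2) \<gamma>)\<^sup>2)) \<partial>P) = (\<Sum>j. \<integral>\<^sup>+\<gamma>. ennreal ((A ((Suc j)\<^sup>2) \<gamma>)\<^sup>2) \<partial>P)"
    by (intro nn_integral_suminf) measurable
  also have "\<dots> \<le> (\<Sum>j. ennreal (C * inverse (real (Suc j) ^ 2)))"
  proof (intro suminf_le summableI)
    fix j
    let ?n = "(Suc j)\<^sup>2" let ?a = "(2 * real ((Suc j)\<^sup>2)) ^ ?d"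
    have a: "?a > 0" by simp
    have "(\<integral>\<^sup>+\<gamma>. ennreal ((A ?n \<gamma>)\<^sup>2) \<partial>P) = ennreal (\<integral>\<gamma>. (A ?n \<gamma>)\<^sup>2 \<partial>P)"
    proof (rule nn_integral_eq_integral)
      show "integrable P (\<lambda>\<gamma>. (A ?n \<gamma>)\<^sup>2)"
      proof (rule integrable_const_bound[where B = "M\<^sup>2"])
        have "\<bar>A ?n \<gamma>\<bar> \<le> M" for \<gamma>
          using Sb[of ?n \<gamma>] a unfolding A_def abs_divide by (subst pos_divide_le_eq) auto
        then show "AE \<gamma> in P. norm ((A ?n \<gamma>)\<^sup>2) \<le> M\<^sup>2"
          by (simp add: abs_le_square_iff[symmetric] M0)
      qed measurable
    qed simp
    also have "(\<integral>\<gamma>. (A ?n \<gamma>)\<^sup>2 \<partial>P) = (\<integral>\<gamma>. (S ?n \<gamma>)\<^sup>2 \<partial>P) / ?a\<^sup>2"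
      by (simp add: A_def power_divide)
    also have "\<dots> \<le> C * ?a / ?a\<^sup>2"
      by (intro divide_right_mono second_moment) simp
    also have "\<dots> = C / ?a" using a by (simp add: power2_eq_square)
    also have "\<dots> \<le> C * inverse (real (Suc j) ^ 2)"
    proof -
      have "real (Suc j) ^ 2 \<le> 2 * real ((Suc j)\<^sup>2)" by simp
      also have "\<dots> \<le> ?a" by (rule self_le_power) (auto simp: power2_eq_square)
      finally show ?thesis
        unfolding divide_inverse using C0 by (intro mult_left_mono le_imp_inverse_le) auto
    qed
    finally show "(\<integral>\<^sup>+\<gamma>. ennreal ((A ?n \<gamma>)\<^sup>2) \<partial>P) \<le> ennreal (C * inverse (real (Suc j) ^ 2))"
      by (simp add: ennreal_leI)
  qed
  also have "\<dots> < \<infinity>"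
  proof -
    have "summable (\<lambda>j. C * inverse (real (Suc j) ^ 2))"
      by (intro summable_mult) (subst summable_Suc_iff, rule inverse_power_summable, simp)
    then show ?thesis using C0 by (subst suminf_ennreal2) auto
  qed
  finally have "AE \<gamma> in P. (\<Sum>j. ennreal ((A ((Suc j)\<^sup>2) \<gamma>)\<^sup>2)) \<noteq> \<infinity>"
    by (intro nn_integral_PInf_AE) auto
  then show ?thesis
  proof eventually_elim
    case (elim \<gamma>)
    then have "summable (\<lambda>j. (A ((Suc j)\<^sup>2) \<gamma>)\<^sup>2)"
      by (intro summable_suminf_not_top) auto
    then have "(\<lambda>j. (A ((Suc j)\<^sup>2) \<gamma>)\<^sup>2) \<longlonglongrightarrow> 0" by (rule summable_LIMSEQ_zero)
    then have "(\<lambda>j. A ((Suc j)\<^sup>2) \<gamma>) \<longlonglongrightarrow> 0" by (simp add: tendsto_null_power)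
    then have "(\<lambda>j. A (j\<^sup>2) \<gamma>) \<longlonglongrightarrow> 0"
      using filterlim_sequentially_Suc[of "\<lambda>j. A (j\<^sup>2) \<gamma>"] by simp
    then show ?case
      using M unfolding A_def S_def by (intro lattice_average_subsequence) auto
  qed
qed

end

section \<open>Energies of finite range\<close>

lemma enlarge_singleton: "enlarge {x} R = cball x R"
  by (simp add: enlarge_def)

lemma compact_enlarge:
  assumes "compact \<Delta>"
  shows "compact (enlarge \<Delta> R)"
proof -
  have "enlarge \<Delta> R = {x + y | x y. x \<in> \<Delta> \<and> y \<in> cball 0 R}"
    by (force simp: enlarge_def dist_norm norm_minus_commute
        intro: exI[of _ "_ - _"])
  then show ?thesis using compact_sums[OF assms compact_cball[of 0 R]] by (simp only:)
qed

locale stationary_finite_range_energy =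
  fixes H :: "'a::euclidean_space set \<Rightarrow> ereal" and R :: real
  assumes energy: "energy_function H" and stationary_energy: "stationary_energy H"
    and finite_range: "finite_range H R" and R_pos: "R > 0"
begin

text \<open>With the convention \<open>\<infinity> - \<infinity> = 0\<close>, the finite range identity excludes infinite energies: if
  \<open>\<gamma>\<^sub>0\<close> is a minimal configuration of infinite energy, then adding a distant translate of \<open>\<gamma>\<^sub>0\<close>
  turns the energy difference of a point of \<open>\<gamma>\<^sub>0\<close> from \<open>\<infinity>\<close> into \<open>0\<close>.\<close>

lemma energy_finite:
  assumes "finite \<gamma>"
  shows "\<bar>H \<gamma>\<bar> \<noteq> \<infinity>"
proof -
  have not_minf: "H \<xi> \<noteq> - \<infinity>" if "finite \<xi>" for \<xi>
  proof -
    obtain A :: real where "\<forall>\<gamma>. finite \<gamma> \<longrightarrow> H \<gamma> \<ge> ereal (- A * real (card \<gamma>))"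
      using energy by (auto simp: energy_function_def)
    then have "H \<xi> \<ge> ereal (- A * real (card \<xi>))" using that by blast
    then show ?thesis by auto
  qed
  have hered: "H \<xi>' < \<infinity>" if "finite \<xi>" "\<xi>' \<subseteq> \<xi>" "H \<xi> < \<infinity>" for \<xi> \<xi>'
    using energy that unfolding energy_function_def by blast
  have "H \<gamma> \<noteq> \<infinity>"
  proof
    assume "H \<gamma> = \<infinity>"
    then have "\<exists>n \<gamma>. finite \<gamma> \<and> card \<gamma> = n \<and> H \<gamma> = \<infinity>" using assms by blast
    then obtain \<gamma>0 where fin: "finite \<gamma>0" and inf: "H \<gamma>0 = \<infinity>"
      and min: "\<And>\<xi>. finite \<xi> \<Longrightarrow> card \<xi> < card \<gamma>0 \<Longrightarrow> H \<xi> \<noteq> \<infinity>"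
      using exists_least_iff[of "\<lambda>n. \<exists>\<gamma>. finite \<gamma> \<and> card \<gamma> = n \<and> H \<gamma> = \<infinity>"] by metis
    have "H {} < \<infinity>" using energy by (simp add: energy_function_def)
    then have "\<gamma>0 \<noteq> {}" using inf by auto
    then obtain x where x: "x \<in> \<gamma>0" by blast
    have "bounded \<gamma>0" using fin by (rule finite_imp_bounded)
    then obtain r where r: "\<And>y. y \<in> \<gamma>0 \<Longrightarrow> norm y \<le> r" by (auto simp: bounded_iff)
    have r0: "r \<ge> 0" using r[OF x] norm_ge_zero[of x] by linarith
    obtain b :: 'a where b: "b \<in> Basis" using nonempty_Basis by blast
    \<comment> \<open>With \<open>\<gamma>0\<close> inside the ball of radius \<open>r\<close>, a
      shift of length \<open>2 * r + R + 1\<close> puts every translated point at distance more than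
      \<open>R\<close> from \<open>x\<close>.\<close>
    define u where "u = (2 * r + R + 1) *\<^sub>R b"
    have nu: "norm u = 2 * r + R + 1" using b r0 R_pos by (simp add: u_def)
    define \<gamma>1 where "\<gamma>1 = translate_conf u \<gamma>0"
    have fin1: "finite \<gamma>1" using fin by (simp add: \<gamma>1_def finite_translate_conf)
    have far: "R < dist x y" if "y \<in> \<gamma>1" for y
    proof -
      have "norm (y - u) \<le> r" "norm x \<le> r" using that r x by (auto simp: \<gamma>1_def mem_translate_conf)
      moreover have "norm u \<le> norm (y - x) + norm (y - u) + norm x"
        using norm_triangle_ineq4[of "y - x" "y - u"] norm_triangle_ineq[of "y - x - (y - u)" x] by simp
      ultimately show ?thesis using nu by (simp add: dist_norm norm_minus_commute)
    qed
    have inf1: "H \<gamma>1 = \<infinity>"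
      using stationary_energy fin inf by (simp add: stationary_energy_def \<gamma>1_def)
    let ?\<gamma> = "\<gamma>0 \<union> \<gamma>1"
    have "x \<notin> \<gamma>1" using far R_pos by force
    \<comment> \<open>Heredity: each of the two sets still contains a copy of infinite energy, the
      second one because \<open>x\<close> is not in \<open>\<gamma>1\<close>.\<close>
    then have H\<gamma>: "H ?\<gamma> = \<infinity>" "H (?\<gamma> - {x}) = \<infinity>"
      using hered[of ?\<gamma> \<gamma>0] hered[of "?\<gamma> - {x}" \<gamma>1] fin fin1 inf inf1 by auto
    have near: "?\<gamma> \<inter> cball x R = \<gamma>0 \<inter> cball x R"
      using far by (force simp: not_le)
    have loc: "ediff (H \<xi>) (H (\<xi> - {x})) = ediff (H (\<xi> \<inter> cball x R)) (H (\<xi> \<inter> cball x R - {x}))"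
      if "finite \<xi>" for \<xi>
      using finite_range[unfolded finite_range_def, rule_format, of "{x}" \<xi>] that
      by (simp add: enlarge_singleton)
    have "ediff (H \<gamma>0) (H (\<gamma>0 - {x})) = ediff (H (?\<gamma> \<inter> cball x R)) (H (?\<gamma> \<inter> cball x R - {x}))"
      unfolding near by (rule loc[OF fin])
    also have "\<dots> = ediff (H ?\<gamma>) (H (?\<gamma> - {x}))"
      using fin fin1 by (intro loc[symmetric]) simp
    finally have "ediff (H \<gamma>0) (H (\<gamma>0 - {x})) = ediff \<infinity> \<infinity>" unfolding H\<gamma> .
    \<comment> \<open>Minimality makes the subtracted energy finite, so this difference is really
      infinite, against the value \<open>0\<close> produced by the convention.\<close>
    moreover have "card (\<gamma>0 - {x}) < card \<gamma>0" using fin x by (rule card_Diff1_less)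
    then have "H (\<gamma>0 - {x}) \<noteq> \<infinity>" using min fin by blast
    then have "ediff (H \<gamma>0) (H (\<gamma>0 - {x})) = \<infinity>"
      using inf not_minf[of "\<gamma>0 - {x}"] fin by (cases "H (\<gamma>0 - {x})") (auto simp: ediff_def)
    ultimately show False by (simp add: ediff_def)
  qed
  then show ?thesis using not_minf[OF assms] by (cases "H \<gamma>") auto
qed

text \<open>Faithful on finite sets by \<open>energy_finite\<close>, as is \<open>hr\<close> on
  locally finite ones; elsewhere the value may be a mere default of
  \<open>real_of_ereal\<close>.\<close>

definition Hr :: "'a set \<Rightarrow> real" where "Hr \<gamma> = real_of_ereal (H \<gamma>)"

definition hr :: "'a \<Rightarrow> 'a set \<Rightarrow> real" where "hr x \<gamma> = real_of_ereal (h_loc H R x \<gamma>)"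

lemma H_eq: "finite \<gamma> \<Longrightarrow> H \<gamma> = ereal (Hr \<gamma>)"
  using energy_finite by (simp add: Hr_def ereal_real)

lemma ediff_ereal: "ediff (ereal a) (ereal b) = ereal (a - b)"
  by (simp add: ediff_def)

lemma h_loc_energies:
  assumes "locally_finite_conf \<gamma>"
  shows "h_loc H R x \<gamma> = ereal (Hr (insert x (\<gamma> \<inter> cball x R)) - Hr (\<gamma> \<inter> cball x R))"
  using locally_finite_confD[OF assms bounded_cball, of x R]
  by (simp add: h_loc_def H_eq ediff_ereal)

lemma h_loc_eq: "locally_finite_conf \<gamma> \<Longrightarrow> h_loc H R x \<gamma> = ereal (hr x \<gamma>)"
  by (simp add: hr_def h_loc_energies)

lemma hr_eq:
  "locally_finite_conf \<gamma> \<Longrightarrow> hr x \<gamma> = Hr (insert x (\<gamma> \<inter> cball x R)) - Hr (\<gamma> \<inter> cball x R)"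
  by (simp add: hr_def h_loc_energies)

text \<open>Valid for arbitrary sets, as \<open>h_loc\<close> only looks at the ball; the laws of
  large numbers below ask for locality at every set, not only at locally finite ones.\<close>

lemma hr_local: "\<gamma> \<inter> cball x R = \<gamma>' \<inter> cball x R \<Longrightarrow> hr x \<gamma> = hr x \<gamma>'"
  by (simp add: hr_def h_loc_def)

lemma Hr_translate: "finite \<gamma> \<Longrightarrow> Hr (translate_conf u \<gamma>) = Hr \<gamma>"
  using stationary_energy by (simp add: Hr_def stationary_energy_def)

lemma translate_conf_cball: "translate_conf u (cball x r) = cball (x + u) r"
  by (auto simp: mem_translate_conf dist_norm algebra_simps)

lemma hr_translate:
  assumes "locally_finite_conf \<gamma>"
  shows "hr (x + u) (translate_conf u \<gamma>) = hr x \<gamma>"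
proof -
  have "finite (\<gamma> \<inter> cball x R)" using assms by (rule locally_finite_confD) simp
  then show ?thesis
    using assms Hr_translate[of "insert x (\<gamma> \<inter> cball x R)" u] Hr_translate[of "\<gamma> \<inter> cball x R" u]
    by (simp add: hr_eq locally_finite_conf_translate translate_conf_simps translate_conf_cball)
qed

lemma hr_shift:
  assumes "locally_finite_conf \<gamma>"
  shows "hr (x - k) (translate_conf (- k) \<gamma>) = hr x \<gamma>"
  using hr_translate[OF assms, of x "- k"] by simp

lemma measurable_Hr:
  assumes f: "f \<in> measurable M config_space" and fin: "\<And>w. w \<in> space M \<Longrightarrow> finite (f w)"
  shows "(\<lambda>w. Hr (f w)) \<in> borel_measurable M"
proof -
  have "f \<in> measurable M fconfig_space"
    unfolding fconfig_space_def by (rule measurable_restrict_space2) (use f fin in auto)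
  moreover have "H \<in> borel_measurable fconfig_space"
    using energy by (simp add: energy_function_def)
  ultimately have "(\<lambda>w. H (f w)) \<in> borel_measurable M" by (rule measurable_compose)
  then show ?thesis unfolding Hr_def by measurable
qed

text \<open>Joint measurability in the point and the configuration, as Tonelli and the Mecke formula
  require; it comes from selecting the points in a ball with moving centre.\<close>

lemma measurable_hr:
  assumes f: "f \<in> measurable M config_space" and u: "u \<in> borel_measurable M"
  shows "(\<lambda>w. hr (u w) (f w)) \<in> borel_measurable M"
proof -
  have lf: "locally_finite_conf (f w)" if "w \<in> space M" for w
    using measurable_space[OF f that] by (simp add: space_config_space)
  have "Measurable.pred (M \<Otimes>\<^sub>M borel) (\<lambda>(w, y). dist (u w) y \<le> R)"
    using u by measurable
  from measurable_filter_config[OF f this]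
  have g: "(\<lambda>w. f w \<inter> cball (u w) R) \<in> measurable M config_space"
    by (simp add: cball_def Int_def)
  have "(\<lambda>w. Hr (insert (u w) (f w \<inter> cball (u w) R)) - Hr (f w \<inter> cball (u w) R)) \<in> borel_measurable M"
    using lf by (intro borel_measurable_diff measurable_Hr measurable_insert_config g u)
      (auto intro: locally_finite_confD)
  then show ?thesis using lf by (simp add: hr_eq cong: measurable_cong)
qed

definition HD :: "'a set \<Rightarrow> 'a set \<Rightarrow> real" where
  "HD \<Delta> \<gamma> = Hr (\<gamma> \<inter> enlarge \<Delta> R) - Hr (\<gamma> \<inter> enlarge \<Delta> R - \<Delta>)"

lemma H_Delta_eq:
  assumes "locally_finite_conf \<gamma>" "compact \<Delta>"
  shows "H_Delta H R \<Delta> \<gamma> = ereal (HD \<Delta> \<gamma>)"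
  using locally_finite_confD[OF assms(1) compact_imp_bounded[OF compact_enlarge[OF assms(2)]], of R]
  by (simp add: H_Delta_def HD_def H_eq ediff_ereal)

lemma HD_local: "\<gamma> \<inter> enlarge \<Delta> R = \<gamma>' \<inter> enlarge \<Delta> R \<Longrightarrow> HD \<Delta> \<gamma> = HD \<Delta> \<gamma>'"
  by (simp add: HD_def)

text \<open>The finite range identity for the singleton \<open>{y}\<close>, applied to the part of
  the configuration near \<open>\<Delta>\<close>: the energy gained is the local energy, while the
  subtracted energy outside \<open>\<Delta>\<close> does not see \<open>y\<close>.\<close>

lemma HD_insert:
  assumes lf: "locally_finite_conf \<gamma>" and \<Delta>: "compact \<Delta>" and y: "y \<in> \<Delta>" "y \<notin> \<gamma>"
  shows "HD \<Delta> (insert y \<gamma>) = HD \<Delta> \<gamma> + hr y \<gamma>"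
proof -
  let ?E = "enlarge \<Delta> R"
  have fin: "finite (\<gamma> \<inter> ?E)"
    using lf compact_imp_bounded[OF compact_enlarge[OF \<Delta>]] by (rule locally_finite_confD)
  have sub: "cball y R \<subseteq> ?E" using y by (auto simp: enlarge_def)
  have yE: "y \<in> ?E" using sub R_pos by auto
  let ?\<xi> = "\<gamma> \<inter> ?E"
  have "ediff (H (insert y ?\<xi>)) (H (insert y ?\<xi> - {y}))
      = ediff (H (insert y ?\<xi> \<inter> cball y R)) (H (insert y ?\<xi> \<inter> cball y R - {y}))"
    using finite_range[unfolded finite_range_def, rule_format, of "{y}" "insert y ?\<xi>"] fin
    by (simp only: enlarge_singleton) simp
  moreover have "insert y ?\<xi> - {y} = ?\<xi>" using y by auto
  moreover have "insert y ?\<xi> \<inter> cball y R = insert y (\<gamma> \<inter> cball y R)" using sub R_pos by auto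
  moreover have "insert y (\<gamma> \<inter> cball y R) - {y} = \<gamma> \<inter> cball y R" using y by auto
  moreover have "finite (\<gamma> \<inter> cball y R)" using lf by (rule locally_finite_confD) simp
  ultimately have "Hr (insert y ?\<xi>) - Hr ?\<xi> = hr y \<gamma>"
    using fin lf by (simp add: H_eq ediff_ereal hr_eq)
  moreover have "insert y \<gamma> \<inter> ?E = insert y ?\<xi>" using yE by auto
  moreover have "insert y ?\<xi> - \<Delta> = ?\<xi> - \<Delta>" using y by auto
  ultimately show ?thesis by (simp add: HD_def)
qed

lemma measurable_HD:
  assumes f: "f \<in> measurable M config_space" and \<Delta>: "compact \<Delta>"
  shows "(\<lambda>w. HD \<Delta> (f w)) \<in> borel_measurable M"
proof -
  have E: "compact (enlarge \<Delta> R)" using \<Delta> by (rule compact_enlarge)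
  have [measurable]: "\<Delta> \<in> sets borel" "enlarge \<Delta> R \<in> sets borel"
    using \<Delta> E by (auto intro: borel_compact)
  have lf: "locally_finite_conf (f w)" if "w \<in> space M" for w
    using measurable_space[OF f that] by (simp add: space_config_space)
  have "(\<lambda>w. {y \<in> f w. y \<in> enlarge \<Delta> R}) \<in> measurable M config_space"
    "(\<lambda>w. {y \<in> f w. y \<in> enlarge \<Delta> R \<and> y \<notin> \<Delta>}) \<in> measurable M config_space"
    by (rule measurable_filter_config[OF f]; measurable)+
  then have "(\<lambda>w. f w \<inter> enlarge \<Delta> R) \<in> measurable M config_space"
    "(\<lambda>w. f w \<inter> enlarge \<Delta> R - \<Delta>) \<in> measurable M config_space"
    by (simp_all add: Int_def set_diff_eq conj_assoc)
  then show ?thesis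
    unfolding HD_def using lf compact_imp_bounded[OF E]
    by (intro borel_measurable_diff measurable_Hr) (auto intro: locally_finite_confD)
qed

end

section \<open>The Mecke formula for the Poisson process\<close>

interpretation lborel_product: product_sigma_finite "\<lambda>_::nat. lborel :: 'a::euclidean_space measure"
  by standard

lemma measurable_image_config:
  assumes "finite I"
  shows "(\<lambda>x. x ` I) \<in> measurable (Pi\<^sub>M I (\<lambda>_::nat. lborel :: 'a::euclidean_space measure)) config_space"
proof -
  have "(\<lambda>x. {}) \<in> measurable (Pi\<^sub>M I (\<lambda>_::nat. lborel :: 'a measure)) config_space"
    by (rule measurable_const) (simp add: space_config_space locally_finite_conf_def)
  from measurable_union_config[OF this assms, of "\<lambda>i x. x i"]
  show ?thesis by simp
qed

text \<open>The \<open>n\<close>-point integral of the Poisson series, over an arbitrary index set: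
  removing one index from \<open>{..<n}\<close> need not leave an initial segment.\<close>

definition config_integral :: "'a::euclidean_space set \<Rightarrow> nat set \<Rightarrow> ('a set \<Rightarrow> ennreal) \<Rightarrow> ennreal" where
  "config_integral \<Delta> I F = (\<integral>\<^sup>+ x. (\<Prod>i\<in>I. indicator \<Delta> (x i)) * F (x ` I) \<partial>Pi\<^sub>M I (\<lambda>_. lborel))"

lemma poisson_nn_integral_eq:
  "poisson_nn_integral \<Delta> F = ennreal (exp (- measure lborel \<Delta>)) *
     (\<Sum>n. ennreal (1 / fact n) * config_integral \<Delta> {..<n} F)"
  by (simp add: poisson_nn_integral_def config_integral_def)

lemma measurable_config_integrand:
  fixes F :: "'a::euclidean_space set \<Rightarrow> ennreal"
  assumes "finite I" "\<Delta> \<in> sets borel" "F \<in> borel_measurable config_space"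
  shows "(\<lambda>x. (\<Prod>i\<in>I. indicator \<Delta> (x i)) * F (x ` I))
    \<in> borel_measurable (Pi\<^sub>M I (\<lambda>_::nat. lborel :: 'a::euclidean_space measure))"
proof -
  let ?P = "Pi\<^sub>M I (\<lambda>_::nat. lborel :: 'a measure)"
  have "(\<lambda>x. F (x ` I)) \<in> borel_measurable ?P"
    by (rule measurable_compose[OF measurable_image_config[OF assms(1)] assms(3)])
  moreover have "(\<lambda>x. indicator \<Delta> (x i) :: ennreal) \<in> borel_measurable ?P" if "i \<in> I" for i
    using that assms(2) by measurable
  then have "(\<lambda>x. \<Prod>i\<in>I. indicator \<Delta> (x i) :: ennreal) \<in> borel_measurable ?P"
    by (rule borel_measurable_prod_ennreal)
  ultimately show ?thesis by (intro borel_measurable_times_ennreal)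
qed

lemma prod_indicator_eq:
  "finite I \<Longrightarrow> (\<Prod>i\<in>I. indicator \<Delta> (x i) :: ennreal) = indicator {x. x ` I \<subseteq> \<Delta>} x"
  by (induction I rule: finite_induct) (auto simp: indicator_def)

lemma config_integral_cong:
  assumes "finite I" "\<And>\<xi>. finite \<xi> \<Longrightarrow> \<xi> \<subseteq> \<Delta> \<Longrightarrow> F \<xi> = G \<xi>"
  shows "config_integral \<Delta> I F = config_integral \<Delta> I G"
  unfolding config_integral_def prod_indicator_eq[OF assms(1)]
  using assms by (intro nn_integral_cong) (auto simp: indicator_def)

lemma poisson_cong:
  assumes "\<And>\<xi>. finite \<xi> \<Longrightarrow> \<xi> \<subseteq> \<Delta> \<Longrightarrow> F \<xi> = G \<xi>"
  shows "poisson_nn_integral \<Delta> F = poisson_nn_integral \<Delta> G"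
proof -
  have "config_integral \<Delta> {..<n} F = config_integral \<Delta> {..<n} G" for n
    by (rule config_integral_cong) (use assms in auto)
  then show ?thesis by (simp add: poisson_nn_integral_eq)
qed

lemma measurable_insert_fix:
  assumes "F \<in> borel_measurable config_space"
  shows "(\<lambda>\<xi>. F (insert y \<xi>)) \<in> borel_measurable config_space"
  by (rule measurable_compose[OF measurable_insert_config assms]) auto

lemma config_integral_insert:
  assumes I: "finite I" "i \<notin> I" and \<Delta>: "\<Delta> \<in> sets borel" and F: "F \<in> borel_measurable config_space"
  shows "config_integral \<Delta> (insert i I) F
    = (\<integral>\<^sup>+y. indicator \<Delta> y * config_integral \<Delta> I (\<lambda>\<xi>. F (insert y \<xi>)) \<partial>lborel)"
proof -
  have "config_integral \<Delta> (insert i I) F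
    = (\<integral>\<^sup>+y. \<integral>\<^sup>+x. (\<Prod>j\<in>insert i I. indicator \<Delta> ((x(i:=y)) j)) * F ((x(i:=y)) ` insert i I)
        \<partial>Pi\<^sub>M I (\<lambda>_. lborel) \<partial>lborel)"
    unfolding config_integral_def
    using I \<Delta> F by (intro lborel_product.product_nn_integral_insert_rev measurable_config_integrand) auto
  also have "\<dots> = (\<integral>\<^sup>+y. \<integral>\<^sup>+x. indicator \<Delta> y * ((\<Prod>j\<in>I. indicator \<Delta> (x j)) * F (insert y (x ` I)))
        \<partial>Pi\<^sub>M I (\<lambda>_. lborel) \<partial>lborel)"
  proof (intro nn_integral_cong)
    fix x :: "nat \<Rightarrow> 'a" and y :: 'a
    have "(\<Prod>j\<in>I. indicator \<Delta> ((x(i:=y)) j) :: ennreal) = (\<Prod>j\<in>I. indicator \<Delta> (x j))"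
      using I by (intro prod.cong) auto
    then have "(\<Prod>j\<in>insert i I. indicator \<Delta> ((x(i:=y)) j)) = indicator \<Delta> y * (\<Prod>j\<in>I. indicator \<Delta> (x j) :: ennreal)"
      by (simp only: prod.insert[OF I] fun_upd_same)
    moreover have "(x(i:=y)) ` insert i I = insert y (x ` I)" using I by auto
    ultimately show "(\<Prod>j\<in>insert i I. indicator \<Delta> ((x(i:=y)) j)) * F ((x(i:=y)) ` insert i I)
      = indicator \<Delta> y * ((\<Prod>j\<in>I. indicator \<Delta> (x j)) * F (insert y (x ` I)))"
      by (simp only: mult.assoc)
  qed
  also have "\<dots> = (\<integral>\<^sup>+y. indicator \<Delta> y * config_integral \<Delta> I (\<lambda>\<xi>. F (insert y \<xi>)) \<partial>lborel)"
    unfolding config_integral_def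
    using I \<Delta> measurable_insert_fix[OF F] by (intro nn_integral_cong nn_integral_cmult measurable_config_integrand)
  finally show ?thesis .
qed

text \<open>Induction on the size, splitting off one point on both sides. It restores the standard
  index set once an index has been removed.\<close>

lemma config_integral_card:
  assumes "finite I" "finite J" "card I = card J" "\<Delta> \<in> sets borel" "F \<in> borel_measurable config_space"
  shows "config_integral \<Delta> I F = config_integral \<Delta> J F"
  using assms
proof (induction I arbitrary: J F rule: finite_induct)
  case empty
  then show ?case by simp
next
  case (insert i I)
  from insert.prems insert.hyps have "card J = Suc (card I)" by simp
  then obtain j K where J: "J = insert j K" "j \<notin> K" "card K = card I"
    by (auto simp: card_Suc_eq)
  have K: "finite K" using insert.prems J by simp
  have "config_integral \<Delta> I (\<lambda>\<xi>. F (insert y \<xi>)) = config_integral \<Delta> K (\<lambda>\<xi>. F (insert y \<xi>))" for y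
    using insert.prems K J by (intro insert.IH measurable_insert_fix) auto
  then show ?case
    using insert J K by (simp add: config_integral_insert)
qed

text \<open>Passing from a tuple to its set of values forgets repetitions. A sum over the set is a
  sum over the indices only for injective tuples; these are almost all, since Lebesgue measure has
  no atoms.\<close>

lemma AE_distinct_PiM:
  assumes I: "finite I"
  shows "AE x in Pi\<^sub>M I (\<lambda>_::nat. lborel :: 'a::euclidean_space measure). inj_on x I"
proof -
  let ?P = "Pi\<^sub>M I (\<lambda>_::nat. lborel :: 'a measure)"
  have "AE x in ?P. x i \<noteq> x j" if ij: "i \<in> I" "j \<in> I" "i \<noteq> j" for i j
  proof -
    define K where "K = I - {i}"
    have K: "finite K" "i \<notin> K" "I = insert i K" "j \<in> K" using I ij by (auto simp: K_def)
    have [measurable]: "{x \<in> space ?P. x i = x j} \<in> sets ?P"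
      using ij by measurable
    have "emeasure ?P {x \<in> space ?P. x i = x j} = (\<integral>\<^sup>+x. indicator {x \<in> space ?P. x i = x j} x \<partial>?P)"
      by (rule nn_integral_indicator[symmetric]) measurable
    also have "\<dots> = (\<integral>\<^sup>+x. (if x i = x j then 1 else 0) \<partial>?P)"
      by (intro nn_integral_cong) (auto simp: indicator_def)
    also have "\<dots> = (\<integral>\<^sup>+x. \<integral>\<^sup>+y. (if (x(i:=y)) i = (x(i:=y)) j then 1 else 0) \<partial>lborel \<partial>Pi\<^sub>M K (\<lambda>_. lborel :: 'a measure))"
      unfolding K(3) using K ij by (intro lborel_product.product_nn_integral_insert) measurable
    also have "\<dots> = (\<integral>\<^sup>+x. \<integral>\<^sup>+y. indicator {x j} y \<partial>lborel \<partial>Pi\<^sub>M K (\<lambda>_. lborel :: 'a measure))"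
      using K by (intro nn_integral_cong) (auto simp: indicator_def)
    also have "\<dots> = 0" by simp
    finally show ?thesis by (subst AE_iff_measurable[OF _ refl]) auto
  qed
  then have "AE x in ?P. \<forall>i\<in>I. \<forall>j\<in>I. i \<noteq> j \<longrightarrow> x i \<noteq> x j"
    using I by (subst AE_finite_all, simp, safe, subst AE_finite_all) auto
  then show ?thesis by eventually_elim (auto simp: inj_on_def)
qed

lemma measurable_delete_config:
  assumes f: "f \<in> measurable M config_space" and u: "u \<in> borel_measurable M"
  shows "(\<lambda>w. f w - {u w}) \<in> measurable M config_space"
proof -
  have "Measurable.pred (M \<Otimes>\<^sub>M borel) (\<lambda>(w, y). y \<noteq> u w)" using u by measurable
  from measurable_filter_config[OF f this] show ?thesis by (simp add: set_diff_eq)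
qed

lemma measurable_pair_fix:
  assumes "(\<lambda>(x, \<xi>). G x \<xi>) \<in> borel_measurable (borel \<Otimes>\<^sub>M config_space)"
    and "f \<in> measurable M config_space" "u \<in> borel_measurable M"
  shows "(\<lambda>w. G (u w) (f w)) \<in> borel_measurable M"
  using measurable_compose[OF measurable_Pair[OF assms(3,2)] assms(1)] by simp

text \<open>Each point of the sum is integrated out first; the remaining integral depends only on the number of points.\<close>

lemma config_integral_sum:
  fixes G :: "'a::euclidean_space \<Rightarrow> 'a set \<Rightarrow> ennreal"
  assumes I: "finite I" and \<Delta>: "\<Delta> \<in> sets borel"
    and G: "(\<lambda>(x, \<xi>). G x \<xi>) \<in> borel_measurable (borel \<Otimes>\<^sub>M config_space)"
  shows "config_integral \<Delta> I (\<lambda>\<xi>. \<Sum>x\<in>\<xi>. G x (\<xi> - {x}))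
    = (\<Sum>i\<in>I. \<integral>\<^sup>+y. indicator \<Delta> y * config_integral \<Delta> (I - {i}) (G y) \<partial>lborel)"
proof -
  let ?P = "\<lambda>I. Pi\<^sub>M I (\<lambda>_::nat. lborel :: 'a measure)"
  let ?T = "\<lambda>i x. (\<Prod>i\<in>I. indicator \<Delta> (x i)) * G (x i) (x ` (I - {i}))"
  have im: "(\<lambda>x. x ` (I - {i})) \<in> measurable (?P I) config_space" for i
  proof -
    have "(\<lambda>x. {}) \<in> measurable (?P I) config_space"
      by (rule measurable_const) (simp add: space_config_space locally_finite_conf_def)
    from measurable_union_config[OF this, of "I - {i}" "\<lambda>i x. x i"] I show ?thesis by simp
  qed
  have meas: "?T i \<in> borel_measurable (?P I)" if "i \<in> I" for i
    using measurable_pair_fix[OF G im[of i], of "\<lambda>x. x i"] that \<Delta> by measurable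
  have "config_integral \<Delta> I (\<lambda>\<xi>. \<Sum>x\<in>\<xi>. G x (\<xi> - {x})) = (\<integral>\<^sup>+x. (\<Sum>i\<in>I. ?T i x) \<partial>?P I)"
    unfolding config_integral_def
  proof (rule nn_integral_cong_AE, use AE_distinct_PiM[OF I] in eventually_elim)
    case (elim x)
    have "(\<Sum>y\<in>x ` I. G y (x ` I - {y})) = (\<Sum>i\<in>I. G (x i) (x ` I - {x i}))"
      using elim by (simp add: sum.reindex)
    also have "\<dots> = (\<Sum>i\<in>I. G (x i) (x ` (I - {i})))"
      using elim by (intro sum.cong refl) (simp add: inj_on_image_set_diff[of x I])
    finally show ?case by (simp add: sum_distrib_left)
  qed
  also have "\<dots> = (\<Sum>i\<in>I. \<integral>\<^sup>+x. ?T i x \<partial>?P I)"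
    by (rule nn_integral_sum) (rule meas)
  also have "\<dots> = (\<Sum>i\<in>I. \<integral>\<^sup>+y. indicator \<Delta> y * config_integral \<Delta> (I - {i}) (G y) \<partial>lborel)"
  proof (intro sum.cong refl)
    fix i assume i: "i \<in> I"
    define K where "K = I - {i}"
    have K: "finite K" "i \<notin> K" "insert i K = I" using I i by (auto simp: K_def)
    have "(\<integral>\<^sup>+x. ?T i x \<partial>?P I) = (\<integral>\<^sup>+x. ?T i x \<partial>?P (insert i K))" using K by simp
    also have "\<dots> = (\<integral>\<^sup>+y. \<integral>\<^sup>+x. ?T i (x(i:=y)) \<partial>?P K \<partial>lborel)"
      using K meas[OF i] by (intro lborel_product.product_nn_integral_insert_rev) auto
    also have "\<dots> = (\<integral>\<^sup>+y. \<integral>\<^sup>+x. indicator \<Delta> y * ((\<Prod>j\<in>K. indicator \<Delta> (x j)) * G y (x ` K)) \<partial>?P K \<partial>lborel)"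
    proof (intro nn_integral_cong)
      fix x :: "nat \<Rightarrow> 'a" and y :: 'a
      have "(\<Prod>j\<in>K. indicator \<Delta> ((x(i:=y)) j) :: ennreal) = (\<Prod>j\<in>K. indicator \<Delta> (x j))"
        using K by (intro prod.cong) auto
      then have "(\<Prod>j\<in>insert i K. indicator \<Delta> ((x(i:=y)) j)) = indicator \<Delta> y * (\<Prod>j\<in>K. indicator \<Delta> (x j) :: ennreal)"
        by (simp only: prod.insert[OF K(1,2)] fun_upd_same)
      then have "(\<Prod>j\<in>I. indicator \<Delta> ((x(i:=y)) j)) = indicator \<Delta> y * (\<Prod>j\<in>K. indicator \<Delta> (x j) :: ennreal)"
        using K(3) by simp
      moreover have "(x(i:=y)) ` (I - {i}) = x ` K" by (auto simp: K_def)
      ultimately show "?T i (x(i:=y)) = indicator \<Delta> y * ((\<Prod>j\<in>K. indicator \<Delta> (x j)) * G y (x ` K))"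
        by (simp only: mult.assoc fun_upd_same)
    qed
    also have "\<dots> = (\<integral>\<^sup>+y. indicator \<Delta> y * config_integral \<Delta> K (G y) \<partial>lborel)"
      unfolding config_integral_def using K \<Delta> measurable_pair_fix[OF G measurable_ident_sets[OF refl], of "\<lambda>_. _"]
      by (intro nn_integral_cong nn_integral_cmult measurable_config_integrand) auto
    finally show "(\<integral>\<^sup>+x. ?T i x \<partial>?P I) = (\<integral>\<^sup>+y. indicator \<Delta> y * config_integral \<Delta> (I - {i}) (G y) \<partial>lborel)"
      by (simp add: K_def)
  qed
  finally show ?thesis .
qed

lemma measurable_config_integral:
  assumes I: "finite I" and \<Delta>: "\<Delta> \<in> sets borel"
    and F: "(\<lambda>(w, \<xi>). F w \<xi>) \<in> borel_measurable (M \<Otimes>\<^sub>M config_space)"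
  shows "(\<lambda>w. config_integral \<Delta> I (F w)) \<in> borel_measurable M"
proof -
  interpret P: sigma_finite_measure "Pi\<^sub>M I (\<lambda>_::nat. lborel :: 'a measure)"
    by (rule lborel_product.sigma_finite[OF I])
  have "(\<lambda>(w, x). (w, x ` I)) \<in> measurable (M \<Otimes>\<^sub>M Pi\<^sub>M I (\<lambda>_::nat. lborel :: 'a measure)) (M \<Otimes>\<^sub>M config_space)"
    using measurable_compose[OF measurable_snd measurable_image_config[OF I]]
    by (auto simp: split_beta' intro!: measurable_Pair)
  from measurable_compose[OF this F]
  have "(\<lambda>(w, x). F w (x ` I)) \<in> borel_measurable (M \<Otimes>\<^sub>M Pi\<^sub>M I (\<lambda>_::nat. lborel))"
    by (simp add: split_beta')
  then have "(\<lambda>(w, x). (\<Prod>i\<in>I. indicator \<Delta> (x i)) * F w (x ` I)) \<in> borel_measurable (M \<Otimes>\<^sub>M Pi\<^sub>M I (\<lambda>_::nat. lborel))"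
    using \<Delta> unfolding split_beta' by measurable
  then show ?thesis
    unfolding config_integral_def by (rule P.borel_measurable_nn_integral)
qed

lemma measurable_poisson:
  assumes "\<Delta> \<in> sets borel" "(\<lambda>(w, \<xi>). F w \<xi>) \<in> borel_measurable (M \<Otimes>\<^sub>M config_space)"
  shows "(\<lambda>w. poisson_nn_integral \<Delta> (F w)) \<in> borel_measurable M"
  unfolding poisson_nn_integral_eq using measurable_config_integral[OF _ assms] by measurable

text \<open>The integral over \<open>n + 1\<close> points splits into \<open>n + 1\<close>
  contributions, all equal since they depend only on the number of remaining points;
  \<open>(n + 1) / (n + 1)! = 1 / n!\<close> matches it with the \<open>n\<close>-point term on the
  right. The term without points vanishes.\<close>

lemma poisson_mecke:
  fixes G :: "'a::euclidean_space \<Rightarrow> 'a set \<Rightarrow> ennreal"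
  assumes \<Delta>: "\<Delta> \<in> sets borel"
    and G: "(\<lambda>(x, \<xi>). G x \<xi>) \<in> borel_measurable (borel \<Otimes>\<^sub>M config_space)"
  shows "poisson_nn_integral \<Delta> (\<lambda>\<xi>. \<Sum>x\<in>\<xi>. G x (\<xi> - {x}))
    = poisson_nn_integral \<Delta> (\<lambda>\<xi>. \<integral>\<^sup>+y. indicator \<Delta> y * G y \<xi> \<partial>lborel)"
proof -
  let ?P = "\<lambda>n. Pi\<^sub>M {..<n} (\<lambda>_::nat. lborel :: 'a measure)"
  let ?S = "\<lambda>n. config_integral \<Delta> {..<n} (\<lambda>\<xi>. \<Sum>x\<in>\<xi>. G x (\<xi> - {x}))"
  let ?N = "\<lambda>n. config_integral \<Delta> {..<n} (\<lambda>\<xi>. \<integral>\<^sup>+y. indicator \<Delta> y * G y \<xi> \<partial>lborel)"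
  have Gy: "G y \<in> borel_measurable config_space" for y
    using measurable_pair_fix[OF G measurable_ident_sets[OF refl], of "\<lambda>_. y"] by simp
  have swap: "?N n = (\<integral>\<^sup>+y. indicator \<Delta> y * config_integral \<Delta> {..<n} (G y) \<partial>lborel)" for n
  proof -
    interpret P: sigma_finite_measure "?P n" by (rule lborel_product.sigma_finite) simp
    interpret pair_sigma_finite "?P n" "lborel :: 'a measure" ..
    have m: "(\<lambda>(x, y). (\<Prod>i<n. indicator \<Delta> (x i)) * (indicator \<Delta> y * G y (x ` {..<n})))
        \<in> borel_measurable (?P n \<Otimes>\<^sub>M lborel)"
    proof -
      have "(\<lambda>(x, y). G y (x ` {..<n})) \<in> borel_measurable (?P n \<Otimes>\<^sub>M lborel)"
        using measurable_pair_fix[OF G measurable_compose[OF measurable_fst measurable_image_config], of "{..<n}" snd lborel]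
        by (simp add: split_beta')
      then show ?thesis using \<Delta> unfolding split_beta' by measurable
    qed
    have "?N n = (\<integral>\<^sup>+x. \<integral>\<^sup>+y. (\<Prod>i<n. indicator \<Delta> (x i)) * (indicator \<Delta> y * G y (x ` {..<n})) \<partial>lborel \<partial>?P n)"
      unfolding config_integral_def
    proof (intro nn_integral_cong nn_integral_cmult[symmetric])
      fix x assume x: "x \<in> space (?P n)"
      have "x ` {..<n} \<in> space config_space"
        by (simp add: space_config_space locally_finite_conf_finite)
      then have "(\<lambda>y. G y (x ` {..<n})) \<in> borel_measurable borel"
        using measurable_pair_fix[OF G measurable_const, of _ "\<lambda>y. y"] by simp
      then show "(\<lambda>y. indicator \<Delta> y * G y (x ` {..<n})) \<in> borel_measurable lborel"
        using \<Delta> by measurable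
    qed
    also have "\<dots> = (\<integral>\<^sup>+y. \<integral>\<^sup>+x. (\<Prod>i<n. indicator \<Delta> (x i)) * (indicator \<Delta> y * G y (x ` {..<n})) \<partial>?P n \<partial>lborel)"
      by (rule Fubini'[OF m, symmetric])
    also have "\<dots> = (\<integral>\<^sup>+y. \<integral>\<^sup>+x. indicator \<Delta> y * ((\<Prod>i<n. indicator \<Delta> (x i)) * G y (x ` {..<n})) \<partial>?P n \<partial>lborel)"
      by (simp only: mult.left_commute)
    also have "\<dots> = (\<integral>\<^sup>+y. indicator \<Delta> y * config_integral \<Delta> {..<n} (G y) \<partial>lborel)"
      unfolding config_integral_def using \<Delta> Gy
      by (intro nn_integral_cong nn_integral_cmult measurable_config_integrand) auto
    finally show ?thesis .
  qed
  have term_Suc: "ennreal (1 / fact (Suc n)) * ?S (Suc n) = ennreal (1 / fact n) * ?N n" for n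
  proof -
    have "?S (Suc n) = (\<Sum>i<Suc n. \<integral>\<^sup>+y. indicator \<Delta> y * config_integral \<Delta> ({..<Suc n} - {i}) (G y) \<partial>lborel)"
      by (rule config_integral_sum[OF _ \<Delta> G]) simp
    also have "\<dots> = (\<Sum>i<Suc n. ?N n)"
      unfolding swap using \<Delta> Gy
      by (intro sum.cong refl nn_integral_cong) (auto intro!: arg_cong2[where f = "(*)"] config_integral_card)
    also have "\<dots> = ennreal (real (Suc n)) * ?N n" by (simp add: ennreal_of_nat_eq_real_of_nat del: of_nat_Suc)
    finally have "ennreal (1 / fact (Suc n)) * ?S (Suc n) = (ennreal (1 / fact (Suc n)) * ennreal (real (Suc n))) * ?N n"
      by (simp only: mult.assoc)
    also have "ennreal (1 / fact (Suc n)) * ennreal (real (Suc n)) = ennreal (1 / fact n)"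
      by (subst ennreal_mult[symmetric]) (auto simp: field_simps simp del: of_nat_Suc)
    finally show ?thesis .
  qed
  have "?S 0 = 0" by (simp add: config_integral_def)
  then have "(\<Sum>n. ennreal (1 / fact n) * ?S n) = (\<Sum>n. ennreal (1 / fact (Suc n)) * ?S (Suc n))"
    by (subst suminf_offset[where i = 1]) (auto simp: summableI)
  then show ?thesis
    unfolding poisson_nn_integral_eq term_Suc by simp
qed

text \<open>A strictly positive weight leaves the null sets of each \<open>n\<close>-point integral
  unchanged. This carries positivity from the Poisson process to the Gibbs kernel without a lower
  bound on the weight.\<close>

lemma poisson_pos_iff:
  assumes \<Delta>: "\<Delta> \<in> sets borel" and F: "F \<in> borel_measurable config_space" and w: "w \<in> borel_measurable config_space"
    and pos: "\<And>\<xi>. finite \<xi> \<Longrightarrow> \<xi> \<subseteq> \<Delta> \<Longrightarrow> w \<xi> > 0"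
    and nz: "poisson_nn_integral \<Delta> F \<noteq> 0"
  shows "poisson_nn_integral \<Delta> (\<lambda>\<xi>. F \<xi> * w \<xi>) \<noteq> 0"
proof
  assume "poisson_nn_integral \<Delta> (\<lambda>\<xi>. F \<xi> * w \<xi>) = 0"
  then have zero: "config_integral \<Delta> {..<n} (\<lambda>\<xi>. F \<xi> * w \<xi>) = 0" for n
    unfolding poisson_nn_integral_eq by (simp add: suminf_eq_zero_iff summableI)
  have "config_integral \<Delta> {..<n} F = 0" for n
  proof -
    let ?P = "Pi\<^sub>M {..<n} (\<lambda>_::nat. lborel :: 'a measure)"
    have m: "(\<lambda>\<xi>. F \<xi> * w \<xi>) \<in> borel_measurable config_space" using F w by measurable
    have "AE x in ?P. (\<Prod>i<n. indicator \<Delta> (x i)) * (F (x ` {..<n}) * w (x ` {..<n})) = 0"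
      using zero[of n] unfolding config_integral_def
      by (subst (asm) nn_integral_0_iff_AE) (use measurable_config_integrand[OF _ \<Delta> m, of "{..<n}"] in auto)
    then have "AE x in ?P. (\<Prod>i<n. indicator \<Delta> (x i)) * F (x ` {..<n}) = 0"
    proof eventually_elim
      case (elim x)
      show ?case
      proof (cases "x ` {..<n} \<subseteq> \<Delta>")
        case True
        then have "w (x ` {..<n}) > 0" by (intro pos) auto
        then show ?thesis using elim by (auto simp: zero_less_iff_neq_zero)
      qed (simp add: prod_indicator_eq)
    qed
    then show ?thesis
      unfolding config_integral_def
      by (subst nn_integral_0_iff_AE) (use measurable_config_integrand[OF _ \<Delta> F, of "{..<n}"] in auto)
  qed
  then show False using nz unfolding poisson_nn_integral_eq by simp
qed

section \<open>Laws of large numbers for the Gibbs kernel\<close>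

lemma mem_Lambda: "x \<in> Lambda n \<longleftrightarrow> (\<forall>b\<in>Basis. - real n \<le> x \<bullet> b \<and> x \<bullet> b \<le> real n)"
  by (auto simp: Lambda_def mem_box)

lemma compact_Lambda: "compact (Lambda n)"
  by (simp add: Lambda_def)

lemma Lambda_borel [measurable]: "Lambda n \<in> sets borel"
  by (simp add: Lambda_def)

lemma measurable_Un_config:
  assumes f: "f \<in> measurable M config_space" and g: "g \<in> measurable M config_space"
  shows "(\<lambda>w. f w \<union> g w) \<in> measurable M config_space"
proof (rule measurable_configI)
  have lf: "locally_finite_conf (f w)" "locally_finite_conf (g w)" if "w \<in> space M" for w
    using measurable_space[OF f that] measurable_space[OF g that] by (simp_all add: space_config_space)
  show "locally_finite_conf (f w \<union> g w)" if "w \<in> space M" for w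
    using lf[OF that] by (simp add: locally_finite_conf_def Int_Un_distrib2)
  fix B :: "'b set" assume B: "B \<in> sets borel" "bounded B"
  have "Measurable.pred (M \<Otimes>\<^sub>M borel) (\<lambda>w. snd w \<in> f (fst w))"
    by (intro measurable_member_config measurable_compose[OF measurable_fst f]) measurable
  then have "Measurable.pred (M \<Otimes>\<^sub>M borel) (\<lambda>(w, y). y \<notin> f w)" by (simp add: split_beta')
  from measurable_filter_config[OF g this]
  have "(\<lambda>w. {y \<in> g w. y \<notin> f w}) \<in> measurable M config_space" .
  then have [measurable]: "(\<lambda>w. card ({y \<in> g w. y \<notin> f w} \<inter> B)) \<in> measurable M (count_space UNIV)"
    "(\<lambda>w. card (f w \<inter> B)) \<in> measurable M (count_space UNIV)"
    using measurable_compose[OF _ measurable_card_config[OF B]] f by auto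
  have "(\<lambda>w. card (f w \<inter> B) + card ({y \<in> g w. y \<notin> f w} \<inter> B)) \<in> measurable M (count_space UNIV)"
    by measurable
  moreover have "card (f w \<inter> B) + card ({y \<in> g w. y \<notin> f w} \<inter> B) = card ((f w \<union> g w) \<inter> B)"
    if "w \<in> space M" for w
  proof -
    have "(f w \<union> g w) \<inter> B = (f w \<inter> B) \<union> ({y \<in> g w. y \<notin> f w} \<inter> B)" by auto
    moreover have "finite (g w \<inter> B)" using lf[OF that] B by (intro locally_finite_confD)
    then have "finite ({y \<in> g w. y \<notin> f w} \<inter> B)" by (rule rev_finite_subset) auto
    ultimately show ?thesis
      using lf(1)[OF that] B by (subst card_Un_disjoint[symmetric]) (auto intro: locally_finite_confD)
  qed
  ultimately show "(\<lambda>w. card ((f w \<union> g w) \<inter> B)) \<in> measurable M (count_space UNIV)"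
    by (simp cong: measurable_cong)
qed

lemma measurable_diff_config:
  assumes f: "f \<in> measurable M config_space" and [measurable]: "\<Delta> \<in> sets borel"
  shows "(\<lambda>w. f w - \<Delta>) \<in> measurable M config_space"
proof -
  have "Measurable.pred (M \<Otimes>\<^sub>M borel) (\<lambda>(w, y). y \<notin> \<Delta>)" by measurable
  from measurable_filter_config[OF f this] show ?thesis by (simp add: set_diff_eq)
qed

lemma poisson_cmult:
  assumes "\<Delta> \<in> sets borel" "F \<in> borel_measurable config_space"
  shows "poisson_nn_integral \<Delta> (\<lambda>\<xi>. c * F \<xi>) = c * poisson_nn_integral \<Delta> F"
proof -
  have "config_integral \<Delta> {..<n} (\<lambda>\<xi>. c * F \<xi>) = c * config_integral \<Delta> {..<n} F" for n
    unfolding config_integral_def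
    using nn_integral_cmult[OF measurable_config_integrand[OF _ assms], of "{..<n}" c]
    by (simp add: mult.left_commute)
  then show ?thesis by (simp add: poisson_nn_integral_eq mult.left_commute)
qed

lemma poisson_add:
  assumes "\<Delta> \<in> sets borel" "F \<in> borel_measurable config_space" "G \<in> borel_measurable config_space"
  shows "poisson_nn_integral \<Delta> (\<lambda>\<xi>. F \<xi> + G \<xi>) = poisson_nn_integral \<Delta> F + poisson_nn_integral \<Delta> G"
proof -
  have "config_integral \<Delta> {..<n} (\<lambda>\<xi>. F \<xi> + G \<xi>) = config_integral \<Delta> {..<n} F + config_integral \<Delta> {..<n} G" for n
    unfolding config_integral_def
    using nn_integral_add[OF measurable_config_integrand[OF _ assms(1,2)] measurable_config_integrand[OF _ assms(1,3)], of "{..<n}"]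
    by (simp add: distrib_left)
  then show ?thesis by (simp add: poisson_nn_integral_eq distrib_left suminf_add[OF summableI summableI, symmetric])
qed

lemma poisson_mono:
  assumes "\<And>\<xi>. F \<xi> \<le> G \<xi>"
  shows "poisson_nn_integral \<Delta> F \<le> poisson_nn_integral \<Delta> G"
  unfolding poisson_nn_integral_eq config_integral_def
  by (intro mult_left_mono suminf_le summableI nn_integral_mono assms) auto

text \<open>The exceptional sets for \<open>\<delta> = 1 / (i + 1)\<close> have a null intersection,
  and \<open>Q\<close> holds almost surely off each of them. Made for the maximal inequality, whose
  exceptional sets are small but not null.\<close>

lemma (in prob_space) AE_I_small:
  assumes "\<And>\<delta>. \<delta> > 0 \<Longrightarrow> \<exists>A\<in>sets M. prob A \<le> \<delta> \<and> (AE x in M. x \<notin> A \<longrightarrow> Q x)"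
  shows "AE x in M. Q x"
proof -
  have "\<forall>i. \<exists>A\<in>sets M. prob A \<le> 1 / real (Suc i) \<and> (AE x in M. x \<notin> A \<longrightarrow> Q x)"
    using assms by simp
  then obtain A where A: "\<And>i. A i \<in> sets M" "\<And>i. prob (A i) \<le> 1 / real (Suc i)"
    "\<And>i. AE x in M. x \<notin> A i \<longrightarrow> Q x" by metis
  have "prob (\<Inter>i. A i) \<le> 1 / real (Suc i)" for i
    by (rule order_trans[OF finite_measure_mono A(2)]) (use A in auto)
  then have "prob (\<Inter>i. A i) \<le> 0"
    using LIMSEQ_le_const[OF LIMSEQ_Suc[OF lim_1_over_n[where 'a = real]], of "prob (\<Inter>i. A i)"] by auto
  then have "emeasure M (\<Inter>i. A i) = 0" by (simp add: emeasure_eq_measure measure_le_0_iff)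
  then have "AE x in M. x \<notin> (\<Inter>i. A i)"
    using A by (intro AE_not_in) (auto simp: null_sets_def)
  moreover have "AE x in M. \<forall>i. x \<notin> A i \<longrightarrow> Q x" unfolding AE_all_countable using A(3) by blast
  ultimately show ?thesis by eventually_elim auto
qed

text \<open>One window of half-width \<open>m\<close> is fixed. The bound
  \<open>m \<ge> R + 1\<close> puts the \<open>R\<close>-neighbourhood of the unit cube inside it,
  so local energies in the cube are functions of the configuration in the window.\<close>

locale gibbs_window = stationary_finite_range_energy H R + stationary_config P
  for H :: "'a::euclidean_space set \<Rightarrow> ereal" and R :: real and P :: "'a set measure" +
  fixes z \<beta> :: real and m :: nat
  assumes z_pos: "z > 0" and m_ge: "real m \<ge> R + 1" and gibbs: "gibbs_pp H R z \<beta> P"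
begin

lemma borel_measurable_P: "borel_measurable P = borel_measurable config_space"
  by (rule measurable_cong_sets) (simp_all add: sets_P)

section \<open>The Gibbs kernel of the window\<close>

abbreviation W :: "'a set" where "W \<equiv> Lambda m"
abbreviation E :: "'a set" where "E \<equiv> enlarge W R"

definition wt :: "'a set \<Rightarrow> ennreal" where
  "wt \<gamma> = ennreal (z ^ card (\<gamma> \<inter> W) * exp (- \<beta> * HD W \<gamma>))"

definition Z :: "'a set \<Rightarrow> ennreal" where
  "Z \<gamma> = poisson_nn_integral W (\<lambda>\<xi>. wt (\<xi> \<union> (\<gamma> - W)))"

text \<open>The Gibbs specification kernel, defined at every configuration and not up to null sets.
  Division in \<open>ennreal\<close> keeps its total mass at most \<open>1\<close> even where
  \<open>Z\<close> is \<open>0\<close> or infinite, so linearity and locality hold without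
  exceptional sets.\<close>

definition K :: "('a set \<Rightarrow> ennreal) \<Rightarrow> 'a set \<Rightarrow> ennreal" where
  "K F \<gamma> = poisson_nn_integral W (\<lambda>\<xi>. F (\<xi> \<union> (\<gamma> - W)) * wt (\<xi> \<union> (\<gamma> - W))) / Z \<gamma>"

lemma finite_W: "locally_finite_conf \<gamma> \<Longrightarrow> finite (\<gamma> \<inter> W)"
  by (intro locally_finite_confD) (simp_all add: Lambda_def)

lemma W_subset_E: "W \<subseteq> E"
  using R_pos by (auto simp: enlarge_def intro!: bexI)

lemma mem_E: "x \<in> E \<Longrightarrow> b \<in> Basis \<Longrightarrow> \<bar>x \<bullet> b\<bar> \<le> real m + R"
proof -
  assume "x \<in> E" and b: "b \<in> Basis"
  then obtain y where y: "y \<in> W" "dist y x \<le> R" by (auto simp: enlarge_def)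
  have "\<bar>y \<bullet> b\<bar> \<le> real m" using y b by (auto simp: mem_Lambda abs_le_iff)
  moreover have "\<bar>(x - y) \<bullet> b\<bar> \<le> R"
    using Basis_le_norm[OF b, of "x - y"] y by (simp add: dist_norm norm_minus_commute)
  ultimately show "\<bar>x \<bullet> b\<bar> \<le> real m + R" by (simp add: inner_diff_left)
qed

lemma gibbs_weight_eq: "locally_finite_conf \<gamma> \<Longrightarrow> gibbs_weight H R z \<beta> W \<gamma> = wt \<gamma>"
  by (simp add: gibbs_weight_def wt_def ewt_def H_Delta_eq compact_Lambda)

lemma lf_replace: "finite \<xi> \<Longrightarrow> locally_finite_conf \<gamma> \<Longrightarrow> locally_finite_conf (\<xi> \<union> (\<gamma> - W))"
  by (intro locally_finite_conf_Un) (auto intro: locally_finite_conf_subset)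

lemma wt_pos: "wt \<gamma> > 0"
  using z_pos by (simp add: wt_def)

lemma measurable_wt:
  assumes "f \<in> measurable M config_space"
  shows "(\<lambda>w. wt (f w)) \<in> borel_measurable M"
proof -
  have "(\<lambda>w. card (f w \<inter> W)) \<in> measurable M (count_space UNIV)"
    by (rule measurable_compose[OF assms measurable_card_config]) (simp_all add: Lambda_def)
  then show ?thesis
    unfolding wt_def using measurable_HD[OF assms compact_Lambda[of m]] by measurable
qed

text \<open>The ratio of the weights is the Papangelou conditional intensity
  \<open>z exp (- \<beta> h)\<close>, whence the factor in the integral term of an
  innovation.\<close>

lemma wt_insert:
  assumes "locally_finite_conf \<gamma>" "y \<in> W" "y \<notin> \<gamma>"
  shows "wt (insert y \<gamma>) = ennreal (z * exp (- \<beta> * hr y \<gamma>)) * wt \<gamma>"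
proof -
  have "card (insert y \<gamma> \<inter> W) = Suc (card (\<gamma> \<inter> W))"
    using assms finite_W[OF assms(1)] by (simp add: Int_insert_left)
  then show ?thesis
    using z_pos assms unfolding wt_def HD_insert[OF assms(1) compact_Lambda assms(2,3)]
    by (simp add: ennreal_mult[symmetric] exp_add[symmetric] algebra_simps)
qed

lemma Z_eq: "locally_finite_conf \<gamma> \<Longrightarrow> partition_fun H R z \<beta> W \<gamma> = Z \<gamma>"
  unfolding partition_fun_def Z_def by (intro poisson_cong gibbs_weight_eq lf_replace)

lemma W_positive: "W \<in> sets lborel" "bounded W" "emeasure lborel W > 0"
proof -
  have "real m > 0" using m_ge R_pos by linarith
  then show "W \<in> sets lborel" "bounded W" "emeasure lborel W > 0"
    by (auto simp: Lambda_def emeasure_lborel_cbox_eq inner_add_left intro!: prod_pos)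
qed

lemma AE_Z: "AE \<gamma> in P. 0 < Z \<gamma> \<and> Z \<gamma> < \<infinity>"
proof -
  have "AE \<gamma> in P. 0 < partition_fun H R z \<beta> W \<gamma> \<and> partition_fun H R z \<beta> W \<gamma> < \<infinity>"
    using gibbs W_positive unfolding gibbs_pp_def by blast
  with AE_space show ?thesis
    by eventually_elim (simp add: Z_eq space_P)
qed

lemma DLR:
  assumes "F \<in> borel_measurable P"
  shows "(\<integral>\<^sup>+\<gamma>. F \<gamma> \<partial>P) = (\<integral>\<^sup>+\<gamma>. K F \<gamma> \<partial>P)"
proof -
  have "(\<integral>\<^sup>+\<gamma>. F \<gamma> \<partial>P) = (\<integral>\<^sup>+\<gamma>. poisson_nn_integral W
                (\<lambda>\<xi>. F (\<xi> \<union> (\<gamma> - W)) * gibbs_weight H R z \<beta> W (\<xi> \<union> (\<gamma> - W)))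
              / partition_fun H R z \<beta> W \<gamma> \<partial>P)"
    using gibbs W_positive assms unfolding gibbs_pp_def by blast
  also have "\<dots> = (\<integral>\<^sup>+\<gamma>. K F \<gamma> \<partial>P)"
    unfolding K_def
    by (intro nn_integral_cong arg_cong2[where f = "(/)"] poisson_cong)
       (auto simp: space_P Z_eq gibbs_weight_eq lf_replace)
  finally show ?thesis .
qed

lemma measurable_replace:
  "f \<in> measurable M config_space \<Longrightarrow> g \<in> measurable M config_space \<Longrightarrow>
    (\<lambda>w. g w \<union> (f w - W)) \<in> measurable M config_space"
  by (intro measurable_Un_config measurable_diff_config) auto

lemma measurable_replace_fix:
  assumes "locally_finite_conf \<gamma>"
  shows "(\<lambda>\<xi>. \<xi> \<union> (\<gamma> - W)) \<in> measurable config_space config_space"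
  by (intro measurable_replace measurable_const) (use assms in \<open>auto simp: space_config_space\<close>)

lemma measurable_K:
  assumes F: "F \<in> borel_measurable P"
  shows "K F \<in> borel_measurable P"
proof -
  have F': "F \<in> borel_measurable config_space" using F by (simp add: borel_measurable_P)
  have r: "(\<lambda>w. snd w \<union> (fst w - W)) \<in> measurable (P \<Otimes>\<^sub>M config_space) config_space"
    by (intro measurable_replace measurable_snd measurable_compose[OF measurable_fst])
      (simp add: measurable_ident_sets sets_P)
  have "(\<lambda>\<gamma>. poisson_nn_integral W (\<lambda>\<xi>. F (\<xi> \<union> (\<gamma> - W)) * wt (\<xi> \<union> (\<gamma> - W)))) \<in> borel_measurable P"
    using measurable_compose[OF r F'] measurable_wt[OF r]
    by (intro measurable_poisson) (auto simp: split_beta')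
  moreover have "Z \<in> borel_measurable P"
    unfolding Z_def using measurable_wt[OF r] by (intro measurable_poisson) (auto simp: split_beta')
  ultimately show ?thesis unfolding K_def by measurable
qed

lemma K_integrand_measurable:
  assumes "locally_finite_conf \<gamma>" "F \<in> borel_measurable P"
  shows "(\<lambda>\<xi>. F (\<xi> \<union> (\<gamma> - W))) \<in> borel_measurable config_space"
    "(\<lambda>\<xi>. wt (\<xi> \<union> (\<gamma> - W))) \<in> borel_measurable config_space"
    "(\<lambda>\<xi>. F (\<xi> \<union> (\<gamma> - W)) * wt (\<xi> \<union> (\<gamma> - W))) \<in> borel_measurable config_space"
proof -
  show F: "(\<lambda>\<xi>. F (\<xi> \<union> (\<gamma> - W))) \<in> borel_measurable config_space"
    using measurable_compose[OF measurable_replace_fix[OF assms(1)]] assms(2) by (simp add: borel_measurable_P)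
  show w: "(\<lambda>\<xi>. wt (\<xi> \<union> (\<gamma> - W))) \<in> borel_measurable config_space"
    by (rule measurable_wt[OF measurable_replace_fix[OF assms(1)]])
  show "(\<lambda>\<xi>. F (\<xi> \<union> (\<gamma> - W)) * wt (\<xi> \<union> (\<gamma> - W))) \<in> borel_measurable config_space"
    using F w by (rule borel_measurable_times_ennreal)
qed

text \<open>The kernel resamples only inside the window, so a function of the outside is a constant
  factor. Together with \<open>DLR\<close> this makes \<open>K F\<close> the conditional expectation
  given the outside.\<close>

lemma K_outside:
  assumes "locally_finite_conf \<gamma>" "F \<in> borel_measurable P"
    and G: "\<And>\<gamma> \<gamma>'. \<gamma> - W = \<gamma>' - W \<Longrightarrow> G \<gamma> = G \<gamma>'"
  shows "K (\<lambda>\<gamma>. F \<gamma> * G \<gamma>) \<gamma> = K F \<gamma> * G \<gamma>"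
proof -
  have "poisson_nn_integral W (\<lambda>\<xi>. F (\<xi> \<union> (\<gamma> - W)) * G (\<xi> \<union> (\<gamma> - W)) * wt (\<xi> \<union> (\<gamma> - W)))
    = poisson_nn_integral W (\<lambda>\<xi>. G \<gamma> * (F (\<xi> \<union> (\<gamma> - W)) * wt (\<xi> \<union> (\<gamma> - W))))"
  proof (rule poisson_cong)
    fix \<xi> assume "\<xi> \<subseteq> W"
    then have "G (\<xi> \<union> (\<gamma> - W)) = G \<gamma>" by (intro G) auto
    then show "F (\<xi> \<union> (\<gamma> - W)) * G (\<xi> \<union> (\<gamma> - W)) * wt (\<xi> \<union> (\<gamma> - W))
      = G \<gamma> * (F (\<xi> \<union> (\<gamma> - W)) * wt (\<xi> \<union> (\<gamma> - W)))" by (simp add: mult_ac)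
  qed
  also have "\<dots> = G \<gamma> * poisson_nn_integral W (\<lambda>\<xi>. F (\<xi> \<union> (\<gamma> - W)) * wt (\<xi> \<union> (\<gamma> - W)))"
    by (intro poisson_cmult K_integrand_measurable assms) simp
  finally show ?thesis unfolding K_def by (simp add: divide_ennreal_def mult_ac)
qed

lemma DLR_outside:
  assumes "F \<in> borel_measurable P" "G \<in> borel_measurable P"
    and "\<And>\<gamma> \<gamma>'. \<gamma> - W = \<gamma>' - W \<Longrightarrow> G \<gamma> = G \<gamma>'"
  shows "(\<integral>\<^sup>+\<gamma>. F \<gamma> * G \<gamma> \<partial>P) = (\<integral>\<^sup>+\<gamma>. K F \<gamma> * G \<gamma> \<partial>P)"
proof -
  have "(\<integral>\<^sup>+\<gamma>. F \<gamma> * G \<gamma> \<partial>P) = (\<integral>\<^sup>+\<gamma>. K (\<lambda>\<gamma>. F \<gamma> * G \<gamma>) \<gamma> \<partial>P)"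
    by (intro DLR borel_measurable_times_ennreal assms(1,2))
  also have "\<dots> = (\<integral>\<^sup>+\<gamma>. K F \<gamma> * G \<gamma> \<partial>P)"
    by (intro nn_integral_cong K_outside assms(1,3)) (auto simp: space_P)
  finally show ?thesis .
qed

text \<open>The weight sees the outside only within distance \<open>R\<close> of the window. Hence
  \<open>K F\<close> is local too, and far translates of \<open>F - K F\<close> are functions of the
  outside.\<close>

lemma K_local:
  assumes F: "\<And>\<gamma> \<gamma>'. \<gamma> \<inter> W = \<gamma>' \<inter> W \<Longrightarrow> F \<gamma> = F \<gamma>'" and eq: "\<gamma> \<inter> E = \<gamma>' \<inter> E"
  shows "K F \<gamma> = K F \<gamma>'"
proof -
  have wt: "wt (\<xi> \<union> (\<gamma> - W)) = wt (\<xi> \<union> (\<gamma>' - W))" for \<xi>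
  proof -
    have "(\<xi> \<union> (\<gamma> - W)) \<inter> W = (\<xi> \<union> (\<gamma>' - W)) \<inter> W" by auto
    moreover have "(\<xi> \<union> (\<gamma> - W)) \<inter> E = (\<xi> \<union> (\<gamma>' - W)) \<inter> E" using eq by blast
    ultimately show ?thesis unfolding wt_def by (metis HD_local)
  qed
  have "F (\<xi> \<union> (\<gamma> - W)) = F (\<xi> \<union> (\<gamma>' - W))" for \<xi>
    by (rule F) auto
  then show ?thesis unfolding K_def Z_def by (simp add: wt)
qed

lemma K_le_const:
  assumes "locally_finite_conf \<gamma>" "\<And>\<gamma>. F \<gamma> \<le> c"
  shows "K F \<gamma> \<le> c"
proof -
  have "poisson_nn_integral W (\<lambda>\<xi>. F (\<xi> \<union> (\<gamma> - W)) * wt (\<xi> \<union> (\<gamma> - W)))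
    \<le> poisson_nn_integral W (\<lambda>\<xi>. c * wt (\<xi> \<union> (\<gamma> - W)))"
    by (intro poisson_mono mult_right_mono assms) simp
  also have "\<dots> = c * Z \<gamma>"
    unfolding Z_def by (intro poisson_cmult K_integrand_measurable[where F = "\<lambda>_. 0"] assms) auto
  finally have "K F \<gamma> \<le> c * Z \<gamma> / Z \<gamma>" unfolding K_def by (rule divide_right_mono_ennreal)
  also have "\<dots> \<le> c"
    by (cases "Z \<gamma> = 0 \<or> Z \<gamma> = \<infinity>") (auto simp: ennreal_mult_divide_eq ennreal_divide_top)
  finally show ?thesis .
qed

lemma K_add:
  assumes "locally_finite_conf \<gamma>" "F \<in> borel_measurable P" "G \<in> borel_measurable P"
  shows "K (\<lambda>\<gamma>. F \<gamma> + G \<gamma>) \<gamma> = K F \<gamma> + K G \<gamma>"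
  unfolding K_def using K_integrand_measurable[OF assms(1,2)] K_integrand_measurable[OF assms(1,3)]
  by (simp add: distrib_right poisson_add add_divide_distrib_ennreal)

lemma DLR_orthogonal:
  fixes F G :: "'a set \<Rightarrow> real"
  assumes [measurable]: "F \<in> borel_measurable P" "G \<in> borel_measurable P"
    and F: "\<And>\<gamma>. 0 \<le> F \<gamma>" "\<And>\<gamma>. F \<gamma> \<le> M" and G: "\<And>\<gamma>. \<bar>G \<gamma>\<bar> \<le> M"
    and out: "\<And>\<gamma> \<gamma>'. \<gamma> - W = \<gamma>' - W \<Longrightarrow> G \<gamma> = G \<gamma>'"
  shows "(\<integral>\<gamma>. (F \<gamma> - enn2real (K F \<gamma>)) * G \<gamma> \<partial>P) = 0"
proof -
  have [measurable]: "K F \<in> borel_measurable P" by (rule measurable_K) measurable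
  have M0: "M \<ge> 0" using F(1)[of undefined] F(2)[of undefined] by linarith
  have KF: "K F \<gamma> \<le> ennreal M" if "\<gamma> \<in> space P" for \<gamma>
    using that F by (intro K_le_const) (auto simp: space_P intro: ennreal_leI)
  then have KF': "enn2real (K F \<gamma>) \<le> M" if "\<gamma> \<in> space P" for \<gamma>
    using that M0 by (intro enn2real_leI) auto
  have KF_fin: "ennreal (enn2real (K F \<gamma>)) = K F \<gamma>" if "\<gamma> \<in> space P" for \<gamma>
    using le_less_trans[OF KF[OF that] ennreal_less_top] by simp
  have eq: "(\<integral>\<gamma>. F \<gamma> * g \<gamma> \<partial>P) = (\<integral>\<gamma>. enn2real (K F \<gamma>) * g \<gamma> \<partial>P)"
    if [measurable]: "g \<in> borel_measurable P" and g: "\<And>\<gamma>. 0 \<le> g \<gamma>"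
      and out: "\<And>\<gamma> \<gamma>'. \<gamma> - W = \<gamma>' - W \<Longrightarrow> g \<gamma> = g \<gamma>'" for g :: "'a set \<Rightarrow> real"
  proof -
    have "(\<integral>\<^sup>+\<gamma>. ennreal (F \<gamma>) * ennreal (g \<gamma>) \<partial>P) = (\<integral>\<^sup>+\<gamma>. K F \<gamma> * ennreal (g \<gamma>) \<partial>P)"
    proof (rule DLR_outside)
      fix \<gamma> \<gamma>' :: "'a set" assume "\<gamma> - W = \<gamma>' - W"
      then show "ennreal (g \<gamma>) = ennreal (g \<gamma>')" using out by metis
    qed measurable
    also have "\<dots> = (\<integral>\<^sup>+\<gamma>. ennreal (enn2real (K F \<gamma>)) * ennreal (g \<gamma>) \<partial>P)"
      by (intro nn_integral_cong) (simp add: KF_fin)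
    finally show ?thesis
      using F g by (simp add: integral_eq_nn_integral ennreal_mult[symmetric])
  qed
  have int: "integrable P (\<lambda>\<gamma>. F \<gamma> * G \<gamma>)" "integrable P (\<lambda>\<gamma>. enn2real (K F \<gamma>) * G \<gamma>)"
    "integrable P F" "integrable P (\<lambda>\<gamma>. enn2real (K F \<gamma>))"
  proof -
    have "\<bar>F \<gamma> * G \<gamma>\<bar> \<le> M * M" for \<gamma>
      unfolding abs_mult using F G M0 by (intro mult_mono) (auto simp: abs_of_nonneg)
    then show "integrable P (\<lambda>\<gamma>. F \<gamma> * G \<gamma>)"
      by (intro integrable_const_bound[where B = "M * M"]) auto
    have "\<bar>enn2real (K F \<gamma>) * G \<gamma>\<bar> \<le> M * M" if "\<gamma> \<in> space P" for \<gamma>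
      unfolding abs_mult using KF'[OF that] G M0 by (intro mult_mono) auto
    then show "integrable P (\<lambda>\<gamma>. enn2real (K F \<gamma>) * G \<gamma>)"
      by (intro integrable_const_bound[where B = "M * M"] AE_I2) auto
    show "integrable P F" using F by (intro integrable_const_bound[where B = M]) auto
    show "integrable P (\<lambda>\<gamma>. enn2real (K F \<gamma>))"
      using KF' by (intro integrable_const_bound[where B = M] AE_I2) auto
  qed
  \<comment> \<open>The identity \<open>eq\<close> is for nonnegative functions of the outside:
    adding \<open>M\<close> makes \<open>G\<close> nonnegative, and the constant part is removed by
    the case \<open>g = 1\<close>.\<close>
  have "(\<integral>\<gamma>. F \<gamma> * (G \<gamma> + M) \<partial>P) = (\<integral>\<gamma>. enn2real (K F \<gamma>) * (G \<gamma> + M) \<partial>P)"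
  proof (rule eq)
    fix \<gamma> \<gamma>' :: "'a set"
    show "0 \<le> G \<gamma> + M" using G[of \<gamma>] by linarith
    assume "\<gamma> - W = \<gamma>' - W"
    then show "G \<gamma> + M = G \<gamma>' + M" using out by metis
  qed measurable
  moreover have "(\<integral>\<gamma>. F \<gamma> \<partial>P) = (\<integral>\<gamma>. enn2real (K F \<gamma>) \<partial>P)"
    using eq[of "\<lambda>_. 1"] by simp
  ultimately show ?thesis
    using int by (simp add: distrib_left left_diff_distrib)
qed

text \<open>Such a \<open>k\<close> has a coordinate of size at least \<open>3m\<close>. Points of
  \<open>E\<close> have coordinates of size at most \<open>m + R\<close>, so adding \<open>k\<close>
  gives one of size at least \<open>2m - R \<ge> m + 1\<close>, outside the window.\<close>

lemma shift_E_outside: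
  assumes "k \<notin> lattice_box (3 * m)" "\<forall>b\<in>Basis. k \<bullet> b \<in> \<int>" and eq: "\<gamma> - W = \<gamma>' - W"
  shows "shift_conf k \<gamma> \<inter> E = shift_conf k \<gamma>' \<inter> E"
proof -
  obtain b where b: "b \<in> Basis" "\<bar>k \<bullet> b\<bar> \<ge> 3 * real m"
    using assms(1,2) by (auto simp: lattice_box_def not_le not_less abs_if split: if_splits)
  have "x \<in> shift_conf k \<gamma> \<longleftrightarrow> x \<in> shift_conf k \<gamma>'" if "x \<in> E" for x
  proof -
    have "\<bar>(x + k) \<bullet> b\<bar> > real m"
      using mem_E[OF that b(1)] b(2) m_ge R_pos by (simp add: inner_add_left)
    then have "x + k \<notin> W" using b(1) by (force simp: mem_Lambda)
    then show ?thesis using eq by (auto simp: mem_translate_conf)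
  qed
  then show ?thesis by blast
qed

section \<open>Averages of a functional minus its conditional expectation\<close>

lemma bounded_lln:
  fixes F :: "'a set \<Rightarrow> real"
  assumes [measurable]: "F \<in> borel_measurable P" and F: "\<And>\<gamma>. 0 \<le> F \<gamma>" "\<And>\<gamma>. F \<gamma> \<le> M"
    and loc: "\<And>\<gamma> \<gamma>'. \<gamma> \<inter> W = \<gamma>' \<inter> W \<Longrightarrow> F \<gamma> = F \<gamma>'"
  shows "AE \<gamma> in P. (\<lambda>n. (\<Sum>k\<in>lattice_box n. F (shift_conf k \<gamma>) - enn2real (K F (shift_conf k \<gamma>)))
      / (2 * real n) ^ DIM('a)) \<longlonglongrightarrow> 0"
proof -
  have M0: "M \<ge> 0" using F(1)[of undefined] F(2)[of undefined] by linarith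
  have [measurable]: "K F \<in> borel_measurable P" by (rule measurable_K) measurable
  \<comment> \<open>The bound on \<open>K F\<close> is known at locally finite configurations only,
    while \<open>bounded_orthogonal_lln\<close> asks for one at every set; truncation at
    \<open>M\<close> changes nothing on \<open>space P\<close>.\<close>
  define V where "V \<gamma> = min M (enn2real (K F \<gamma>))" for \<gamma>
  have V: "V \<gamma> = enn2real (K F \<gamma>)" if "\<gamma> \<in> space P" for \<gamma>
  proof -
    have "K F \<gamma> \<le> ennreal M"
      using that F by (intro K_le_const) (auto simp: space_P intro: ennreal_leI)
    then have "enn2real (K F \<gamma>) \<le> M" using M0 by (intro enn2real_leI) auto
    then show ?thesis by (simp add: V_def)
  qed
  define Y where "Y \<gamma> = F \<gamma> - V \<gamma>" for \<gamma>
  have Yb: "\<bar>Y \<gamma>\<bar> \<le> M" for \<gamma> using F[of \<gamma>] M0 enn2real_nonneg[of "K F \<gamma>"] unfolding Y_def V_def by linarith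
  have [measurable]: "Y \<in> borel_measurable P" unfolding Y_def V_def by measurable
  have locY: "Y \<gamma> = Y \<gamma>'" if "\<gamma> \<inter> E = \<gamma>' \<inter> E" for \<gamma> \<gamma>'
  proof -
    have "\<gamma> \<inter> W = \<gamma>' \<inter> W" using that W_subset_E by blast
    then have "F \<gamma> = F \<gamma>'" by (rule loc)
    moreover have "K F \<gamma> = K F \<gamma>'"
    proof (rule K_local[OF _ that])
      fix \<gamma> \<gamma>' :: "'a set" assume "\<gamma> \<inter> W = \<gamma>' \<inter> W"
      from loc[OF this] show "ennreal (F \<gamma>) = ennreal (F \<gamma>')" by simp
    qed
    ultimately show ?thesis by (simp add: Y_def V_def)
  qed
  have "AE \<gamma> in P. (\<lambda>n. (\<Sum>k\<in>lattice_box n. Y (shift_conf k \<gamma>)) / (2 * real n) ^ DIM('a)) \<longlonglongrightarrow> 0"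
  proof (rule bounded_orthogonal_lln[where M = M and m = "3 * m"])
    fix k :: 'a assume k: "\<forall>b\<in>Basis. k \<bullet> b \<in> \<int>" "k \<notin> lattice_box (3 * m)"
    have "(\<integral>\<gamma>. Y \<gamma> * Y (shift_conf k \<gamma>) \<partial>P) = (\<integral>\<gamma>. (F \<gamma> - enn2real (K F \<gamma>)) * Y (shift_conf k \<gamma>) \<partial>P)"
      by (intro Bochner_Integration.integral_cong) (auto simp: Y_def V)
    also have "\<dots> = 0"
    proof (rule DLR_orthogonal[where M = M])
      fix \<gamma> \<gamma>' :: "'a set" assume "\<gamma> - W = \<gamma>' - W"
      then show "Y (shift_conf k \<gamma>) = Y (shift_conf k \<gamma>')"
        by (intro locY shift_E_outside k)
    qed (use F Yb in auto)
    finally show "(\<integral>\<gamma>. Y \<gamma> * Y (shift_conf k \<gamma>) \<partial>P) = 0" .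
  qed (use Yb in auto)
  with AE_space show ?thesis
    by eventually_elim (simp add: Y_def V translate_space)
qed

text \<open>Each shift preserves null sets by stationarity, and only countably many occur.\<close>

lemma AE_lattice:
  assumes "AE \<gamma> in P. Q \<gamma>"
  shows "AE \<gamma> in P. \<forall>n. \<forall>k\<in>lattice_box n. Q (shift_conf k \<gamma>)"
  unfolding AE_all_countable using AE_translate[OF assms] by (simp add: AE_finite_all)

text \<open>Truncate: the bounded part is covered by \<open>bounded_lln\<close>, and the maximal inequality shows that the
  averages of the remainder are uniformly small outside an event of small probability.\<close>

lemma lln:
  fixes F :: "'a set \<Rightarrow> real"
  assumes Fm [measurable]: "F \<in> borel_measurable P" and F0: "\<And>\<gamma>. 0 \<le> F \<gamma>" and int: "integrable P F"
    and loc: "\<And>\<gamma> \<gamma>'. \<gamma> \<inter> W = \<gamma>' \<inter> W \<Longrightarrow> F \<gamma> = F \<gamma>'"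
  shows "AE \<gamma> in P. (\<lambda>n. (\<Sum>k\<in>lattice_box n. F (shift_conf k \<gamma>) - enn2real (K F (shift_conf k \<gamma>)))
      / (2 * real n) ^ DIM('a)) \<longlonglongrightarrow> 0"
proof -
  let ?d = "DIM('a)"
  define T where "T \<gamma> = F \<gamma> - enn2real (K F \<gamma>)" for \<gamma>
  define avg where "avg f n \<gamma> = (\<Sum>k\<in>lattice_box n. f (shift_conf k \<gamma>)) / (2 * real n) ^ ?d"
    for f :: "'a set \<Rightarrow> real" and n \<gamma>
  define F1 where "F1 M \<gamma> = min (real M) (F \<gamma>)" for M \<gamma>
  define F2 where "F2 M \<gamma> = F \<gamma> - F1 M \<gamma>" for M \<gamma>
  have F12: "0 \<le> F1 M \<gamma>" "F1 M \<gamma> \<le> real M" "0 \<le> F2 M \<gamma>" "F2 M \<gamma> \<le> F \<gamma>" for M \<gamma>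
    using F0[of \<gamma>] by (auto simp: F1_def F2_def)
  have [measurable]: "F1 M \<in> borel_measurable P" "F2 M \<in> borel_measurable P" for M
    unfolding F2_def F1_def by measurable
  have [measurable]: "K F \<in> borel_measurable P" "K (F1 M) \<in> borel_measurable P" "K (F2 M) \<in> borel_measurable P" for M
    by (rule measurable_K; measurable)+
  have int2: "integrable P (F2 M)" for M
    by (rule Bochner_Integration.integrable_bound[OF int]) (use F12 F0 in auto)
  have F2_lim: "(\<lambda>M. \<integral>\<gamma>. F2 M \<gamma> \<partial>P) \<longlonglongrightarrow> 0"
  proof -
    have "(\<lambda>M. \<integral>\<gamma>. F2 M \<gamma> \<partial>P) \<longlonglongrightarrow> (\<integral>\<gamma>. 0 \<partial>P)"
    proof (rule integral_dominated_convergence[where w = F])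
      show "AE \<gamma> in P. (\<lambda>M. F2 M \<gamma>) \<longlonglongrightarrow> 0"
      proof (rule AE_I2)
        fix \<gamma>
        obtain N where "F \<gamma> \<le> real N" using real_arch_simple by blast
        then have "\<forall>M\<ge>N. F2 M \<gamma> = 0" by (auto simp: F2_def F1_def)
        then show "(\<lambda>M. F2 M \<gamma>) \<longlonglongrightarrow> 0"
          by (intro tendsto_eventually) (auto simp: eventually_sequentially)
      qed
    qed (use int F12 in auto)
    then show ?thesis by simp
  qed
  have KF_fin: "AE \<gamma> in P. K F \<gamma> \<noteq> \<infinity>"
  proof -
    have "(\<integral>\<^sup>+\<gamma>. K F \<gamma> \<partial>P) = (\<integral>\<^sup>+\<gamma>. ennreal (F \<gamma>) \<partial>P)" by (rule DLR[symmetric]) measurable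
    also have "\<dots> \<noteq> \<infinity>" using int F0 by (simp add: nn_integral_eq_integral)
    finally show ?thesis by (intro nn_integral_PInf_AE) auto
  qed
  \<comment> \<open>Majorant of the error made in \<open>F - K F\<close> by truncating
    \<open>F\<close>. Its mean is at most twice that of \<open>F2 M\<close>, which tends to
    \<open>0\<close>.\<close>
  define Z' where "Z' M \<gamma> = F2 M \<gamma> + enn2real (K (F2 M) \<gamma>)" for M \<gamma>
  \<comment> \<open>\<open>enn2real\<close> sends infinity to \<open>0\<close>, so the mean is
    bounded and not computed.\<close>
  have KF2: "integrable P (\<lambda>\<gamma>. enn2real (K (F2 M) \<gamma>))" "(\<integral>\<gamma>. enn2real (K (F2 M) \<gamma>) \<partial>P) \<le> (\<integral>\<gamma>. F2 M \<gamma> \<partial>P)" for M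
  proof -
    have "(\<integral>\<^sup>+\<gamma>. ennreal (enn2real (K (F2 M) \<gamma>)) \<partial>P) \<le> (\<integral>\<^sup>+\<gamma>. K (F2 M) \<gamma> \<partial>P)"
      by (intro nn_integral_mono) (simp add: ennreal_enn2real_if)
    also have "\<dots> = (\<integral>\<^sup>+\<gamma>. ennreal (F2 M \<gamma>) \<partial>P)" by (rule DLR[symmetric]) measurable
    also have "\<dots> = ennreal (\<integral>\<gamma>. F2 M \<gamma> \<partial>P)" using int2 F12 by (intro nn_integral_eq_integral) auto
    finally have *: "(\<integral>\<^sup>+\<gamma>. ennreal (enn2real (K (F2 M) \<gamma>)) \<partial>P) \<le> ennreal (\<integral>\<gamma>. F2 M \<gamma> \<partial>P)" .
    then show i: "integrable P (\<lambda>\<gamma>. enn2real (K (F2 M) \<gamma>))"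
      by (intro integrableI_nonneg) (auto intro: le_less_trans)
    show "(\<integral>\<gamma>. enn2real (K (F2 M) \<gamma>) \<partial>P) \<le> (\<integral>\<gamma>. F2 M \<gamma> \<partial>P)"
      using * F12 by (subst (asm) nn_integral_eq_integral[OF i]) auto
  qed
  have Z'_int: "integrable P (Z' M)" "(\<integral>\<gamma>. Z' M \<gamma> \<partial>P) \<le> 2 * (\<integral>\<gamma>. F2 M \<gamma> \<partial>P)" "Z' M \<gamma> \<ge> 0" for M \<gamma>
    unfolding Z'_def using int2 KF2 F12 by auto
  have dom: "AE \<gamma> in P. \<bar>T \<gamma> - (F1 M \<gamma> - enn2real (K (F1 M) \<gamma>))\<bar> \<le> Z' M \<gamma>" for M
    using KF_fin AE_space
  proof eventually_elim
    case (elim \<gamma>)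
    have "K (\<lambda>\<gamma>. ennreal (F1 M \<gamma>) + ennreal (F2 M \<gamma>)) \<gamma> = K (F1 M) \<gamma> + K (F2 M) \<gamma>"
      by (rule K_add) (use elim in \<open>auto simp: space_P\<close>)
    also have "(\<lambda>\<gamma>. ennreal (F1 M \<gamma>) + ennreal (F2 M \<gamma>)) = (\<lambda>\<gamma>. ennreal (F \<gamma>))"
      using F12 by (simp add: ennreal_plus[symmetric] F2_def del: ennreal_plus)
    finally have "K F \<gamma> = K (F1 M) \<gamma> + K (F2 M) \<gamma>" .
    then have "enn2real (K F \<gamma>) = enn2real (K (F1 M) \<gamma>) + enn2real (K (F2 M) \<gamma>)"
      using elim by (simp add: enn2real_plus less_top)
    then show ?case
      using F12[of M \<gamma>] enn2real_nonneg[of "K (F2 M) \<gamma>"] by (simp add: T_def Z'_def F2_def abs_le_iff)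
  qed
  have small: "AE \<gamma> in P. \<forall>\<^sub>F n in sequentially. \<bar>avg T n \<gamma>\<bar> < \<epsilon>" if \<epsilon>: "\<epsilon> > 0" for \<epsilon>
  proof (rule AE_I_small)
    fix \<delta> :: real assume \<delta>: "\<delta> > 0"
    \<comment> \<open>The maximal inequality is used at level \<open>\<epsilon> / 2\<close>, leaving
      the other half to the truncated part; \<open>M\<close> is chosen to make the exceptional
      probability at most \<open>\<delta>\<close>.\<close>
    have "(\<lambda>M. 4 ^ ?d * (2 * (\<integral>\<gamma>. F2 M \<gamma> \<partial>P)) / (\<epsilon> / 2)) \<longlonglongrightarrow> 4 ^ ?d * (2 * 0) / (\<epsilon> / 2)"
      using \<epsilon> by (intro tendsto_intros F2_lim) simp
    then have "\<forall>\<^sub>F M in sequentially. 4 ^ ?d * (2 * (\<integral>\<gamma>. F2 M \<gamma> \<partial>P)) / (\<epsilon> / 2) < \<delta>"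
      using \<delta> by (intro order_tendstoD) auto
    then obtain M where M: "4 ^ ?d * (2 * (\<integral>\<gamma>. F2 M \<gamma> \<partial>P)) / (\<epsilon> / 2) < \<delta>"
      by (auto simp: eventually_sequentially)
    define A where "A = {\<gamma> \<in> space P. \<exists>n>0. \<epsilon> / 2 * (2 * real n) ^ ?d < (\<Sum>k\<in>lattice_box n. Z' M (shift_conf k \<gamma>))}"
    have [measurable]: "Z' M \<in> borel_measurable P" using Z'_int by auto
    have "A \<in> sets P" unfolding A_def by measurable
    moreover have "prob A \<le> \<delta>"
    proof -
      have "prob A \<le> 4 ^ ?d * (\<integral>\<gamma>. Z' M \<gamma> \<partial>P) / (\<epsilon> / 2)"
        unfolding A_def using \<epsilon> Z'_int by (intro maximal_inequality) auto
      also have "\<dots> \<le> 4 ^ ?d * (2 * (\<integral>\<gamma>. F2 M \<gamma> \<partial>P)) / (\<epsilon> / 2)"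
        using \<epsilon> Z'_int by (intro divide_right_mono mult_left_mono) auto
      finally show ?thesis using M by simp
    qed
    moreover have "AE \<gamma> in P. \<gamma> \<notin> A \<longrightarrow> (\<forall>\<^sub>F n in sequentially. \<bar>avg T n \<gamma>\<bar> < \<epsilon>)"
    proof -
      have "AE \<gamma> in P. (\<lambda>n. avg (\<lambda>\<gamma>. F1 M \<gamma> - enn2real (K (F1 M) \<gamma>)) n \<gamma>) \<longlonglongrightarrow> 0"
        unfolding avg_def
      proof (rule bounded_lln)
        fix \<gamma> \<gamma>' :: "'a set" assume "\<gamma> \<inter> W = \<gamma>' \<inter> W"
        then show "F1 M \<gamma> = F1 M \<gamma>'" using loc unfolding F1_def by metis
      qed (use F12 in auto)
      then show ?thesis
        using AE_lattice[OF dom[of M]] AE_space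
      proof eventually_elim
        case (elim \<gamma>)
        show ?case
        proof
          assume "\<gamma> \<notin> A"
          then have A: "(\<Sum>k\<in>lattice_box n. Z' M (shift_conf k \<gamma>)) \<le> \<epsilon> / 2 * (2 * real n) ^ ?d" if "n > 0" for n
            using elim(3) that \<open>\<gamma> \<notin> A\<close> unfolding A_def mem_Collect_eq by (meson not_less)
          let ?Y = "\<lambda>\<gamma>. F1 M \<gamma> - enn2real (K (F1 M) \<gamma>)"
          have bd: "\<bar>avg T n \<gamma> - avg ?Y n \<gamma>\<bar> \<le> \<epsilon> / 2" if n: "n > 0" for n
          proof -
            have "\<bar>(\<Sum>k\<in>lattice_box n. T (shift_conf k \<gamma>)) - (\<Sum>k\<in>lattice_box n. ?Y (shift_conf k \<gamma>))\<bar>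
              \<le> (\<Sum>k\<in>lattice_box n. Z' M (shift_conf k \<gamma>))"
              unfolding sum_subtractf[symmetric]
              by (rule order_trans[OF sum_abs]) (rule sum_mono, use elim in blast)
            also have "\<dots> \<le> \<epsilon> / 2 * (2 * real n) ^ ?d" by (rule A[OF n])
            finally show ?thesis
              unfolding avg_def diff_divide_distrib[symmetric] abs_divide using n by (subst pos_divide_le_eq) auto
          qed
          have "\<forall>\<^sub>F n in sequentially. \<bar>avg ?Y n \<gamma>\<bar> < \<epsilon> / 2"
            using tendsto_rabs_zero[OF elim(1)] \<epsilon> by (intro order_tendstoD) auto
          then show "\<forall>\<^sub>F n in sequentially. \<bar>avg T n \<gamma>\<bar> < \<epsilon>"
            using eventually_gt_at_top[of 0]
          proof eventually_elim
            case (elim n)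
            show ?case using bd[of n] elim by linarith
          qed
        qed
      qed
    qed
    ultimately show "\<exists>A\<in>sets P. prob A \<le> \<delta> \<and> (AE \<gamma> in P. \<gamma> \<notin> A \<longrightarrow> (\<forall>\<^sub>F n in sequentially. \<bar>avg T n \<gamma>\<bar> < \<epsilon>))"
      by blast
  qed
  have "AE \<gamma> in P. \<forall>i. \<forall>\<^sub>F n in sequentially. \<bar>avg T n \<gamma>\<bar> < 1 / real (Suc i)"
    unfolding AE_all_countable by (intro allI small) simp
  then have "AE \<gamma> in P. (\<lambda>n. avg T n \<gamma>) \<longlonglongrightarrow> 0"
  proof eventually_elim
    case (elim \<gamma>)
    show ?case
    proof (rule tendstoI)
      fix e :: real assume "e > 0"
      then obtain i where i: "1 / real (Suc i) < e" using nat_approx_posE by blast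
      show "\<forall>\<^sub>F n in sequentially. dist (avg T n \<gamma>) 0 < e"
        using elim[rule_format, of i] by eventually_elim (use i in \<open>auto simp: dist_norm\<close>)
    qed
  qed
  then show ?thesis by (simp add: avg_def T_def)
qed

text \<open>The conditional probability of \<open>A\<close> is positive but not bounded away from \<open>0\<close>, and \<open>P\<close> need not be
  ergodic; the maximal inequality bounds the density of the cubes where it is below \<open>1 / (j + 1)\<close>
  outside an event whose probability vanishes as \<open>j\<close> grows.\<close>

lemma density:
  assumes A: "A \<inter> space P \<in> sets P"
    and loc: "\<And>\<gamma> \<gamma>'. \<gamma> \<inter> W = \<gamma>' \<inter> W \<Longrightarrow> \<gamma> \<in> A \<longleftrightarrow> \<gamma>' \<in> A"
    and pos: "poisson_nn_integral W (indicator A) \<noteq> 0"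
  shows "AE \<gamma> in P. \<exists>\<rho>>0. \<forall>\<^sub>F n in sequentially.
    \<rho> * (2 * real n) ^ DIM('a) \<le> (\<Sum>k\<in>lattice_box n. indicator A (shift_conf k \<gamma>))"
proof -
  let ?d = "DIM('a)"
  let ?F = "indicator A :: 'a set \<Rightarrow> real"
  let ?V = "\<lambda>\<gamma>. enn2real (K ?F \<gamma>)"
  have [measurable]: "?F \<in> borel_measurable P" "(indicator A :: _ \<Rightarrow> ennreal) \<in> borel_measurable P"
    using A by (simp_all only: borel_measurable_indicator_iff)
  have Kind: "K ?F = K (indicator A)" by (simp add: ennreal_indicator)
  have [measurable]: "K ?F \<in> borel_measurable P" by (rule measurable_K) measurable
  \<comment> \<open>The event depends on the window only, so under the kernel the outside enters
    through the weight alone, and a positive weight keeps a Poisson-positive event positive.\<close>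
  have V_pos: "AE \<gamma> in P. ?V \<gamma> > 0"
    using AE_Z AE_space
  proof eventually_elim
    case (elim \<gamma>)
    have lf: "locally_finite_conf \<gamma>" using elim by (simp add: space_P)
    have "poisson_nn_integral W (\<lambda>\<xi>. indicator A (\<xi> \<union> (\<gamma> - W)) * wt (\<xi> \<union> (\<gamma> - W))) \<noteq> 0"
    proof (rule poisson_pos_iff)
      have "poisson_nn_integral W (\<lambda>\<xi>. indicator A (\<xi> \<union> (\<gamma> - W))) = poisson_nn_integral W (indicator A)"
      proof (rule poisson_cong)
        fix \<xi> assume "\<xi> \<subseteq> W"
        then have "\<xi> \<union> (\<gamma> - W) \<in> A \<longleftrightarrow> \<xi> \<in> A" by (intro loc) auto
        then show "indicator A (\<xi> \<union> (\<gamma> - W)) = (indicator A \<xi> :: ennreal)" by (simp add: indicator_def)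
      qed
      then show "poisson_nn_integral W (\<lambda>\<xi>. indicator A (\<xi> \<union> (\<gamma> - W))) \<noteq> 0" using pos by simp
    qed (use K_integrand_measurable[OF lf, of "indicator A"] wt_pos in auto)
    then have "K (indicator A) \<gamma> \<noteq> 0"
      using elim unfolding K_def by (auto simp: ennreal_divide_eq_0_iff)
    moreover have "K (indicator A) \<gamma> \<le> 1" by (rule K_le_const[OF lf]) (simp add: indicator_def)
    then have "K (indicator A) \<gamma> < \<infinity>" using le_less_trans by fastforce
    ultimately show ?case unfolding Kind by (simp add: enn2real_positive_iff zero_less_iff_neq_zero)
  qed
  have conv: "AE \<gamma> in P. (\<lambda>n. (\<Sum>k\<in>lattice_box n. ?F (shift_conf k \<gamma>) - ?V (shift_conf k \<gamma>))
      / (2 * real n) ^ ?d) \<longlonglongrightarrow> 0"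
  proof (rule bounded_lln[where M = 1])
    fix \<gamma> \<gamma>' :: "'a set" assume "\<gamma> \<inter> W = \<gamma>' \<inter> W"
    then have "\<gamma> \<in> A \<longleftrightarrow> \<gamma>' \<in> A" by (rule loc)
    then show "?F \<gamma> = ?F \<gamma>'" by (simp add: indicator_def)
  next
    show "?F \<in> borel_measurable P" by measurable
  qed (auto simp: indicator_def)
  \<comment> \<open>Since the conditional probability is positive almost surely, these events
    decrease to a null set.\<close>
  define Bad where "Bad j = {\<gamma> \<in> space P. ?V \<gamma> < 1 / real (Suc j)}" for j
  have [measurable]: "Bad j \<in> sets P" for j unfolding Bad_def by measurable
  have Bad_lim: "(\<lambda>j. prob (Bad j)) \<longlonglongrightarrow> 0"
  proof -
    have "1 / real (Suc (Suc j)) \<le> 1 / real (Suc j)" for j by (intro frac_le) auto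
    then have "decseq Bad"
      unfolding decseq_Suc_iff Bad_def by (auto intro: less_le_trans simp del: of_nat_Suc)
    then have "(\<lambda>j. prob (Bad j)) \<longlonglongrightarrow> prob (\<Inter>j. Bad j)"
      by (intro finite_Lim_measure_decseq) auto
    moreover have "prob (\<Inter>j. Bad j) = 0"
    proof -
      have "AE \<gamma> in P. \<gamma> \<notin> (\<Inter>j. Bad j)"
        using V_pos
      proof eventually_elim
        case (elim \<gamma>)
        then obtain j where "1 / real (Suc j) < ?V \<gamma>" using nat_approx_posE by blast
        then show ?case by (auto simp: Bad_def intro!: exI[of _ j])
      qed
      then show ?thesis by (intro measure_eq_0_null_sets) (simp add: AE_iff_null_sets)
    qed
    ultimately show ?thesis by simp
  qed
  show ?thesis
  proof (rule AE_I_small)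
    fix \<delta> :: real assume \<delta>: "\<delta> > 0"
    have "(\<lambda>j. 4 ^ ?d * prob (Bad j) / (1 / 2)) \<longlonglongrightarrow> 4 ^ ?d * 0 / (1 / 2)"
      by (intro tendsto_intros Bad_lim) simp
    then have "\<forall>\<^sub>F j in sequentially. 4 ^ ?d * prob (Bad j) / (1 / 2) < \<delta>"
      using \<delta> by (intro order_tendstoD) auto
    then obtain j where j: "4 ^ ?d * prob (Bad j) / (1 / 2) < \<delta>" by (auto simp: eventually_sequentially)
    define c where "c = 1 / real (Suc j)"
    have c: "c > 0" by (simp add: c_def)
    \<comment> \<open>Off \<open>S\<close>, at least half of the sites of every nonempty box have
      conditional probability at least \<open>c\<close>.\<close>
    define S where "S = {\<gamma> \<in> space P. \<exists>n>0. 1 / 2 * (2 * real n) ^ ?d < (\<Sum>k\<in>lattice_box n. indicat_real (Bad j) (shift_conf k \<gamma>))}"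
    have "S \<in> sets P" unfolding S_def by measurable
    moreover have "prob S \<le> \<delta>"
    proof -
      have "prob S \<le> 4 ^ ?d * (\<integral>\<gamma>. indicator (Bad j) \<gamma> \<partial>P) / (1 / 2)"
        unfolding S_def by (intro maximal_inequality integrable_real_indicator) (auto simp: emeasure_eq_measure)
      then show ?thesis using j by simp
    qed
    moreover have "AE \<gamma> in P. \<gamma> \<notin> S \<longrightarrow> (\<exists>\<rho>>0. \<forall>\<^sub>F n in sequentially.
      \<rho> * (2 * real n) ^ ?d \<le> (\<Sum>k\<in>lattice_box n. indicator A (shift_conf k \<gamma>)))"
      using conv AE_space
    proof eventually_elim
      case (elim \<gamma>)
      show ?case
      proof
        assume "\<gamma> \<notin> S"
        then have S: "(\<Sum>k\<in>lattice_box n. indicat_real (Bad j) (shift_conf k \<gamma>)) \<le> 1 / 2 * (2 * real n) ^ ?d" if "n > 0" for n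
          using elim(2) that \<open>\<gamma> \<notin> S\<close> unfolding S_def mem_Collect_eq by (meson not_less)
        \<comment> \<open>The conditional probabilities average to at least \<open>c / 2\<close>; an
          error of at most \<open>c / 4\<close> in the law of large numbers leaves density
          \<open>c / 4\<close>.\<close>
        have "\<forall>\<^sub>F n in sequentially. - (c / 4) < (\<Sum>k\<in>lattice_box n. ?F (shift_conf k \<gamma>) - ?V (shift_conf k \<gamma>)) / (2 * real n) ^ ?d"
          using elim(1) c by (intro order_tendstoD) auto
        then have "\<forall>\<^sub>F n in sequentially. c / 4 * (2 * real n) ^ ?d \<le> (\<Sum>k\<in>lattice_box n. ?F (shift_conf k \<gamma>))"
          using eventually_gt_at_top[of 0]
        proof eventually_elim
          case n: (elim n)
          let ?a = "(2 * real n) ^ ?d"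
          have a: "?a > 0" using n by simp
          have "- (c / 4) * ?a < (\<Sum>k\<in>lattice_box n. ?F (shift_conf k \<gamma>)) - (\<Sum>k\<in>lattice_box n. ?V (shift_conf k \<gamma>))"
            using n(1) a by (subst (asm) pos_less_divide_eq) (auto simp: sum_subtractf)
          moreover have "c * (1 / 2) * ?a \<le> (\<Sum>k\<in>lattice_box n. ?V (shift_conf k \<gamma>))"
          proof -
            have "c * (?a - 1 / 2 * ?a) \<le> c * (?a - (\<Sum>k\<in>lattice_box n. indicat_real (Bad j) (shift_conf k \<gamma>)))"
              using S[OF n(2)] c by (intro mult_left_mono diff_left_mono) simp_all
            also have "\<dots> = (\<Sum>k\<in>lattice_box n. c * (1 - indicat_real (Bad j) (shift_conf k \<gamma>)))"
              by (simp add: sum_distrib_left[symmetric] sum_subtractf card_lattice_box)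
            also have "\<dots> \<le> (\<Sum>k\<in>lattice_box n. ?V (shift_conf k \<gamma>))"
              using translate_space elim(2) by (intro sum_mono) (auto simp: indicator_def Bad_def c_def)
            finally show ?thesis by (simp add: algebra_simps)
          qed
          ultimately show ?case by (simp add: algebra_simps)
        qed
        then show "\<exists>\<rho>>0. \<forall>\<^sub>F n in sequentially.
          \<rho> * (2 * real n) ^ ?d \<le> (\<Sum>k\<in>lattice_box n. indicator A (shift_conf k \<gamma>))"
          using c by (intro exI[of _ "c / 4"]) auto
      qed
    qed
    ultimately show "\<exists>S\<in>sets P. prob S \<le> \<delta> \<and> (AE \<gamma> in P. \<gamma> \<notin> S \<longrightarrow> (\<exists>\<rho>>0. \<forall>\<^sub>F n in sequentially.
      \<rho> * (2 * real n) ^ ?d \<le> (\<Sum>k\<in>lattice_box n. indicator A (shift_conf k \<gamma>))))" by blast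
  qed
qed

end

section \<open>Averages over boxes\<close>

definition unit_cube :: "'a::euclidean_space set" where
  "unit_cube = {x. \<forall>b\<in>Basis. 0 \<le> x \<bullet> b \<and> x \<bullet> b < 1}"

text \<open>It differs from \<open>Lambda n\<close> by the upper faces, which are Lebesgue-null but
  might carry points of a configuration; \<open>AE_no_boundary_points\<close> deals with
  those.\<close>

definition half_open_box :: "nat \<Rightarrow> 'a::euclidean_space set" where
  "half_open_box n = {x. \<forall>b\<in>Basis. - real n \<le> x \<bullet> b \<and> x \<bullet> b < real n}"

lemma unit_cube_borel [measurable]: "unit_cube \<in> sets (borel :: 'a::euclidean_space measure)"
proof -
  have "unit_cube = {x \<in> space (borel :: 'a measure). \<forall>b\<in>Basis. 0 \<le> x \<bullet> b \<and> x \<bullet> b < 1}"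
    by (simp add: unit_cube_def)
  also have "\<dots> \<in> sets borel" by measurable
  finally show ?thesis .
qed

lemma emeasure_unit_cube: "emeasure lborel (unit_cube :: 'a::euclidean_space set) = 1"
proof (rule antisym)
  have "emeasure lborel (unit_cube :: 'a set) \<le> emeasure lborel (cbox 0 One :: 'a set)"
    by (intro emeasure_mono) (auto simp: unit_cube_def mem_box less_imp_le)
  then show "emeasure lborel (unit_cube :: 'a set) \<le> 1" by (simp add: emeasure_lborel_cbox_eq)
  have "emeasure lborel (box 0 One :: 'a set) \<le> emeasure lborel (unit_cube :: 'a set)"
    by (intro emeasure_mono) (auto simp: unit_cube_def mem_box less_imp_le)
  then show "1 \<le> emeasure lborel (unit_cube :: 'a set)" by (simp add: emeasure_lborel_box_eq)
qed

lemma half_open_box_subset: "half_open_box n \<subseteq> Lambda n"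
  by (auto simp: half_open_box_def mem_Lambda less_imp_le)

lemma AE_half_open_box: "AE x in lborel. x \<in> Lambda n \<longleftrightarrow> x \<in> half_open_box n"
proof -
  have box: "box (- (real n *\<^sub>R One)) (real n *\<^sub>R One) \<subseteq> (half_open_box n :: 'a set)"
    by (auto simp: half_open_box_def mem_box less_imp_le)
  have "emeasure lborel (Lambda n - box (- (real n *\<^sub>R One)) (real n *\<^sub>R One) :: 'a set)
    = emeasure lborel (Lambda n :: 'a set) - emeasure lborel (box (- (real n *\<^sub>R One)) (real n *\<^sub>R One) :: 'a set)"
    by (intro emeasure_Diff) (auto simp: Lambda_def mem_box less_imp_le emeasure_lborel_box_eq)
  also have "\<dots> = 0"
    by (auto simp: Lambda_def emeasure_lborel_box_eq emeasure_lborel_cbox_eq)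
  finally have "AE x in lborel. x \<notin> (Lambda n - box (- (real n *\<^sub>R One)) (real n *\<^sub>R One) :: 'a set)"
    by (intro AE_not_in) (simp add: null_sets_def Lambda_def)
  then show ?thesis by eventually_elim (use box half_open_box_subset in auto)
qed

lemma lattice_floor:
  fixes x :: "'a::euclidean_space"
  defines "k \<equiv> \<Sum>b\<in>Basis. of_int \<lfloor>x \<bullet> b\<rfloor> *\<^sub>R b"
  shows "b \<in> Basis \<Longrightarrow> k \<bullet> b = of_int \<lfloor>x \<bullet> b\<rfloor>" "x - k \<in> unit_cube"
proof -
  show k: "k \<bullet> b = of_int \<lfloor>x \<bullet> b\<rfloor>" if "b \<in> Basis" for b
    using that by (simp add: k_def inner_sum_left inner_Basis if_distrib cong: if_cong)
  show "x - k \<in> unit_cube"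
    by (auto simp: unit_cube_def inner_diff_left k) linarith
qed

text \<open>The coordinatewise floor is the only lattice point whose cube contains
  \<open>x\<close>.\<close>

lemma sum_indicator_unit_cube:
  fixes x :: "'a::euclidean_space"
  shows "(\<Sum>k\<in>lattice_box n. indicator unit_cube (x - k)) = (indicator (half_open_box n) x :: 'b::{comm_semiring_1})"
proof (cases "x \<in> half_open_box n")
  case True
  define k where "k = (\<Sum>b\<in>Basis. of_int \<lfloor>x \<bullet> b\<rfloor> *\<^sub>R b)"
  note k = lattice_floor[where x = x, folded k_def]
  have kn: "k \<in> lattice_box n"
    unfolding lattice_box_def
  proof safe
    fix b :: 'a assume b: "b \<in> Basis"
    then have "- int n \<le> \<lfloor>x \<bullet> b\<rfloor>" "\<lfloor>x \<bullet> b\<rfloor> < int n"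
      using True by (simp_all add: half_open_box_def le_floor_iff floor_less_iff)
    then show "k \<bullet> b \<in> \<int>" "- real n \<le> k \<bullet> b" "k \<bullet> b < real n"
      unfolding k(1)[OF b] by simp_all
  qed
  have uniq: "j = k" if "j \<in> lattice_box n" "x - j \<in> unit_cube" for j
  proof (rule euclidean_eqI)
    fix b :: 'a assume b: "b \<in> Basis"
    have "j \<bullet> b \<in> \<int>" "0 \<le> x \<bullet> b - j \<bullet> b" "x \<bullet> b - j \<bullet> b < 1"
      using that b by (auto simp: lattice_box_def unit_cube_def inner_diff_left)
    then obtain i where "j \<bullet> b = of_int i" "of_int i \<le> x \<bullet> b" "x \<bullet> b < of_int i + 1"
      by (auto elim: Ints_cases)
    then have "\<lfloor>x \<bullet> b\<rfloor> = i" by (intro floor_unique)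
    then show "j \<bullet> b = k \<bullet> b" using b k \<open>j \<bullet> b = of_int i\<close> by simp
  qed
  have "(\<Sum>j\<in>lattice_box n. indicator unit_cube (x - j) :: 'b) = (\<Sum>j\<in>lattice_box n. if j = k then 1 else 0)"
  proof (intro sum.cong refl)
    fix j :: 'a assume j: "j \<in> lattice_box n"
    show "(indicator unit_cube (x - j) :: 'b) = (if j = k then 1 else 0)"
    proof (cases "j = k")
      case True
      then show ?thesis using k(2) by simp
    next
      case False
      then have "x - j \<notin> unit_cube" using uniq j by blast
      then show ?thesis using False by simp
    qed
  qed
  then show ?thesis using True kn by simp
next
  case False
  have "x - k \<notin> unit_cube" if "k \<in> lattice_box n" for k
  proof
    assume *: "x - k \<in> unit_cube"
    have "x \<in> half_open_box n"
      unfolding half_open_box_def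
    proof safe
      fix b :: 'a assume b: "b \<in> Basis"
      have kb: "k \<bullet> b \<in> \<int>" "- real n \<le> k \<bullet> b" "k \<bullet> b < real n" "0 \<le> x \<bullet> b - k \<bullet> b" "x \<bullet> b - k \<bullet> b < 1"
        using that * b by (auto simp: lattice_box_def unit_cube_def inner_diff_left)
      obtain i where i: "k \<bullet> b = of_int i" using kb(1) by (auto elim: Ints_cases)
      then have "i < int n" using kb(3) by (metis of_int_less_iff of_int_of_nat_eq)
      then have "of_int i + 1 \<le> real n" by linarith
      then show "- real n \<le> x \<bullet> b" "x \<bullet> b < real n" using kb i by linarith+
    qed
    then show False using False by simp
  qed
  then show ?thesis using False by (simp add: indicator_def)
qed

lemma countable_locally_finite:
  assumes "locally_finite_conf \<gamma>"
  shows "countable \<gamma>"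
proof -
  have "\<gamma> = (\<Union>n::nat. \<gamma> \<inter> cball 0 (real n))"
    using real_arch_simple by auto
  moreover have "countable (\<gamma> \<inter> cball 0 (real n))" for n
    using locally_finite_confD[OF assms, of "cball 0 (real n)"] by (simp add: countable_finite)
  ultimately show ?thesis by (metis countable_UN countableI_type)
qed

lemma AE_not_in_config:
  assumes "locally_finite_conf \<gamma>"
  shows "AE y in lborel. y \<notin> \<gamma>"
  by (rule AE_not_in) (simp add: countable_imp_null_set_lborel countable_locally_finite assms)

section \<open>Point sums and integrals of the local energy, cube by cube\<close>

context gibbs_window
begin

lemma cball_unit_cube: "x \<in> unit_cube \<Longrightarrow> cball x R \<subseteq> W"
proof
  fix y assume x: "x \<in> unit_cube" and y: "y \<in> cball x R"
  show "y \<in> W"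
    unfolding mem_Lambda
  proof safe
    fix b :: 'a assume b: "b \<in> Basis"
    have "\<bar>(x - y) \<bullet> b\<bar> \<le> R" using Basis_le_norm[OF b, of "x - y"] y by (simp add: dist_norm)
    moreover have "0 \<le> x \<bullet> b" "x \<bullet> b < 1" using x b by (auto simp: unit_cube_def)
    ultimately show "- real m \<le> y \<bullet> b" "y \<bullet> b \<le> real m"
      using m_ge by (auto simp: inner_diff_left abs_le_iff)
  qed
qed

lemma unit_cube_subset_W: "unit_cube \<subseteq> W"
  using cball_unit_cube R_pos by fastforce

lemma hr_local_W: "x \<in> unit_cube \<Longrightarrow> \<gamma> \<inter> W = \<gamma>' \<inter> W \<Longrightarrow> hr x \<gamma> = hr x \<gamma>'"
  using cball_unit_cube by (intro hr_local) blast

lemma measurable_hr_pair: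
  assumes "u \<in> borel_measurable M" "f \<in> measurable M P"
  shows "(\<lambda>w. hr (u w) (f w)) \<in> borel_measurable M"
  using assms by (intro measurable_hr) (simp_all cong: measurable_cong_sets add: sets_P)

text \<open>Georgii-Nguyen-Zessin formula at a fixed outside configuration: the Mecke formula is
  applied with the Gibbs weight absorbed into the summand, and the weight of the enlarged
  configuration is factored by \<open>wt_insert\<close>.\<close>

lemma GNZ:
  fixes \<phi> :: "'a \<Rightarrow> 'a set \<Rightarrow> ennreal"
  assumes \<phi>: "(\<lambda>(x, \<gamma>). \<phi> x \<gamma>) \<in> borel_measurable (borel \<Otimes>\<^sub>M config_space)"
    and C [measurable]: "C \<in> sets borel" and CW: "C \<subseteq> W" and lf: "locally_finite_conf \<gamma>"
  shows "K (\<lambda>\<gamma>. \<Sum>x\<in>\<gamma> \<inter> C. \<phi> x (\<gamma> - {x})) \<gamma>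
    = K (\<lambda>\<gamma>. \<integral>\<^sup>+y. indicator C y * (ennreal (z * exp (- \<beta> * hr y \<gamma>)) * \<phi> y \<gamma>) \<partial>lborel) \<gamma>"
proof -
  let ?o = "\<gamma> - W"
  \<comment> \<open>The Mecke formula passes the configuration without \<open>x\<close>, whereas the
    weight belongs to the one with \<open>x\<close>; hence the \<open>insert\<close>.\<close>
  define G where "G x \<xi> = indicator C x * \<phi> x (\<xi> \<union> ?o) * wt (insert x (\<xi> \<union> ?o))" for x \<xi>
  have r: "(\<lambda>w. snd w \<union> ?o) \<in> measurable (borel \<Otimes>\<^sub>M config_space) config_space"
    using measurable_compose[OF measurable_snd measurable_replace_fix[OF lf]] .
  have "(\<lambda>w. insert (fst w) (snd w \<union> ?o)) \<in> measurable (borel \<Otimes>\<^sub>M config_space) config_space"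
    by (intro measurable_insert_config r) simp
  note [measurable] = measurable_wt[OF this] measurable_pair_fix[OF \<phi> r measurable_fst]
  have G: "(\<lambda>(x, \<xi>). G x \<xi>) \<in> borel_measurable (borel \<Otimes>\<^sub>M config_space)"
    unfolding G_def split_beta' by measurable
  have "poisson_nn_integral W (\<lambda>\<xi>. (\<Sum>x\<in>(\<xi> \<union> ?o) \<inter> C. \<phi> x ((\<xi> \<union> ?o) - {x})) * wt (\<xi> \<union> ?o))
    = poisson_nn_integral W (\<lambda>\<xi>. \<Sum>x\<in>\<xi>. G x (\<xi> - {x}))"
  proof (rule poisson_cong)
    fix \<xi> :: "'a set" assume \<xi>: "finite \<xi>" "\<xi> \<subseteq> W"
    have "(\<Sum>x\<in>(\<xi> \<union> ?o) \<inter> C. \<phi> x ((\<xi> \<union> ?o) - {x})) * wt (\<xi> \<union> ?o) = (\<Sum>x\<in>\<xi> \<inter> C. \<phi> x ((\<xi> \<union> ?o) - {x}) * wt (\<xi> \<union> ?o))"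
      using CW by (simp add: sum_distrib_right Int_Un_distrib2 Int_commute[of C] Diff_Int_distrib2 Diff_eq_empty_iff[THEN iffD2] Int_absorb1)
    also have "\<dots> = (\<Sum>x\<in>\<xi> \<inter> C. G x (\<xi> - {x}))"
    proof (intro sum.cong refl)
      fix x assume x: "x \<in> \<xi> \<inter> C"
      then have "(\<xi> \<union> ?o) - {x} = (\<xi> - {x}) \<union> ?o" "insert x ((\<xi> - {x}) \<union> ?o) = \<xi> \<union> ?o" using \<xi> by auto
      then show "\<phi> x ((\<xi> \<union> ?o) - {x}) * wt (\<xi> \<union> ?o) = G x (\<xi> - {x})" using x by (simp add: G_def)
    qed
    also have "\<dots> = (\<Sum>x\<in>\<xi>. G x (\<xi> - {x}))"
      using \<xi> by (intro sum.mono_neutral_left) (auto simp: G_def)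
    finally show "(\<Sum>x\<in>(\<xi> \<union> ?o) \<inter> C. \<phi> x ((\<xi> \<union> ?o) - {x})) * wt (\<xi> \<union> ?o) = (\<Sum>x\<in>\<xi>. G x (\<xi> - {x}))" .
  qed
  also have "\<dots> = poisson_nn_integral W (\<lambda>\<xi>. \<integral>\<^sup>+y. indicator W y * G y \<xi> \<partial>lborel)"
    by (rule poisson_mecke[OF _ G]) simp
  also have "\<dots> = poisson_nn_integral W (\<lambda>\<xi>. (\<integral>\<^sup>+y. indicator C y * (ennreal (z * exp (- \<beta> * hr y (\<xi> \<union> ?o))) * \<phi> y (\<xi> \<union> ?o)) \<partial>lborel) * wt (\<xi> \<union> ?o))"
  proof (rule poisson_cong)
    fix \<xi> :: "'a set" assume \<xi>: "finite \<xi>" "\<xi> \<subseteq> W"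
    let ?\<gamma> = "\<xi> \<union> ?o"
    have lf': "locally_finite_conf ?\<gamma>" using \<xi> lf by (intro lf_replace)
    have c: "(\<lambda>y. ?\<gamma>) \<in> measurable borel config_space"
      by (rule measurable_const) (simp add: space_config_space lf')
    have [measurable]: "(\<lambda>y. \<phi> y ?\<gamma>) \<in> borel_measurable borel" "(\<lambda>y. hr y ?\<gamma>) \<in> borel_measurable borel"
      using measurable_pair_fix[OF \<phi> c, of "\<lambda>y. y"] measurable_hr[OF c, of "\<lambda>y. y"] by simp_all
    have "(\<integral>\<^sup>+y. indicator W y * G y \<xi> \<partial>lborel)
       = (\<integral>\<^sup>+y. indicator C y * (ennreal (z * exp (- \<beta> * hr y ?\<gamma>)) * \<phi> y ?\<gamma>) * wt ?\<gamma> \<partial>lborel)"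
    \<comment> \<open>\<open>wt_insert\<close> requires a new point, and almost every
      \<open>y\<close> is new because a locally finite configuration is countable.\<close>
    proof (rule nn_integral_cong_AE, use AE_not_in_config[OF lf'] in eventually_elim)
      case (elim y)
      show ?case
      proof (cases "y \<in> C")
        case True
        then have "wt (insert y ?\<gamma>) = ennreal (z * exp (- \<beta> * hr y ?\<gamma>)) * wt ?\<gamma>"
          using wt_insert[OF lf' _ elim] CW by auto
        then show ?thesis using True CW by (simp add: G_def mult_ac subset_iff)
      qed (simp add: G_def)
    qed
    also have "\<dots> = (\<integral>\<^sup>+y. indicator C y * (ennreal (z * exp (- \<beta> * hr y ?\<gamma>)) * \<phi> y ?\<gamma>) \<partial>lborel) * wt ?\<gamma>"
      by (rule nn_integral_multc) measurable
    finally show "(\<integral>\<^sup>+y. indicator W y * G y \<xi> \<partial>lborel) = \<dots>" .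
  qed
  finally show ?thesis unfolding K_def by simp
qed

text \<open>Tonelli and stationarity of the field of local energies. Integrability over boxes
  thereby reduces to a condition at the origin.\<close>

lemma field_integral:
  fixes G :: "real \<Rightarrow> ennreal"
  assumes [measurable]: "G \<in> borel_measurable borel" "C \<in> sets borel"
  shows "(\<integral>\<^sup>+\<gamma>. \<integral>\<^sup>+x. indicator C x * G (hr x \<gamma>) \<partial>lborel \<partial>P)
    = emeasure lborel C * (\<integral>\<^sup>+\<gamma>. G (hr 0 \<gamma>) \<partial>P)"
proof -
  interpret pair_sigma_finite P "lborel :: 'a measure" ..
  have h[measurable]: "(\<lambda>w. hr (snd w) (fst w)) \<in> borel_measurable (P \<Otimes>\<^sub>M lborel)"
    by (intro measurable_hr_pair) measurable
  have hx[measurable]: "hr x \<in> borel_measurable P" for x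
    using measurable_hr_pair[of "\<lambda>_. x" P "\<lambda>\<gamma>. \<gamma>"] by simp
  have "(\<integral>\<^sup>+\<gamma>. \<integral>\<^sup>+x. indicator C x * G (hr x \<gamma>) \<partial>lborel \<partial>P) = (\<integral>\<^sup>+x. \<integral>\<^sup>+\<gamma>. indicator C x * G (hr x \<gamma>) \<partial>P \<partial>lborel)"
    by (rule Fubini'[symmetric]) (simp add: split_beta', measurable)
  also have "\<dots> = (\<integral>\<^sup>+x. indicator C x * (\<integral>\<^sup>+\<gamma>. G (hr 0 \<gamma>) \<partial>P) \<partial>lborel)"
  proof (intro nn_integral_cong)
    fix x :: 'a
    have "(\<integral>\<^sup>+\<gamma>. indicator C x * G (hr x \<gamma>) \<partial>P) = indicator C x * (\<integral>\<^sup>+\<gamma>. G (hr x \<gamma>) \<partial>P)"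
      by (rule nn_integral_cmult) measurable
    also have "(\<integral>\<^sup>+\<gamma>. G (hr x \<gamma>) \<partial>P) = (\<integral>\<^sup>+\<gamma>. G (hr x (translate_conf x \<gamma>)) \<partial>P)"
      by (rule nn_integral_translate[symmetric]) measurable
    also have "\<dots> = (\<integral>\<^sup>+\<gamma>. G (hr 0 \<gamma>) \<partial>P)"
      using hr_translate[of _ 0 x] by (intro nn_integral_cong) (simp add: space_P)
    finally show "(\<integral>\<^sup>+\<gamma>. indicator C x * G (hr x \<gamma>) \<partial>P) = indicator C x * (\<integral>\<^sup>+\<gamma>. G (hr 0 \<gamma>) \<partial>P)" .
  qed
  also have "\<dots> = emeasure lborel C * (\<integral>\<^sup>+\<gamma>. G (hr 0 \<gamma>) \<partial>P)"
    by (subst nn_integral_multc) auto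
  finally show ?thesis .
qed

lemma measurable_hr_fix:
  assumes "locally_finite_conf \<gamma>"
  shows "(\<lambda>x. hr x \<gamma>) \<in> borel_measurable borel"
  using measurable_hr[of "\<lambda>_. \<gamma>" borel "\<lambda>x. x"] assms by (simp add: space_config_space)

lemma measurable_field_integral:
  fixes G :: "real \<Rightarrow> ennreal"
  assumes [measurable]: "G \<in> borel_measurable borel" "C \<in> sets borel"
  shows "(\<lambda>\<gamma>. \<integral>\<^sup>+x. indicator C x * G (hr x \<gamma>) \<partial>lborel) \<in> borel_measurable P"
proof -
  have [measurable]: "(\<lambda>w. hr (snd w) (fst w)) \<in> borel_measurable (P \<Otimes>\<^sub>M lborel)"
    by (intro measurable_hr_pair) measurable
  show ?thesis
    by (rule lborel.borel_measurable_nn_integral) (simp add: split_beta', measurable)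
qed

lemma AE_field_integral_finite:
  fixes G :: "real \<Rightarrow> ennreal"
  assumes [measurable]: "G \<in> borel_measurable borel" and fin: "(\<integral>\<^sup>+\<gamma>. G (hr 0 \<gamma>) \<partial>P) < \<infinity>"
  shows "AE \<gamma> in P. \<forall>n. (\<integral>\<^sup>+x. indicator (Lambda n) x * G (hr x \<gamma>) \<partial>lborel) < \<infinity>"
  unfolding AE_all_countable
proof
  fix n
  have "(\<integral>\<^sup>+\<gamma>. \<integral>\<^sup>+x. indicator (Lambda n) x * G (hr x \<gamma>) \<partial>lborel \<partial>P) \<noteq> \<infinity>"
    using fin emeasure_compact_finite[OF compact_Lambda, of n, where 'a = 'a]
    by (subst field_integral) (auto simp: ennreal_mult_eq_top_iff less_top)
  then have "AE \<gamma> in P. (\<integral>\<^sup>+x. indicator (Lambda n) x * G (hr x \<gamma>) \<partial>lborel) \<noteq> \<infinity>"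
    by (intro nn_integral_PInf_AE measurable_field_integral) auto
  then show "AE \<gamma> in P. (\<integral>\<^sup>+x. indicator (Lambda n) x * G (hr x \<gamma>) \<partial>lborel) < \<infinity>"
    by eventually_elim (simp add: less_top)
qed

lemma integral_box_cubes:
  fixes G :: "real \<Rightarrow> ennreal"
  assumes [measurable]: "G \<in> borel_measurable borel" and lf: "locally_finite_conf \<gamma>"
  shows "(\<integral>\<^sup>+x. indicator (Lambda n) x * G (hr x \<gamma>) \<partial>lborel)
    = (\<Sum>k\<in>lattice_box n. \<integral>\<^sup>+x. indicator unit_cube x * G (hr x (shift_conf k \<gamma>)) \<partial>lborel)"
proof -
  note [measurable] = measurable_hr_fix[OF lf]
  have "(\<integral>\<^sup>+x. indicator (Lambda n) x * G (hr x \<gamma>) \<partial>lborel) = (\<integral>\<^sup>+x. indicator (half_open_box n) x * G (hr x \<gamma>) \<partial>lborel)"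
    by (rule nn_integral_cong_AE, use AE_half_open_box[of n] in eventually_elim) (simp add: indicator_def)
  also have "\<dots> = (\<integral>\<^sup>+x. (\<Sum>k\<in>lattice_box n. indicator unit_cube (x - k) * G (hr x \<gamma>)) \<partial>lborel)"
    by (simp add: sum_indicator_unit_cube flip: sum_distrib_right)
  also have "\<dots> = (\<Sum>k\<in>lattice_box n. \<integral>\<^sup>+x. indicator unit_cube (x - k) * G (hr x \<gamma>) \<partial>lborel)"
    by (rule nn_integral_sum) measurable
  also have "\<dots> = (\<Sum>k\<in>lattice_box n. \<integral>\<^sup>+x. indicator unit_cube x * G (hr x (shift_conf k \<gamma>)) \<partial>lborel)"
  proof (intro sum.cong refl)
    fix k :: 'a
    have "(\<integral>\<^sup>+x. indicator unit_cube (x - k) * G (hr x \<gamma>) \<partial>lborel)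
       = (\<integral>\<^sup>+x. indicator unit_cube (x - k) * G (hr x \<gamma>) \<partial>distr lborel borel ((+) k))"
      by (simp add: lborel_distr_plus)
    also have "\<dots> = (\<integral>\<^sup>+x. indicator unit_cube x * G (hr (k + x) \<gamma>) \<partial>lborel)"
      by (subst nn_integral_distr) auto
    also have "\<dots> = (\<integral>\<^sup>+x. indicator unit_cube x * G (hr x (shift_conf k \<gamma>)) \<partial>lborel)"
      using hr_shift[OF lf, of "k + _" k] by simp
    finally show "(\<integral>\<^sup>+x. indicator unit_cube (x - k) * G (hr x \<gamma>) \<partial>lborel)
       = (\<integral>\<^sup>+x. indicator unit_cube x * G (hr x (shift_conf k \<gamma>)) \<partial>lborel)" .
  qed
  finally show ?thesis .
qed

text \<open>A lattice shift carries a point on an upper face of a box into the Lebesgue-null set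
  \<open>N\<close> of points with a vanishing coordinate, where \<open>GNZ\<close> shows that the
  expected number of points is \<open>0\<close>.\<close>

lemma AE_no_boundary_points: "AE \<gamma> in P. \<forall>n. \<gamma> \<inter> Lambda n = \<gamma> \<inter> half_open_box n"
proof -
  define N :: "'a set" where "N = {x \<in> W. \<exists>b\<in>Basis. x \<bullet> b = 0}"
  have N [measurable]: "N \<in> sets borel"
  proof -
    have "N = {x \<in> space borel. x \<in> W \<and> (\<exists>b\<in>Basis. x \<bullet> b = 0)}" by (simp add: N_def)
    also have "\<dots> \<in> sets borel" by measurable
    finally show ?thesis .
  qed
  have N0: "AE x in lborel. x \<notin> N"
  proof -
    have "AE x in lborel. x \<bullet> b \<noteq> 0" if "b \<in> Basis" for b :: 'a
    proof -
      have "negligible {x. b \<bullet> x = 0}" using that by (intro negligible_hyperplane) auto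
      then have "{x. x \<bullet> b = 0} \<in> null_sets lborel"
        by (simp add: negligible_iff_null_sets null_sets_completion_iff inner_commute)
      then show ?thesis using AE_not_in by fastforce
    qed
    then have "AE x in lborel. \<forall>b\<in>(Basis :: 'a set). x \<bullet> b \<noteq> 0" by (simp add: AE_finite_all)
    then show ?thesis by eventually_elim (auto simp: N_def)
  qed
  let ?S = "\<lambda>\<gamma>. \<Sum>x\<in>\<gamma> \<inter> N. 1 :: ennreal"
  have S: "?S \<in> borel_measurable P"
    unfolding borel_measurable_P
    by (rule measurable_sum_config[OF measurable_ident_sets]) (auto simp: N_def intro: bounded_subset[OF W_positive(2)])
  have "(\<integral>\<^sup>+\<gamma>. ?S \<gamma> \<partial>P) = (\<integral>\<^sup>+\<gamma>. K ?S \<gamma> \<partial>P)" by (rule DLR[OF S])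
  also have "\<dots> = (\<integral>\<^sup>+\<gamma>. 0 \<partial>P)"
  proof (intro nn_integral_cong)
    fix \<gamma> assume "\<gamma> \<in> space P"
    then have lf: "locally_finite_conf \<gamma>" by (simp add: space_P)
    have "K ?S \<gamma> = K (\<lambda>\<gamma>. \<integral>\<^sup>+y. indicator N y * (ennreal (z * exp (- \<beta> * hr y \<gamma>)) * 1) \<partial>lborel) \<gamma>"
      by (rule GNZ[OF _ N _ lf]) (auto simp: N_def)
    also have "(\<lambda>\<gamma>. \<integral>\<^sup>+y. indicator N y * (ennreal (z * exp (- \<beta> * hr y \<gamma>)) * 1) \<partial>lborel) = (\<lambda>\<gamma>. 0)"
    proof
      fix \<gamma>
      have "(\<integral>\<^sup>+y. indicator N y * (ennreal (z * exp (- \<beta> * hr y \<gamma>)) * 1) \<partial>lborel) = (\<integral>\<^sup>+(y::'a). 0 \<partial>lborel)"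
        by (rule nn_integral_cong_AE, use N0 in eventually_elim) simp
      then show "(\<integral>\<^sup>+y. indicator N y * (ennreal (z * exp (- \<beta> * hr y \<gamma>)) * 1) \<partial>lborel) = 0" by simp
    qed
    also have "K (\<lambda>\<gamma>. 0) \<gamma> = 0" using K_le_const[OF lf, of "\<lambda>_. 0" 0] by simp
    finally show "K ?S \<gamma> = 0" .
  qed
  finally have "AE \<gamma> in P. ?S \<gamma> = 0" using S by (simp add: nn_integral_0_iff_AE)
  with AE_space have "AE \<gamma> in P. \<gamma> \<inter> N = {}"
  proof eventually_elim
    case (elim \<gamma>)
    have "finite (\<gamma> \<inter> N)"
      using elim finite_W by (auto simp: space_P N_def intro: rev_finite_subset)
    then show ?case using elim by simp
  qed
  from AE_lattice[OF this] show ?thesis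
  proof eventually_elim
    case (elim \<gamma>)
    have "x \<in> half_open_box n" if x: "x \<in> \<gamma>" "x \<in> Lambda n" for x n
    proof (rule ccontr)
      assume "x \<notin> half_open_box n"
      then obtain b where b: "b \<in> Basis" "x \<bullet> b = real n"
        using x by (force simp: half_open_box_def mem_Lambda not_less)
      define k where "k = (\<Sum>b\<in>Basis. of_int \<lfloor>x \<bullet> b\<rfloor> *\<^sub>R b)"
      note k = lattice_floor[where x = x, folded k_def]
      \<comment> \<open>A coordinate equal to \<open>n\<close> has floor \<open>n\<close>, which
        \<open>lattice_box n\<close> excludes.\<close>
      have "k \<in> lattice_box (Suc n)"
        unfolding lattice_box_def
      proof safe
        fix c :: 'a assume c: "c \<in> Basis"
        then have "- real n \<le> x \<bullet> c" "x \<bullet> c \<le> real n" using x by (auto simp: mem_Lambda)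
        then show "k \<bullet> c \<in> \<int>" "- real (Suc n) \<le> k \<bullet> c" "k \<bullet> c < real (Suc n)"
          unfolding k(1)[OF c] by (simp_all, linarith+)
      qed
      then have "shift_conf k \<gamma> \<inter> N = {}" using elim by blast
      moreover have "x - k \<in> shift_conf k \<gamma>" using x by (simp add: mem_translate_conf)
      moreover have "x - k \<in> N"
        using k(2) unit_cube_subset_W k(1)[OF b(1)] b
        by (auto simp: N_def inner_diff_left intro!: bexI[of _ b])
      ultimately show False by blast
    qed
    then show ?case using half_open_box_subset by blast
  qed
qed

lemma sum_box_cubes:
  fixes \<phi> :: "real \<Rightarrow> real"
  assumes lf: "locally_finite_conf \<gamma>"
  shows "(\<Sum>x\<in>\<gamma> \<inter> half_open_box n. \<phi> (hr x (\<gamma> - {x})))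
    = (\<Sum>k\<in>lattice_box n. \<Sum>x\<in>shift_conf k \<gamma> \<inter> unit_cube. \<phi> (hr x (shift_conf k \<gamma> - {x})))"
proof -
  let ?f = "\<lambda>x. \<phi> (hr x (\<gamma> - {x}))"
  have fin: "finite (\<gamma> \<inter> half_open_box n)"
  proof -
    have "finite (\<gamma> \<inter> Lambda n)" using lf by (intro locally_finite_confD) (simp_all add: Lambda_def)
    then show ?thesis by (rule rev_finite_subset) (use half_open_box_subset in auto)
  qed
  have cube: "(\<Sum>x\<in>shift_conf k \<gamma> \<inter> unit_cube. \<phi> (hr x (shift_conf k \<gamma> - {x})))
     = (\<Sum>x\<in>\<gamma> \<inter> half_open_box n. indicator unit_cube (x - k) * ?f x)" if k: "k \<in> lattice_box n" for k
  proof -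
    have sub: "x \<in> half_open_box n" if "x - k \<in> unit_cube" for x
    proof (rule ccontr)
      assume "x \<notin> half_open_box n"
      then have "(\<Sum>k\<in>lattice_box n. indicator unit_cube (x - k) :: nat) = 0"
        by (subst sum_indicator_unit_cube) simp
      then have "indicator unit_cube (x - k) = (0 :: nat)"
        using k by (simp only: sum_eq_0_iff finite_lattice_box)
      then show False using that by simp
    qed
    have "(\<Sum>x\<in>shift_conf k \<gamma> \<inter> unit_cube. \<phi> (hr x (shift_conf k \<gamma> - {x})))
      = (\<Sum>x\<in>{x\<in>\<gamma> \<inter> half_open_box n. x - k \<in> unit_cube}. ?f x)"
    proof (rule sum.reindex_bij_witness[where i = "\<lambda>x. x - k" and j = "\<lambda>x. x + k"])
      fix a assume a: "a \<in> shift_conf k \<gamma> \<inter> unit_cube"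
      show "a + k \<in> {x\<in>\<gamma> \<inter> half_open_box n. x - k \<in> unit_cube}"
        using a sub[of "a + k"] by (auto simp: mem_translate_conf)
      have "shift_conf k \<gamma> - {a} = shift_conf k (\<gamma> - {a + k})"
        by (auto simp: mem_translate_conf)
      moreover have "locally_finite_conf (\<gamma> - {a + k})" using lf by (rule locally_finite_conf_subset) auto
      ultimately show "?f (a + k) = \<phi> (hr a (shift_conf k \<gamma> - {a}))"
        using hr_shift[of "\<gamma> - {a + k}" "a + k" k] by simp
    qed (auto simp: mem_translate_conf)
    also have "\<dots> = (\<Sum>x\<in>\<gamma> \<inter> half_open_box n. indicator unit_cube (x - k) * ?f x)"
      using fin by (intro sum.mono_neutral_cong_left) (auto simp: indicator_def)
    finally show ?thesis .
  qed
  have "(\<Sum>k\<in>lattice_box n. \<Sum>x\<in>shift_conf k \<gamma> \<inter> unit_cube. \<phi> (hr x (shift_conf k \<gamma> - {x})))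
    = (\<Sum>k\<in>lattice_box n. \<Sum>x\<in>\<gamma> \<inter> half_open_box n. indicator unit_cube (x - k) * ?f x)"
    by (intro sum.cong refl cube)
  also have "\<dots> = (\<Sum>x\<in>\<gamma> \<inter> half_open_box n. (\<Sum>k\<in>lattice_box n. indicator unit_cube (x - k)) * ?f x)"
    by (subst sum.swap) (simp add: sum_distrib_right)
  also have "\<dots> = (\<Sum>x\<in>\<gamma> \<inter> half_open_box n. ?f x)"
    by (intro sum.cong refl) (simp add: sum_indicator_unit_cube)
  finally show ?thesis by simp
qed

text \<open>Subtracting the law for the cube integrals from the one for the cube sums cancels the
  conditional expectations, whatever random behaviour their averages have. As \<open>K\<close> acts
  on nonnegative functions, a signed function is treated through its two parts.\<close>

lemma innovation_lln:
  fixes \<phi> :: "real \<Rightarrow> real"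
  assumes \<phi>m [measurable]: "\<phi> \<in> borel_measurable borel" and \<phi>0: "\<And>t. \<phi> t \<ge> 0"
    and fin: "(\<integral>\<^sup>+\<gamma>. ennreal (exp (- \<beta> * hr 0 \<gamma>) * \<phi> (hr 0 \<gamma>)) \<partial>P) < \<infinity>"
  shows "AE \<gamma> in P. (\<lambda>n. ((\<Sum>x\<in>\<gamma> \<inter> Lambda n. \<phi> (hr x (\<gamma> - {x})))
      - z * enn2real (\<integral>\<^sup>+x. indicator (Lambda n) x * ennreal (exp (- \<beta> * hr x \<gamma>) * \<phi> (hr x \<gamma>)) \<partial>lborel))
      / (2 * real n) ^ DIM('a)) \<longlonglongrightarrow> 0"
proof -
  let ?d = "DIM('a)"
  define G where "G t = ennreal (z * (exp (- \<beta> * t) * \<phi> t))" for t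
  have [measurable]: "G \<in> borel_measurable borel" unfolding G_def by measurable
  define S where "S \<gamma> = (\<Sum>x\<in>\<gamma> \<inter> unit_cube. \<phi> (hr x (\<gamma> - {x})))" for \<gamma>
  define I where "I \<gamma> = (\<integral>\<^sup>+x. indicator unit_cube x * G (hr x \<gamma>) \<partial>lborel)" for \<gamma>
  have finG: "(\<integral>\<^sup>+\<gamma>. G (hr 0 \<gamma>) \<partial>P) < \<infinity>"
  proof -
    have [measurable]: "hr 0 \<in> borel_measurable P"
      using measurable_hr_pair[of "\<lambda>_. 0" P "\<lambda>\<gamma>. \<gamma>"] by simp
    have "(\<integral>\<^sup>+\<gamma>. G (hr 0 \<gamma>) \<partial>P) = ennreal z * (\<integral>\<^sup>+\<gamma>. ennreal (exp (- \<beta> * hr 0 \<gamma>) * \<phi> (hr 0 \<gamma>)) \<partial>P)"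
      unfolding G_def using z_pos \<phi>0 by (subst nn_integral_cmult[symmetric]) (auto simp: ennreal_mult)
    then show ?thesis using fin by (simp add: ennreal_mult_less_top)
  qed
  have Im [measurable]: "I \<in> borel_measurable P"
    unfolding I_def by (rule measurable_field_integral) measurable
  have I_fin: "(\<integral>\<^sup>+\<gamma>. I \<gamma> \<partial>P) < \<infinity>"
    unfolding I_def using finG by (subst field_integral) (auto simp: emeasure_unit_cube)
  have Sm [measurable]: "S \<in> borel_measurable P"
  proof -
    let ?g = "\<lambda>w y. ennreal (\<phi> (hr y (w - {y})))"
    have "(\<lambda>w. fst w - {snd w}) \<in> measurable (config_space \<Otimes>\<^sub>M borel) (config_space :: 'a set measure)"
      by (intro measurable_delete_config) measurable
    from measurable_hr[OF this, of snd]
    have "(\<lambda>(w, y). ?g w y) \<in> borel_measurable (config_space \<Otimes>\<^sub>M borel)"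
      unfolding split_beta' by measurable
    from measurable_sum_config[OF measurable_ident_sets[OF refl] unit_cube_borel _ this]
    have "(\<lambda>w. \<Sum>y\<in>w \<inter> unit_cube. ?g w y) \<in> borel_measurable config_space"
      using bounded_subset[OF W_positive(2) unit_cube_subset_W] by simp
    then have "(\<lambda>w. enn2real (\<Sum>y\<in>w \<inter> unit_cube. ?g w y)) \<in> borel_measurable config_space" by measurable
    moreover have "(\<lambda>w. enn2real (\<Sum>y\<in>w \<inter> unit_cube. ?g w y)) = S"
      unfolding S_def using \<phi>0 by (simp add: sum_nonneg)
    ultimately show ?thesis by (simp add: borel_measurable_P)
  qed
  have S0: "S \<gamma> \<ge> 0" for \<gamma> unfolding S_def using \<phi>0 by (intro sum_nonneg)
  have KSI: "K S \<gamma> = K I \<gamma>" if "\<gamma> \<in> space P" for \<gamma>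
  proof -
    have lf: "locally_finite_conf \<gamma>" using that by (simp add: space_P)
    have "(\<lambda>w. hr (fst w) (snd w)) \<in> borel_measurable (borel \<Otimes>\<^sub>M config_space)"
      by (intro measurable_hr) measurable
    then have m: "(\<lambda>(x, \<gamma>). ennreal (\<phi> (hr x \<gamma>))) \<in> borel_measurable (borel \<Otimes>\<^sub>M config_space)"
      unfolding split_beta' by measurable
    have "K S \<gamma> = K (\<lambda>\<gamma>. \<Sum>x\<in>\<gamma> \<inter> unit_cube. ennreal (\<phi> (hr x (\<gamma> - {x})))) \<gamma>"
      unfolding S_def using \<phi>0 by (simp add: sum_ennreal)
    also have "\<dots> = K (\<lambda>\<gamma>. \<integral>\<^sup>+y. indicator unit_cube y * (ennreal (z * exp (- \<beta> * hr y \<gamma>)) * ennreal (\<phi> (hr y \<gamma>))) \<partial>lborel) \<gamma>"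
      by (rule GNZ[OF m _ unit_cube_subset_W lf]) simp
    also have "\<dots> = K I \<gamma>"
      unfolding I_def G_def using z_pos \<phi>0 by (simp add: ennreal_mult mult.assoc)
    finally show ?thesis .
  qed
  have S_fin: "(\<integral>\<^sup>+\<gamma>. S \<gamma> \<partial>P) = (\<integral>\<^sup>+\<gamma>. I \<gamma> \<partial>P)"
  proof -
    have "(\<integral>\<^sup>+\<gamma>. S \<gamma> \<partial>P) = (\<integral>\<^sup>+\<gamma>. K S \<gamma> \<partial>P)" by (rule DLR) measurable
    also have "\<dots> = (\<integral>\<^sup>+\<gamma>. K I \<gamma> \<partial>P)" by (intro nn_integral_cong KSI)
    also have "\<dots> = (\<integral>\<^sup>+\<gamma>. I \<gamma> \<partial>P)" by (rule DLR[symmetric]) measurable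
    finally show ?thesis .
  qed
  define I' where "I' \<gamma> = enn2real (I \<gamma>)" for \<gamma>
  have [measurable]: "I' \<in> borel_measurable P" unfolding I'_def by measurable
  have I_neq: "AE \<gamma> in P. I \<gamma> \<noteq> \<infinity>" using I_fin by (intro nn_integral_PInf_AE) auto
  \<comment> \<open>\<open>I\<close> may be infinite on a null set, where \<open>enn2real\<close> returns \<open>0\<close>.\<close>
  have KI': "AE \<gamma> in P. K I' \<gamma> = K I \<gamma>"
  proof -
    define J where "J \<gamma> = (if I \<gamma> = \<infinity> then \<infinity> else 0 :: ennreal)" for \<gamma>
    have [measurable]: "J \<in> borel_measurable P" unfolding J_def by measurable
    have "(\<integral>\<^sup>+\<gamma>. K J \<gamma> \<partial>P) = (\<integral>\<^sup>+\<gamma>. J \<gamma> \<partial>P)" by (rule DLR[symmetric]) measurable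
    also have "\<dots> = (\<integral>\<^sup>+\<gamma>. 0 \<partial>P)"
      by (rule nn_integral_cong_AE, use I_neq in eventually_elim) (simp add: J_def)
    finally have "AE \<gamma> in P. K J \<gamma> = 0" using measurable_K[of J] by (simp add: nn_integral_0_iff_AE)
    with AE_space show ?thesis
    proof eventually_elim
      case (elim \<gamma>)
      have "(\<lambda>\<gamma>. ennreal (I' \<gamma>) + J \<gamma>) = I" by (auto simp: I'_def J_def fun_eq_iff less_top)
      then have "K I \<gamma> = K I' \<gamma> + K J \<gamma>"
        using K_add[of \<gamma> "\<lambda>\<gamma>. ennreal (I' \<gamma>)" J] elim by (simp add: space_P)
      then show ?case using elim by simp
    qed
  qed
  have int: "integrable P S" "integrable P I'"
  proof -
    show "integrable P S" using S0 S_fin I_fin by (intro integrableI_nonneg) auto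
    have "(\<integral>\<^sup>+\<gamma>. ennreal (I' \<gamma>) \<partial>P) \<le> (\<integral>\<^sup>+\<gamma>. I \<gamma> \<partial>P)"
      unfolding I'_def by (intro nn_integral_mono) (simp add: ennreal_enn2real_if)
    then show "integrable P I'" using I_fin by (intro integrableI_nonneg) (auto simp: I'_def intro: le_less_trans)
  qed
  have locS: "S \<gamma> = S \<gamma>'" if "\<gamma> \<inter> W = \<gamma>' \<inter> W" for \<gamma> \<gamma>'
    unfolding S_def
  proof (rule sum.cong)
    show "\<gamma> \<inter> unit_cube = \<gamma>' \<inter> unit_cube" using that unit_cube_subset_W by blast
    fix x assume "x \<in> \<gamma>' \<inter> unit_cube"
    moreover have "(\<gamma> - {x}) \<inter> W = (\<gamma>' - {x}) \<inter> W" using that by blast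
    ultimately show "\<phi> (hr x (\<gamma> - {x})) = \<phi> (hr x (\<gamma>' - {x}))" using hr_local_W by (metis IntD2)
  qed
  have locI: "I' \<gamma> = I' \<gamma>'" if "\<gamma> \<inter> W = \<gamma>' \<inter> W" for \<gamma> \<gamma>'
    unfolding I'_def I_def
    by (intro arg_cong[where f = enn2real] nn_integral_cong) (use hr_local_W[OF _ that] in \<open>auto simp: indicator_def\<close>)
  have "AE \<gamma> in P. (\<lambda>n. (\<Sum>k\<in>lattice_box n. S (shift_conf k \<gamma>) - enn2real (K S (shift_conf k \<gamma>)))
      / (2 * real n) ^ ?d) \<longlonglongrightarrow> 0"
    by (rule lln[OF Sm S0 int(1) locS])
  moreover have "AE \<gamma> in P. (\<lambda>n. (\<Sum>k\<in>lattice_box n. I' (shift_conf k \<gamma>) - enn2real (K I' (shift_conf k \<gamma>)))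
      / (2 * real n) ^ ?d) \<longlonglongrightarrow> 0"
    by (rule lln[OF _ _ int(2) locI]) (auto simp: I'_def)
  ultimately show ?thesis
    using AE_lattice[OF I_neq] AE_lattice[OF KI'] AE_no_boundary_points AE_space
  proof eventually_elim
    case (elim \<gamma>)
    have lf: "locally_finite_conf \<gamma>" using elim by (simp add: space_P)
    have "(\<lambda>n. (\<Sum>k\<in>lattice_box n. S (shift_conf k \<gamma>) - enn2real (K S (shift_conf k \<gamma>))) / (2 * real n) ^ ?d
       - (\<Sum>k\<in>lattice_box n. I' (shift_conf k \<gamma>) - enn2real (K I' (shift_conf k \<gamma>))) / (2 * real n) ^ ?d) \<longlonglongrightarrow> 0 - 0"
      by (intro tendsto_diff elim(1,2))
    moreover have "(\<Sum>k\<in>lattice_box n. S (shift_conf k \<gamma>) - enn2real (K S (shift_conf k \<gamma>)))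
       - (\<Sum>k\<in>lattice_box n. I' (shift_conf k \<gamma>) - enn2real (K I' (shift_conf k \<gamma>)))
       = (\<Sum>x\<in>\<gamma> \<inter> Lambda n. \<phi> (hr x (\<gamma> - {x})))
      - z * enn2real (\<integral>\<^sup>+x. indicator (Lambda n) x * ennreal (exp (- \<beta> * hr x \<gamma>) * \<phi> (hr x \<gamma>)) \<partial>lborel)" for n
    proof -
      have "K S (shift_conf k \<gamma>) = K I' (shift_conf k \<gamma>)" if "k \<in> lattice_box n" for k
        using elim(4) that KSI[OF translate_space[OF elim(6)]] by metis
      then have "(\<Sum>k\<in>lattice_box n. S (shift_conf k \<gamma>) - enn2real (K S (shift_conf k \<gamma>)))
       - (\<Sum>k\<in>lattice_box n. I' (shift_conf k \<gamma>) - enn2real (K I' (shift_conf k \<gamma>)))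
       = (\<Sum>k\<in>lattice_box n. S (shift_conf k \<gamma>)) - (\<Sum>k\<in>lattice_box n. I' (shift_conf k \<gamma>))"
        by (simp add: sum_subtractf)
      also have "(\<Sum>k\<in>lattice_box n. S (shift_conf k \<gamma>)) = (\<Sum>x\<in>\<gamma> \<inter> Lambda n. \<phi> (hr x (\<gamma> - {x})))"
        unfolding S_def elim(5)[rule_format, of n] by (rule sum_box_cubes[OF lf, symmetric])
      also have "(\<Sum>k\<in>lattice_box n. I' (shift_conf k \<gamma>)) = enn2real (\<Sum>k\<in>lattice_box n. I (shift_conf k \<gamma>))"
        unfolding I'_def using elim(3) by (subst enn2real_sum) (auto simp: less_top)
      also have "(\<Sum>k\<in>lattice_box n. I (shift_conf k \<gamma>)) = (\<integral>\<^sup>+x. indicator (Lambda n) x * G (hr x \<gamma>) \<partial>lborel)"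
        unfolding I_def by (rule integral_box_cubes[OF _ lf, symmetric]) measurable
      also have "\<dots> = (\<integral>\<^sup>+x. ennreal z * (indicator (Lambda n) x * ennreal (exp (- \<beta> * hr x \<gamma>) * \<phi> (hr x \<gamma>))) \<partial>lborel)"
        unfolding G_def using z_pos \<phi>0 by (intro nn_integral_cong) (simp add: ennreal_mult mult_ac)
      also have "\<dots> = ennreal z * (\<integral>\<^sup>+x. indicator (Lambda n) x * ennreal (exp (- \<beta> * hr x \<gamma>) * \<phi> (hr x \<gamma>)) \<partial>lborel)"
      proof (rule nn_integral_cmult)
        note [measurable] = measurable_hr_fix[OF lf]
        show "(\<lambda>x. indicator (Lambda n) x * ennreal (exp (- \<beta> * hr x \<gamma>) * \<phi> (hr x \<gamma>))) \<in> borel_measurable lborel"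
          by measurable
      qed
      finally show ?thesis using z_pos by (simp add: enn2real_mult)
    qed
    ultimately show ?case by (simp add: diff_divide_distrib[symmetric])
  qed
qed

text \<open>By \<open>density\<close>, cubes on which the value set occupies volume at least
  \<open>\<eta>\<close> have positive density, and each of them contributes at least
  \<open>\<eta>\<close>.\<close>

lemma density_values:
  fixes B :: "real set" and \<eta> :: real
  assumes [measurable]: "B \<in> sets borel" and \<eta>: "\<eta> > 0"
    and pos: "poisson_nn_integral W (indicator {\<gamma>. ennreal \<eta> \<le> (\<integral>\<^sup>+x. indicator unit_cube x * indicator B (hr x \<gamma>) \<partial>lborel)}) \<noteq> 0"
  shows "AE \<gamma> in P. \<exists>\<rho>>0. \<forall>\<^sub>F n in sequentially.
    ennreal (\<rho> * (2 * real n) ^ DIM('a)) \<le> (\<integral>\<^sup>+x. indicator (Lambda n) x * indicator B (hr x \<gamma>) \<partial>lborel)"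
proof -
  let ?I = "\<lambda>\<gamma>. \<integral>\<^sup>+x. indicator unit_cube x * indicator B (hr x \<gamma>) \<partial>lborel"
  define A where "A = {\<gamma>. ennreal \<eta> \<le> ?I \<gamma>}"
  have Im [measurable]: "?I \<in> borel_measurable P" by (rule measurable_field_integral) measurable
  have "AE \<gamma> in P. \<exists>\<rho>>0. \<forall>\<^sub>F n in sequentially.
    \<rho> * (2 * real n) ^ DIM('a) \<le> (\<Sum>k\<in>lattice_box n. indicator A (shift_conf k \<gamma>))"
  proof (rule density)
    have "A \<inter> space P = {\<gamma> \<in> space P. ennreal \<eta> \<le> ?I \<gamma>}" by (auto simp: A_def)
    also have "\<dots> \<in> sets P" by measurable
    finally show "A \<inter> space P \<in> sets P" .
    fix \<gamma> \<gamma>' :: "'a set" assume eq: "\<gamma> \<inter> W = \<gamma>' \<inter> W"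
    have "?I \<gamma> = ?I \<gamma>'"
      by (intro nn_integral_cong) (use hr_local_W[OF _ eq] in \<open>auto simp: indicator_def\<close>)
    then show "\<gamma> \<in> A \<longleftrightarrow> \<gamma>' \<in> A" by (simp add: A_def)
  qed (use pos in \<open>simp add: A_def\<close>)
  with AE_space show ?thesis
  proof eventually_elim
    case (elim \<gamma>)
    then have lf: "locally_finite_conf \<gamma>" by (simp add: space_P)
    obtain \<rho> where \<rho>: "\<rho> > 0" "\<forall>\<^sub>F n in sequentially.
      \<rho> * (2 * real n) ^ DIM('a) \<le> (\<Sum>k\<in>lattice_box n. indicator A (shift_conf k \<gamma>))" using elim by blast
    have "\<forall>\<^sub>F n in sequentially. ennreal (\<eta> * \<rho> * (2 * real n) ^ DIM('a))
      \<le> (\<integral>\<^sup>+x. indicator (Lambda n) x * indicator B (hr x \<gamma>) \<partial>lborel)"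
      using \<rho>(2)
    proof eventually_elim
      case (elim n)
      have "\<eta> * \<rho> * (2 * real n) ^ DIM('a) \<le> (\<Sum>k\<in>lattice_box n. \<eta> * indicator A (shift_conf k \<gamma>))"
        using mult_left_mono[OF elim, of \<eta>] \<eta> by (simp add: sum_distrib_left mult.assoc)
      then have "ennreal (\<eta> * \<rho> * (2 * real n) ^ DIM('a)) \<le> ennreal (\<Sum>k\<in>lattice_box n. \<eta> * indicator A (shift_conf k \<gamma>))"
        by (rule ennreal_leI)
      also have "\<dots> = (\<Sum>k\<in>lattice_box n. ennreal (\<eta> * indicator A (shift_conf k \<gamma>)))"
        using \<eta> by (intro sum_ennreal[symmetric]) auto
      also have "\<dots> \<le> (\<Sum>k\<in>lattice_box n. ?I (shift_conf k \<gamma>))"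
        by (intro sum_mono) (auto simp: A_def indicator_def)
      also have "\<dots> = (\<integral>\<^sup>+x. indicator (Lambda n) x * indicator B (hr x \<gamma>) \<partial>lborel)"
        by (rule integral_box_cubes[OF _ lf, symmetric]) measurable
      finally show ?case .
    qed
    then show ?case using \<rho>(1) \<eta> by (intro exI[of _ "\<eta> * \<rho>"]) auto
  qed
qed

text \<open>The window is empty with positive Poisson probability, and then the local energy is
  \<open>hr 0 {}\<close> on the whole unit cube; hence \<open>\<eta> = 1\<close>.\<close>

lemma density_empty_value:
  "AE \<gamma> in P. \<exists>\<rho>>0. \<forall>\<^sub>F n in sequentially.
    ennreal (\<rho> * (2 * real n) ^ DIM('a)) \<le> (\<integral>\<^sup>+x. indicator (Lambda n) x * indicator {hr 0 {}} (hr x \<gamma>) \<partial>lborel)"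
proof (rule density_values[where \<eta> = 1])
  let ?F = "indicator {\<gamma>. ennreal 1 \<le> (\<integral>\<^sup>+x. indicator unit_cube x * indicator {hr 0 {}} (hr x \<gamma>) \<partial>lborel)} :: 'a set \<Rightarrow> ennreal"
  have "hr x {} = hr 0 {}" for x :: 'a
    using hr_translate[of "{}" 0 x] by (simp add: locally_finite_conf_def translate_conf_simps)
  then have "?F {} = 1" by (simp add: emeasure_unit_cube)
  then have "config_integral W {..<0} ?F \<noteq> 0"
    by (simp add: config_integral_def PiM_empty nn_integral_count_space_finite)
  then show "poisson_nn_integral W ?F \<noteq> 0"
    unfolding poisson_nn_integral_eq by (auto simp: suminf_eq_zero_iff summableI simp del: lessThan_0 intro!: exI[of _ 0])
qed auto

text \<open>By contraposition: Poisson-null events of the window are null under \<open>P\<close>,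
  and if they were null for every \<open>\<eta>\<close>, the local energy at the origin would almost
  surely be \<open>hr 0 {}\<close>. The cut at \<open>1 / \<eta>\<close> keeps the values bounded,
  so that the exponential weight is bounded below on them.\<close>

lemma density_other_values:
  assumes nondeg: "prob {\<gamma> \<in> space P. hr 0 \<gamma> = hr 0 {}} < 1"
  obtains \<eta> where "\<eta> > 0" "AE \<gamma> in P. \<exists>\<rho>>0. \<forall>\<^sub>F n in sequentially. ennreal (\<rho> * (2 * real n) ^ DIM('a))
    \<le> (\<integral>\<^sup>+x. indicator (Lambda n) x * indicator {t. \<eta> \<le> \<bar>t - hr 0 {}\<bar> \<and> \<bar>t - hr 0 {}\<bar> \<le> 1 / \<eta>} (hr x \<gamma>) \<partial>lborel)"
proof -
  define B where "B \<eta> = {t. \<eta> \<le> \<bar>t - hr 0 {}\<bar> \<and> \<bar>t - hr 0 {}\<bar> \<le> 1 / \<eta>}" for \<eta>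
  have [measurable]: "B \<eta> \<in> sets borel" for \<eta> unfolding B_def by measurable
  define I where "I \<eta> \<gamma> = (\<integral>\<^sup>+x. indicator unit_cube x * indicator (B \<eta>) (hr x \<gamma>) \<partial>lborel)" for \<eta> \<gamma>
  have [measurable]: "I \<eta> \<in> borel_measurable P" for \<eta>
    unfolding I_def by (rule measurable_field_integral) measurable
  have [measurable]: "hr 0 \<in> borel_measurable P"
    using measurable_hr_pair[of "\<lambda>_. 0" P "\<lambda>\<gamma>. \<gamma>"] by simp
  define e where "e j = 1 / real (Suc j)" for j
  have e: "e j > 0" for j by (simp add: e_def)
  have "\<exists>j. poisson_nn_integral W (indicator {\<gamma>. ennreal (e j) \<le> I (e j) \<gamma>}) \<noteq> 0"
  proof (rule ccontr)
    assume "\<not> ?thesis"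
    then have zero: "poisson_nn_integral W (indicator {\<gamma>. ennreal (e j) \<le> I (e j) \<gamma>}) = 0" for j by blast
    have "AE \<gamma> in P. I (e j) \<gamma> < ennreal (e j)" for j
    proof -
      let ?A = "{\<gamma>. ennreal (e j) \<le> I (e j) \<gamma>}"
      have "?A \<inter> space P = {\<gamma> \<in> space P. ennreal (e j) \<le> I (e j) \<gamma>}" by auto
      also have "\<dots> \<in> sets P" by measurable
      finally have A: "(indicator ?A :: _ \<Rightarrow> ennreal) \<in> borel_measurable P"
        by (simp only: borel_measurable_indicator_iff)
      have "(\<integral>\<^sup>+\<gamma>. indicator ?A \<gamma> \<partial>P) = (\<integral>\<^sup>+\<gamma>. K (indicator ?A) \<gamma> \<partial>P)" by (rule DLR[OF A])
      also have "\<dots> = (\<integral>\<^sup>+\<gamma>. 0 \<partial>P)"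
      proof (intro nn_integral_cong)
        fix \<gamma> assume "\<gamma> \<in> space P"
        have "poisson_nn_integral W (\<lambda>\<xi>. indicator ?A (\<xi> \<union> (\<gamma> - W)) * wt (\<xi> \<union> (\<gamma> - W)))
          = poisson_nn_integral W (\<lambda>\<xi>. indicator ?A \<xi> * wt (\<xi> \<union> (\<gamma> - W)))"
        proof (rule poisson_cong)
          fix \<xi> assume "\<xi> \<subseteq> W"
          then have eq: "(\<xi> \<union> (\<gamma> - W)) \<inter> W = \<xi> \<inter> W" by auto
          have "I (e j) (\<xi> \<union> (\<gamma> - W)) = I (e j) \<xi>"
            unfolding I_def by (intro nn_integral_cong) (use hr_local_W[OF _ eq] in \<open>auto simp: indicator_def\<close>)
          then show "indicator ?A (\<xi> \<union> (\<gamma> - W)) * wt (\<xi> \<union> (\<gamma> - W)) = indicator ?A \<xi> * wt (\<xi> \<union> (\<gamma> - W))"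
            by (simp add: indicator_def)
        qed
        \<comment> \<open>No bound on the weight is at hand; infinity times the indicator serves, as
          infinity times \<open>0\<close> is \<open>0\<close> in \<open>ennreal\<close>.\<close>
        also have "\<dots> \<le> poisson_nn_integral W (\<lambda>\<xi>. \<infinity> * indicator ?A \<xi>)"
          by (intro poisson_mono) (simp add: indicator_def)
        also have "\<dots> = \<infinity> * poisson_nn_integral W (indicator ?A)"
          using A by (intro poisson_cmult) (simp_all add: borel_measurable_P)
        finally show "K (indicator ?A) \<gamma> = 0" unfolding K_def by (simp add: zero)
      qed
      finally have "AE \<gamma> in P. indicator ?A \<gamma> = (0 :: ennreal)"
        using A by (simp add: nn_integral_0_iff_AE del: nn_integral_indicator)
      then show ?thesis by eventually_elim (auto simp: indicator_def not_le split: if_splits)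
    qed
    then have all: "AE \<gamma> in P. \<forall>j. I (e j) \<gamma> < ennreal (e j)" by (simp add: AE_all_countable)
    have "AE \<gamma> in P. hr 0 \<gamma> \<notin> B (e i)" for i
    proof -
      have "AE \<gamma> in P. I (e i) \<gamma> = 0"
        using all
      proof eventually_elim
        case (elim \<gamma>)
        \<comment> \<open>The sets \<open>B (e j)\<close> grow with \<open>j\<close> while the
          thresholds \<open>e j\<close> tend to \<open>0\<close>; one parameter in both roles thus
          forces \<open>I (e i)\<close> to vanish.\<close>
        have "I (e i) \<gamma> \<le> ennreal (e j)" if "i \<le> j" for j
        proof -
          have ee: "e j \<le> e i" "1 / e i \<le> 1 / e j" using that by (simp_all add: e_def frac_le)
          have "B (e i) \<subseteq> B (e j)"
            unfolding B_def using ee by (auto simp del: divide_le_eq_1)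
          then have "I (e i) \<gamma> \<le> I (e j) \<gamma>"
            unfolding I_def by (intro nn_integral_mono mult_left_mono) (auto simp: indicator_def)
          then show ?thesis using elim[rule_format, of j] by (auto intro: less_imp_le le_less_trans)
        qed
        moreover have "(\<lambda>j. ennreal (e j)) \<longlonglongrightarrow> ennreal 0"
          unfolding e_def by (intro tendsto_ennrealI LIMSEQ_Suc[OF lim_1_over_n])
        ultimately have "I (e i) \<gamma> \<le> ennreal 0"
          by (intro LIMSEQ_le_const) auto
        then show ?case by simp
      qed
      then have "(\<integral>\<^sup>+\<gamma>. I (e i) \<gamma> \<partial>P) = 0" by (simp add: nn_integral_0_iff_AE)
      then have "(\<integral>\<^sup>+\<gamma>. indicator (B (e i)) (hr 0 \<gamma>) \<partial>P) = 0"
        unfolding I_def by (subst (asm) field_integral) (auto simp: emeasure_unit_cube)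
      then have "AE \<gamma> in P. indicator (B (e i)) (hr 0 \<gamma>) = (0 :: ennreal)"
        by (subst (asm) nn_integral_0_iff_AE) auto
      then show ?thesis by eventually_elim (auto simp: indicator_def split: if_splits)
    qed
    then have "AE \<gamma> in P. \<forall>i. hr 0 \<gamma> \<notin> B (e i)" by (simp add: AE_all_countable)
    then have "AE \<gamma> in P. hr 0 \<gamma> = hr 0 {}"
    proof eventually_elim
      case (elim \<gamma>)
      show ?case
      proof (rule ccontr)
        assume "hr 0 \<gamma> \<noteq> hr 0 {}"
        then have d: "\<bar>hr 0 \<gamma> - hr 0 {}\<bar> > 0" by simp
        then obtain i where i: "e i < \<bar>hr 0 \<gamma> - hr 0 {}\<bar>" unfolding e_def using nat_approx_posE by blast
        obtain j where j: "\<bar>hr 0 \<gamma> - hr 0 {}\<bar> \<le> real j" using real_arch_simple by blast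
        have "e (max i j) \<le> e i" by (simp add: e_def frac_le)
        moreover have "real j \<le> 1 / e (max i j)" by (simp add: e_def)
        ultimately have "hr 0 \<gamma> \<in> B (e (max i j))" unfolding B_def using i j by simp
        then show False using elim by blast
      qed
    qed
    then have "prob {\<gamma> \<in> space P. hr 0 \<gamma> = hr 0 {}} = 1" by (subst prob_Collect_eq_1) auto
    then show False using nondeg by simp
  qed
  then obtain j where "poisson_nn_integral W (indicator {\<gamma>. ennreal (e j) \<le> I (e j) \<gamma>}) \<noteq> 0" by blast
  then have "AE \<gamma> in P. \<exists>\<rho>>0. \<forall>\<^sub>F n in sequentially. ennreal (\<rho> * (2 * real n) ^ DIM('a))
    \<le> (\<integral>\<^sup>+x. indicator (Lambda n) x * indicator (B (e j)) (hr x \<gamma>) \<partial>lborel)"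
    unfolding I_def by (intro density_values[OF _ e]) auto
  then show ?thesis using e by (intro that[of "e j"]) (auto simp: B_def)
qed

end

section \<open>Consistency\<close>

text \<open>An affine function with slope \<open>\<delta>\<close> and value \<open>- ln (z' / z)\<close> at \<open>0\<close> that is small both at \<open>v\<close> and at a
  point away from \<open>v\<close> has small coefficients. The factor \<open>1 + \<bar>ln (z' / z)\<bar>\<close> makes the bound uniform as
  \<open>z'\<close> tends to \<open>0\<close>.\<close>

lemma affine_separation:
  fixes z \<beta> \<eta> v b :: real
  assumes z: "z > 0" and \<eta>: "\<eta> > 0" and \<epsilon>: "\<epsilon> > 0" and b: "b \<ge> 0"
  obtains c where "c > 0"
    "\<And>z' \<delta>. z' > 0 \<Longrightarrow> \<bar>\<delta>\<bar> \<le> b \<Longrightarrow> \<not> (\<bar>\<delta>\<bar> < \<epsilon> \<and> \<bar>z' - z\<bar> < \<epsilon>) \<Longrightarrow>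
      (\<forall>t\<in>{v}. c * (1 + \<bar>ln (z' / z)\<bar>) \<le> exp (- \<beta> * t) * (\<delta> * t - ln (z' / z)) * (1 - exp (- (\<delta> * t - ln (z' / z))))) \<or>
      (\<forall>t. \<eta> \<le> \<bar>t - v\<bar> \<and> \<bar>t - v\<bar> \<le> 1 / \<eta> \<longrightarrow>
        c * (1 + \<bar>ln (z' / z)\<bar>) \<le> exp (- \<beta> * t) * (\<delta> * t - ln (z' / z)) * (1 - exp (- (\<delta> * t - ln (z' / z)))))"
proof -
  have "((\<lambda>l. z * exp l) \<longlongrightarrow> z * exp 0) (at 0)" by (intro tendsto_intros)
  then obtain \<kappa> where \<kappa>: "\<kappa> > 0" "\<And>l. l \<noteq> 0 \<Longrightarrow> \<bar>l\<bar> < \<kappa> \<Longrightarrow> \<bar>z * exp l - z\<bar> < \<epsilon>"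
    using \<epsilon> unfolding LIM_def dist_real_def by force
  have \<kappa>': "\<bar>z * exp l - z\<bar> < \<epsilon>" if "\<bar>l\<bar> < \<kappa>" for l using \<kappa>(2)[OF _ that] \<epsilon> by (cases "l = 0") auto
  \<comment> \<open>If the affine function is below \<open>\<theta>\<close> in absolute value at
    \<open>v\<close> and at a point at least \<open>\<eta>\<close> away, its slope is below
    \<open>2 * \<theta> / \<eta>\<close> and its constant term below
    \<open>\<theta> * (1 + 2 * \<bar>v\<bar> / \<eta>)\<close>. The two entries of the minimum push
    these below \<open>\<epsilon>\<close> and \<open>\<kappa>\<close>.\<close>
  define \<theta> where "\<theta> = min (\<epsilon> * \<eta> / 4) (\<kappa> / (2 * (1 + 2 * \<bar>v\<bar> / \<eta>)))"
  have den: "1 + 2 * \<bar>v\<bar> / \<eta> > 0" using \<eta> by (simp add: add_pos_nonneg)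
  have \<theta>: "\<theta> > 0" using \<epsilon> \<eta> \<kappa> den by (simp add: \<theta>_def)
  have \<theta>1: "2 * \<theta> / \<eta> < \<epsilon>"
  proof -
    have "\<theta> \<le> \<epsilon> * \<eta> / 4" unfolding \<theta>_def by (rule min.cobounded1)
    then have "2 * \<theta> / \<eta> \<le> 2 * (\<epsilon> * \<eta> / 4) / \<eta>" using \<eta> by (intro divide_right_mono mult_left_mono) auto
    also have "\<dots> < \<epsilon>" using \<epsilon> \<eta> by simp
    finally show ?thesis .
  qed
  have \<theta>2: "\<theta> * (1 + 2 * \<bar>v\<bar> / \<eta>) < \<kappa>"
  proof -
    have "\<theta> \<le> \<kappa> / (2 * (1 + 2 * \<bar>v\<bar> / \<eta>))" unfolding \<theta>_def by (rule min.cobounded2)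
    moreover have "x * k \<le> \<kappa> / 2" if "x \<le> \<kappa> / (2 * k)" "k > 0" for x k
      using that by (simp add: field_simps)
    ultimately have "\<theta> * (1 + 2 * \<bar>v\<bar> / \<eta>) \<le> \<kappa> / 2" using den by blast
    then show ?thesis using \<kappa> by linarith
  qed
  define T where "T = \<bar>v\<bar> + 1 / \<eta>"
  have T: "T \<ge> 0" using \<eta> by (simp add: T_def)
  \<comment> \<open>Where the affine function \<open>L\<close> has size at least
    \<open>\<theta>\<close>, these are lower bounds for the exponential weight, for
    \<open>L * (1 - exp (- L)) / \<bar>L\<bar>\<close> and for
    \<open>\<bar>L\<bar> / (1 + \<bar>l\<bar>)\<close>; the last one because
    \<open>\<bar>l\<bar>\<close> is at most \<open>b * T + \<bar>L\<bar>\<close>.\<close>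
  define c where "c = exp (- \<bar>\<beta>\<bar> * T) * (1 - exp (- \<theta>)) * (\<theta> / (1 + b * T + \<theta>))"
  have bT: "1 + b * T + \<theta> > 0" using b T \<theta> by (simp add: add_pos_nonneg add_nonneg_pos)
  have c: "c > 0" using \<theta> bT by (simp add: c_def)
  have lower: "c * (1 + \<bar>l\<bar>) \<le> exp (- \<beta> * t) * (\<delta> * t - l) * (1 - exp (- (\<delta> * t - l)))"
    if t: "\<bar>t\<bar> \<le> T" and \<delta>: "\<bar>\<delta>\<bar> \<le> b" and L: "\<theta> \<le> \<bar>\<delta> * t - l\<bar>" for t \<delta> l
  proof -
    define L where "L = \<delta> * t - l"
    have "\<bar>\<delta> * t\<bar> \<le> b * T" unfolding abs_mult using t \<delta> b T by (intro mult_mono) auto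
    then have l: "1 + \<bar>l\<bar> \<le> 1 + b * T + \<bar>L\<bar>" unfolding L_def by linarith
    have "\<theta> * (1 + b * T + \<bar>L\<bar>) \<le> \<bar>L\<bar> * (1 + b * T + \<theta>)"
      using mult_right_mono[of \<theta> "\<bar>L\<bar>" "1 + b * T"] L b T by (simp add: L_def[symmetric] algebra_simps)
    then have "\<theta> / (1 + b * T + \<theta>) * (1 + b * T + \<bar>L\<bar>) \<le> \<bar>L\<bar>"
      using bT by (simp add: pos_divide_le_eq)
    then have 1: "\<theta> / (1 + b * T + \<theta>) * (1 + \<bar>l\<bar>) \<le> \<bar>L\<bar>"
      using mult_left_mono[OF l, of "\<theta> / (1 + b * T + \<theta>)"] \<theta> bT by simp
    \<comment> \<open>For negative \<open>L\<close> the relevant factor is at least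
      \<open>exp \<theta> - 1\<close>, which dominates \<open>1 - exp (- \<theta>)\<close> by adding
      the tangent line bounds at \<open>\<theta>\<close> and \<open>- \<theta>\<close>.\<close>
    have 2: "\<bar>L\<bar> * (1 - exp (- \<theta>)) \<le> L * (1 - exp (- L))"
    proof (cases "L \<ge> 0")
      case True
      then show ?thesis using L using \<theta> by (intro mult_mono) (auto simp: L_def[symmetric])
    next
      case False
      have "1 + \<theta> \<le> exp \<theta>" "1 - \<theta> \<le> exp (- \<theta>)" using exp_ge_add_one_self[of \<theta>] exp_ge_add_one_self[of "- \<theta>"] by simp_all
      moreover have "exp \<theta> \<le> exp (- L)" using L False by (simp add: L_def[symmetric])
      ultimately have "1 - exp (- \<theta>) \<le> exp (- L) - 1" by linarith
      then have "\<bar>L\<bar> * (1 - exp (- \<theta>)) \<le> \<bar>L\<bar> * (exp (- L) - 1)" by (intro mult_left_mono) auto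
      then show ?thesis using False by (simp add: algebra_simps)
    qed
    have "- \<bar>\<beta>\<bar> * T \<le> - \<beta> * t"
    proof -
      have "\<beta> * t \<le> \<bar>\<beta>\<bar> * \<bar>t\<bar>" by (metis abs_ge_self abs_mult)
      also have "\<dots> \<le> \<bar>\<beta>\<bar> * T" using t by (intro mult_left_mono) auto
      finally show ?thesis by simp
    qed
    then have 3: "exp (- \<bar>\<beta>\<bar> * T) \<le> exp (- \<beta> * t)" by simp
    have "c * (1 + \<bar>l\<bar>) = exp (- \<bar>\<beta>\<bar> * T) * ((1 - exp (- \<theta>)) * (\<theta> / (1 + b * T + \<theta>) * (1 + \<bar>l\<bar>)))"
      by (simp add: c_def)
    also have "\<dots> \<le> exp (- \<beta> * t) * ((1 - exp (- \<theta>)) * \<bar>L\<bar>)"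
      using 1 3 \<theta> bT by (intro mult_mono mult_left_mono) auto
    also have "\<dots> \<le> exp (- \<beta> * t) * (L * (1 - exp (- L)))"
      using 2 by (intro mult_left_mono) (auto simp: mult.commute)
    finally show ?thesis by (simp add: L_def mult.assoc)
  qed
  show ?thesis
  proof (rule that[OF c], rule ccontr)
    fix z' \<delta> :: real
    let ?l = "ln (z' / z)"
    assume z': "z' > 0" and \<delta>: "\<bar>\<delta>\<bar> \<le> b" and far: "\<not> (\<bar>\<delta>\<bar> < \<epsilon> \<and> \<bar>z' - z\<bar> < \<epsilon>)"
      and neg: "\<not> ((\<forall>t\<in>{v}. c * (1 + \<bar>?l\<bar>) \<le> exp (- \<beta> * t) * (\<delta> * t - ?l) * (1 - exp (- (\<delta> * t - ?l)))) \<or>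
        (\<forall>t. \<eta> \<le> \<bar>t - v\<bar> \<and> \<bar>t - v\<bar> \<le> 1 / \<eta> \<longrightarrow>
          c * (1 + \<bar>?l\<bar>) \<le> exp (- \<beta> * t) * (\<delta> * t - ?l) * (1 - exp (- (\<delta> * t - ?l)))))"
    then obtain t where t: "\<eta> \<le> \<bar>t - v\<bar>" "\<bar>t - v\<bar> \<le> 1 / \<eta>"
      and nt: "\<not> c * (1 + \<bar>?l\<bar>) \<le> exp (- \<beta> * t) * (\<delta> * t - ?l) * (1 - exp (- (\<delta> * t - ?l)))"
      and n0: "\<not> c * (1 + \<bar>?l\<bar>) \<le> exp (- \<beta> * v) * (\<delta> * v - ?l) * (1 - exp (- (\<delta> * v - ?l)))" by blast
    have L0: "\<bar>\<delta> * v - ?l\<bar> < \<theta>"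
      using n0 lower[of v \<delta> ?l] \<delta> \<eta> by (force simp: T_def)
    have L1: "\<bar>\<delta> * t - ?l\<bar> < \<theta>"
      using nt lower[of t \<delta> ?l] \<delta> t by (force simp: T_def)
    have "\<bar>\<delta>\<bar> * \<eta> \<le> \<bar>\<delta> * (t - v)\<bar>" unfolding abs_mult using t by (intro mult_left_mono) auto
    also have "\<dots> < 2 * \<theta>" using L0 L1 by (simp add: algebra_simps)
    finally have d: "\<bar>\<delta>\<bar> < 2 * \<theta> / \<eta>" using \<eta> by (simp add: pos_less_divide_eq)
    then have "\<bar>\<delta>\<bar> * \<bar>v\<bar> \<le> 2 * \<theta> / \<eta> * \<bar>v\<bar>" by (intro mult_right_mono) auto
    then have "\<bar>?l\<bar> < \<theta> + 2 * \<theta> / \<eta> * \<bar>v\<bar>" using L0 by (simp add: abs_mult[symmetric])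
    also have "\<dots> = \<theta> * (1 + 2 * \<bar>v\<bar> / \<eta>)" by (simp add: algebra_simps)
    finally have "\<bar>z * exp ?l - z\<bar> < \<epsilon>" using \<theta>2 by (intro \<kappa>') linarith
    then have "\<bar>z' - z\<bar> < \<epsilon>" using z z' by simp
    then show False using far d \<theta>1 by linarith
  qed
qed

lemma mult_one_minus_exp_nonneg: "(x::real) * (1 - exp (- x)) \<ge> 0"
  by (cases "x \<ge> 0") (auto intro: mult_nonneg_nonneg mult_nonpos_nonpos)

text \<open>Integrability makes the positive and negative parts finite, so the \<open>ereal\<close>
  difference in \<open>ext_integral\<close> is a genuine subtraction.\<close>

lemma ext_integral_eq:
  fixes g :: "'a::euclidean_space \<Rightarrow> real"
  assumes "\<Lambda> \<in> sets borel" and int: "integrable lborel (\<lambda>x. indicator \<Lambda> x * g x)"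
  shows "ext_integral (restrict_space lborel \<Lambda>) (\<lambda>x. ereal (g x)) = ereal (\<integral>x. indicator \<Lambda> x * g x \<partial>lborel)"
proof -
  let ?f = "\<lambda>x. indicator \<Lambda> x * g x"
  have p: "(\<integral>\<^sup>+x. e2ennreal (ereal (g x)) \<partial>restrict_space lborel \<Lambda>) = (\<integral>\<^sup>+x. ennreal (?f x) \<partial>lborel)"
    using assms by (subst nn_integral_restrict_space) (auto intro!: nn_integral_cong simp: indicator_def e2ennreal_ereal)
  have q: "(\<integral>\<^sup>+x. e2ennreal (- ereal (g x)) \<partial>restrict_space lborel \<Lambda>) = (\<integral>\<^sup>+x. ennreal (- ?f x) \<partial>lborel)"
    using assms by (subst nn_integral_restrict_space) (auto intro!: nn_integral_cong simp: indicator_def e2ennreal_ereal)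
  have fin: "(\<integral>\<^sup>+x. ennreal (?f x) \<partial>lborel) \<noteq> \<infinity>" "(\<integral>\<^sup>+x. ennreal (- ?f x) \<partial>lborel) \<noteq> \<infinity>"
    using real_integrable_def[THEN iffD1, OF int] by auto
  have "enn2ereal x = ereal (enn2real x)" if "x \<noteq> \<infinity>" for x
    using that by (cases x) (auto simp: enn2ereal_ennreal)
  then show ?thesis
    unfolding ext_integral_def p q using fin real_lebesgue_integral_def[OF int] by simp
qed

context gibbs_window
begin

lemma innov_eq:
  fixes f :: "real \<Rightarrow> real"
  assumes lf: "locally_finite_conf \<gamma>"
    and F: "\<And>x \<xi>. locally_finite_conf \<xi> \<Longrightarrow> F x \<xi> = ereal (f (hr x \<xi>))"
    and int: "integrable lborel (\<lambda>x. indicator (Lambda n) x * (exp (- b * hr x \<gamma>) * f (hr x \<gamma>)))"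
  shows "innov H R (Lambda n) z' b F \<gamma> = ereal ((\<Sum>x\<in>\<gamma> \<inter> Lambda n. f (hr x (\<gamma> - {x})))
    - z' * (\<integral>x. indicator (Lambda n) x * (exp (- b * hr x \<gamma>) * f (hr x \<gamma>)) \<partial>lborel))"
proof -
  have "(\<Sum>x\<in>\<gamma> \<inter> Lambda n. F x (\<gamma> - {x})) = ereal (\<Sum>x\<in>\<gamma> \<inter> Lambda n. f (hr x (\<gamma> - {x})))"
    unfolding sum_ereal[symmetric] by (intro sum.cong refl F locally_finite_conf_subset[OF lf]) auto
  moreover have "(\<lambda>x. ereal (ewt b (h_loc H R x \<gamma>)) * F x \<gamma>) = (\<lambda>x. ereal (exp (- b * hr x \<gamma>) * f (hr x \<gamma>)))"
    by (simp add: F[OF lf] h_loc_eq[OF lf] ewt_def)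
  ultimately show ?thesis
    unfolding innov_def by (simp only: ext_integral_eq[OF Lambda_borel int]) simp
qed

lemma consistency:
  assumes D: "bounded D" "D \<subseteq> {0<..} \<times> UNIV" "(z, \<beta>) \<in> D"
    and est: "AE \<gamma> in P. \<forall>n. est n \<gamma> \<in> D \<and>
                 (\<forall>p\<in>D. pl_contrast H R n (est n \<gamma>) \<gamma> \<le> pl_contrast H R n p \<gamma>)"
    and moment: "(\<integral>\<^sup>+ \<gamma>. e2ennreal (1 + (h_loc H R 0 \<gamma>)\<^sup>2) *
                     (SUP p\<in>D. ennreal (ewt (snd p) (h_loc H R 0 \<gamma>))) \<partial>P) < \<infinity>"
    and nondeg: "prob {\<gamma> \<in> space P. h_loc H R 0 \<gamma> = h_loc H R 0 {}} < 1"
  shows "AE \<gamma> in P. (\<lambda>n. est n \<gamma>) \<longlonglongrightarrow> (z, \<beta>)"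
proof -
  let ?d = "DIM('a)"
  let ?h0 = "hr 0 {} :: real"
  have [measurable]: "hr 0 \<in> borel_measurable P"
    using measurable_hr_pair[of "\<lambda>_. 0" P "\<lambda>\<gamma>. \<gamma>"] by simp
  have lf_empty: "locally_finite_conf ({} :: 'a set)" by (simp add: locally_finite_conf_def)
  have "prob {\<gamma> \<in> space P. hr 0 \<gamma> = ?h0} < 1"
  proof -
    have "{\<gamma> \<in> space P. hr 0 \<gamma> = ?h0} = {\<gamma> \<in> space P. h_loc H R 0 \<gamma> = h_loc H R 0 {}}"
      by (auto simp: space_P h_loc_eq lf_empty)
    then show ?thesis using nondeg by simp
  qed
  then obtain \<eta> where \<eta>: "\<eta> > 0" and dens2: "AE \<gamma> in P. \<exists>\<rho>>0. \<forall>\<^sub>F n in sequentially. ennreal (\<rho> * (2 * real n) ^ ?d)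
    \<le> (\<integral>\<^sup>+x. indicator (Lambda n) x * indicator {t. \<eta> \<le> \<bar>t - ?h0\<bar> \<and> \<bar>t - ?h0\<bar> \<le> 1 / \<eta>} (hr x \<gamma>) \<partial>lborel)"
    by (rule density_other_values)

  define S where "S = snd ` D"
  have S: "bounded S" "S \<noteq> {}" using bounded_snd[OF D(1)] D(3) by (auto simp: S_def)
  then have bdd: "bdd_below S" "bdd_above S" by (auto intro: bounded_imp_bdd_below bounded_imp_bdd_above)
  \<comment> \<open>For each \<open>t\<close> the map
    \<open>\<beta> \<mapsto> exp (- \<beta> * t)\<close> is monotone, so its supremum over
    \<open>S\<close> is its value at an end point of the closure. This turns the supremum over
    \<open>D\<close> into a Borel function of \<open>t\<close>.\<close>
  define s where "s t = max (exp (- Inf S * t)) (exp (- Sup S * t))" for t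
  have s_upper: "exp (- snd p * t) \<le> s t" if "p \<in> D" for p t
  proof -
    have "Inf S \<le> snd p" "snd p \<le> Sup S"
      using that bdd by (auto simp: S_def intro: cInf_lower cSup_upper)
    then show ?thesis
      by (cases "t \<ge> 0") (auto simp: s_def le_max_iff_disj mult_right_mono mult_right_mono_neg)
  qed
  \<comment> \<open>The end points need not belong to \<open>S\<close>; continuity reaches them from
    parameters of \<open>D\<close>.\<close>
  have s_lower: "ennreal (s t) \<le> (SUP p\<in>D. ennreal (exp (- snd p * t)))" for t
  proof -
    have "ennreal (exp (- c * t)) \<le> (SUP p\<in>D. ennreal (exp (- snd p * t)))" if c: "c \<in> closure S" for c
    proof -
      obtain x where x: "\<And>n. x n \<in> S" "x \<longlonglongrightarrow> c" using c unfolding closure_sequential by blast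
      have lim: "(\<lambda>n. ennreal (exp (- x n * t))) \<longlonglongrightarrow> ennreal (exp (- c * t))"
        by (intro tendsto_ennrealI tendsto_intros x)
      have le: "ennreal (exp (- x n * t)) \<le> (SUP p\<in>D. ennreal (exp (- snd p * t)))" for n
      proof -
        obtain p where "p \<in> D" "snd p = x n" using x(1)[of n] by (auto simp: S_def)
        then show ?thesis using SUP_upper[of p D "\<lambda>p. ennreal (exp (- snd p * t))"] by simp
      qed
      show ?thesis by (rule LIMSEQ_le_const2[OF lim]) (use le in blast)
    qed
    moreover have "Inf S \<in> closure S" "Sup S \<in> closure S"
      using S bdd by (auto intro: closure_contains_Inf closure_contains_Sup)
    ultimately show ?thesis unfolding s_def max_def by simp
  qed
  define G where "G t = ennreal ((1 + t\<^sup>2) * s t)" for t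
  have G_m [measurable]: "G \<in> borel_measurable borel" unfolding G_def s_def by measurable
  have s0: "s t > 0" for t by (simp add: s_def less_max_iff_disj)
  have G_fin: "(\<integral>\<^sup>+\<gamma>. G (hr 0 \<gamma>) \<partial>P) < \<infinity>"
  proof -
    have "(\<integral>\<^sup>+\<gamma>. G (hr 0 \<gamma>) \<partial>P) \<le> (\<integral>\<^sup>+ \<gamma>. e2ennreal (1 + (h_loc H R 0 \<gamma>)\<^sup>2) *
                     (SUP p\<in>D. ennreal (ewt (snd p) (h_loc H R 0 \<gamma>))) \<partial>P)"
    proof (rule nn_integral_mono)
      fix \<gamma> assume "\<gamma> \<in> space P"
      then have h: "h_loc H R 0 \<gamma> = ereal (hr 0 \<gamma>)" by (intro h_loc_eq) (simp add: space_P)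
      have "G (hr 0 \<gamma>) = ennreal (1 + (hr 0 \<gamma>)\<^sup>2) * ennreal (s (hr 0 \<gamma>))"
        unfolding G_def using s0 by (intro ennreal_mult) (auto intro: less_imp_le add_nonneg_nonneg)
      also have "\<dots> \<le> ennreal (1 + (hr 0 \<gamma>)\<^sup>2) * (SUP p\<in>D. ennreal (exp (- snd p * hr 0 \<gamma>)))"
        by (intro mult_left_mono s_lower) simp
      also have "1 + (ereal (hr 0 \<gamma>))\<^sup>2 = ereal (1 + (hr 0 \<gamma>)\<^sup>2)"
        by (simp add: power2_eq_square one_ereal_def)
      then have "ennreal (1 + (hr 0 \<gamma>)\<^sup>2) = e2ennreal (1 + (h_loc H R 0 \<gamma>)\<^sup>2)"
        unfolding h by (simp only: e2ennreal_ereal)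
      also have "(SUP p\<in>D. ennreal (exp (- snd p * hr 0 \<gamma>))) = (SUP p\<in>D. ennreal (ewt (snd p) (h_loc H R 0 \<gamma>)))"
        unfolding h by (simp add: ewt_def)
      finally show "G (hr 0 \<gamma>) \<le> e2ennreal (1 + (h_loc H R 0 \<gamma>)\<^sup>2) * (SUP p\<in>D. ennreal (ewt (snd p) (h_loc H R 0 \<gamma>)))" .
    qed
    then show ?thesis using moment by (rule le_less_trans)
  qed
  have dominated: "exp (- snd p * t) * \<bar>t\<bar> \<le> (1 + t\<^sup>2) * s t" "exp (- snd p * t) \<le> (1 + t\<^sup>2) * s t"
    if "p \<in> D" for p t
  proof -
    have t: "\<bar>t\<bar> \<le> 1 + t\<^sup>2"
      using sum_power2_ge_zero[of "\<bar>t\<bar> - 1/2" 0] by (simp add: power2_eq_square algebra_simps)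
    have "\<bar>t\<bar> * exp (- snd p * t) \<le> (1 + t\<^sup>2) * s t"
      using t s_upper[OF that, of t] by (intro mult_mono) auto
    then show "exp (- snd p * t) * \<bar>t\<bar> \<le> (1 + t\<^sup>2) * s t" by (simp add: mult.commute)
    have "1 * exp (- snd p * t) \<le> (1 + t\<^sup>2) * s t"
      using s_upper[OF that, of t] by (intro mult_mono) auto
    then show "exp (- snd p * t) \<le> (1 + t\<^sup>2) * s t" by simp
  qed
  \<comment> \<open>To be used for \<open>1\<close> and for the positive and negative parts of the
    identity, whose difference yields the innovation of \<open>h\<close>.\<close>
  have lln: "AE \<gamma> in P. (\<lambda>n. ((\<Sum>x\<in>\<gamma> \<inter> Lambda n. \<phi> (hr x (\<gamma> - {x})))
      - z * enn2real (\<integral>\<^sup>+x. indicator (Lambda n) x * ennreal (exp (- \<beta> * hr x \<gamma>) * \<phi> (hr x \<gamma>)) \<partial>lborel))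
      / (2 * real n) ^ ?d) \<longlonglongrightarrow> 0"
    if "\<phi> \<in> borel_measurable borel" "\<And>t. 0 \<le> \<phi> t" "\<And>t. \<phi> t \<le> 1 \<or> \<phi> t \<le> \<bar>t\<bar>" for \<phi> :: "real \<Rightarrow> real"
  proof (rule innovation_lln[OF that(1,2)])
    have "exp (- \<beta> * t) * \<phi> t \<le> (1 + t\<^sup>2) * s t" for t
    proof -
      have "exp (- \<beta> * t) * \<phi> t \<le> exp (- \<beta> * t) * 1 \<or> exp (- \<beta> * t) * \<phi> t \<le> exp (- \<beta> * t) * \<bar>t\<bar>"
        using that(3)[of t] by (meson mult_left_mono exp_ge_zero)
      then show ?thesis
        using dominated[OF D(3), of t] by (simp only: snd_conv mult_1_right) (elim disjE; linarith)
    qed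
    then have "(\<integral>\<^sup>+\<gamma>. ennreal (exp (- \<beta> * hr 0 \<gamma>) * \<phi> (hr 0 \<gamma>)) \<partial>P) \<le> (\<integral>\<^sup>+\<gamma>. G (hr 0 \<gamma>) \<partial>P)"
      unfolding G_def by (intro nn_integral_mono ennreal_leI)
    then show "(\<integral>\<^sup>+\<gamma>. ennreal (exp (- \<beta> * hr 0 \<gamma>) * \<phi> (hr 0 \<gamma>)) \<partial>P) < \<infinity>"
      using G_fin by (rule le_less_trans)
  qed
  have "AE \<gamma> in P. (\<lambda>n. ((\<Sum>x\<in>\<gamma> \<inter> Lambda n. 1)
      - z * enn2real (\<integral>\<^sup>+x. indicator (Lambda n) x * ennreal (exp (- \<beta> * hr x \<gamma>) * 1) \<partial>lborel))
      / (2 * real n) ^ ?d) \<longlonglongrightarrow> 0"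
    by (rule lln) auto
  moreover have "AE \<gamma> in P. (\<lambda>n. ((\<Sum>x\<in>\<gamma> \<inter> Lambda n. max 0 (hr x (\<gamma> - {x})))
      - z * enn2real (\<integral>\<^sup>+x. indicator (Lambda n) x * ennreal (exp (- \<beta> * hr x \<gamma>) * max 0 (hr x \<gamma>)) \<partial>lborel))
      / (2 * real n) ^ ?d) \<longlonglongrightarrow> 0"
    by (rule lln) auto
  moreover have "AE \<gamma> in P. (\<lambda>n. ((\<Sum>x\<in>\<gamma> \<inter> Lambda n. max 0 (- hr x (\<gamma> - {x})))
      - z * enn2real (\<integral>\<^sup>+x. indicator (Lambda n) x * ennreal (exp (- \<beta> * hr x \<gamma>) * max 0 (- hr x \<gamma>)) \<partial>lborel))
      / (2 * real n) ^ ?d) \<longlonglongrightarrow> 0"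
    by (rule lln) auto
  ultimately show ?thesis
    using AE_space est AE_field_integral_finite[OF G_m G_fin] density_empty_value dens2
  \<comment> \<open>From here on \<open>\<gamma>\<close> is fixed and the argument is
    deterministic.\<close>
  proof eventually_elim
    case (elim \<gamma>)
    then have lf: "locally_finite_conf \<gamma>" by (simp add: space_P)
    have hm [measurable]: "(\<lambda>x. hr x \<gamma>) \<in> borel_measurable borel" by (rule measurable_hr_fix[OF lf])
    define a where "a n = (2 * real n) ^ ?d" for n
    have a: "a n > 0" if "n > 0" for n using that by (simp add: a_def)
    define X where "X = (\<lambda>n b f. \<integral>x. indicator (Lambda n) x * (exp (- b * hr x \<gamma>) * f (hr x \<gamma>)) \<partial>lborel)"
    define N where "N n f = (\<Sum>x\<in>\<gamma> \<inter> Lambda n. f (hr x (\<gamma> - {x})))" for n and f :: "real \<Rightarrow> real"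
    have int_dom: "integrable lborel (\<lambda>x. indicator (Lambda n) x * (exp (- b * hr x \<gamma>) * f (hr x \<gamma>)))"
      if bS: "b \<in> S" and fb: "\<And>t. \<bar>f t\<bar> \<le> 1 \<or> \<bar>f t\<bar> \<le> \<bar>t\<bar>" and [measurable]: "f \<in> borel_measurable borel" for n b f
    proof (rule integrableI_bounded)
      obtain p where p: "p \<in> D" "b = snd p" using bS by (auto simp: S_def)
      have le: "exp (- b * t) * \<bar>f t\<bar> \<le> (1 + t\<^sup>2) * s t" for t
      proof -
        have "exp (- b * t) * \<bar>f t\<bar> \<le> exp (- b * t) * 1 \<or> exp (- b * t) * \<bar>f t\<bar> \<le> exp (- b * t) * \<bar>t\<bar>"
          using fb[of t] by (meson mult_left_mono exp_ge_zero)
        then show ?thesis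
          using dominated[OF p(1), of t] by (simp only: p(2) mult_1_right) (elim disjE; linarith)
      qed
      have "(\<integral>\<^sup>+x. ennreal (norm (indicator (Lambda n) x * (exp (- b * hr x \<gamma>) * f (hr x \<gamma>)))) \<partial>lborel)
        \<le> (\<integral>\<^sup>+x. indicator (Lambda n) x * G (hr x \<gamma>) \<partial>lborel)"
      proof (intro nn_integral_mono)
        fix x
        show "ennreal (norm (indicator (Lambda n) x * (exp (- b * hr x \<gamma>) * f (hr x \<gamma>)))) \<le> indicator (Lambda n) x * G (hr x \<gamma>)"
          using ennreal_leI[OF le[of "hr x \<gamma>"]] by (cases "x \<in> Lambda n") (simp_all add: G_def abs_mult)
      qed
      also have "\<dots> < \<infinity>" using elim by simp
      finally show "(\<integral>\<^sup>+x. ennreal (norm (indicator (Lambda n) x * (exp (- b * hr x \<gamma>) * f (hr x \<gamma>)))) \<partial>lborel) < \<infinity>" .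
    qed measurable
    have inS: "snd p \<in> S" if "p \<in> D" for p using that by (simp add: S_def)
    have \<beta>S: "\<beta> \<in> S" using inS[OF D(3)] by simp
    let ?one = "\<lambda>_::real. 1 :: real" and ?id = "\<lambda>t::real. t"
    have int1: "integrable lborel (\<lambda>x. indicator (Lambda n) x * (exp (- b * hr x \<gamma>) * ?one (hr x \<gamma>)))"
      and inth: "integrable lborel (\<lambda>x. indicator (Lambda n) x * (exp (- b * hr x \<gamma>) * ?id (hr x \<gamma>)))" if "b \<in> S" for n b
      by (intro int_dom that; simp)+
    define c where "c n p f = N n f - fst p * X n (snd p) f" for n and p :: "real \<times> real" and f
    have contrast: "pl_contrast H R n p \<gamma> = ereal ((c n p ?one)\<^sup>2 + (c n p ?id)\<^sup>2)" if "p \<in> D" for n p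
    proof -
      have "innov H R (Lambda n) (fst p) (snd p) (\<lambda>_ _. 1) \<gamma> = ereal (c n p ?one)"
        unfolding c_def N_def X_def by (rule innov_eq[OF lf _ int1[OF inS[OF that]]]) (simp add: one_ereal_def)
      moreover have "innov H R (Lambda n) (fst p) (snd p) (h_loc H R) \<gamma> = ereal (c n p ?id)"
        unfolding c_def N_def X_def by (rule innov_eq[OF lf _ inth[OF inS[OF that]]]) (rule h_loc_eq)
      ultimately show ?thesis unfolding pl_contrast_def by (simp add: power2_eq_square)
    qed
    have X_nn: "enn2real (\<integral>\<^sup>+x. indicator (Lambda n) x * ennreal (exp (- \<beta> * hr x \<gamma>) * f (hr x \<gamma>)) \<partial>lborel) = X n \<beta> f"
      if [measurable]: "f \<in> borel_measurable borel" and "\<And>t. 0 \<le> f t" for n f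
    proof -
      have "(\<integral>\<^sup>+x. indicator (Lambda n) x * ennreal (exp (- \<beta> * hr x \<gamma>) * f (hr x \<gamma>)) \<partial>lborel)
        = (\<integral>\<^sup>+x. ennreal (indicator (Lambda n) x * (exp (- \<beta> * hr x \<gamma>) * f (hr x \<gamma>))) \<partial>lborel)"
        by (intro nn_integral_cong) (simp add: indicator_def)
      then show ?thesis unfolding X_def using that by (subst integral_eq_nn_integral) auto
    qed
    let ?p = "(z, \<beta>)"
    have c1: "(\<lambda>n. c n ?p ?one / a n) \<longlonglongrightarrow> 0"
      using elim(1) X_nn[of ?one] by (simp add: c_def N_def a_def)
    have ch: "(\<lambda>n. c n ?p ?id / a n) \<longlonglongrightarrow> 0"
    proof -
      let ?pos = "\<lambda>t::real. max 0 t" and ?neg = "\<lambda>t::real. max 0 (- t)"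
      have "(\<lambda>n. (N n ?pos - z * X n \<beta> ?pos) / a n - (N n ?neg - z * X n \<beta> ?neg) / a n) \<longlonglongrightarrow> 0 - 0"
        using elim(2,3) X_nn[of ?pos] X_nn[of ?neg] unfolding N_def a_def by (intro tendsto_diff) simp_all
      moreover have "(N n ?pos - z * X n \<beta> ?pos) / a n - (N n ?neg - z * X n \<beta> ?neg) / a n = c n ?p ?id / a n" for n
      proof -
        have id: "max 0 t - max 0 (- t) = t" for t :: real by (simp add: max_def)
        have "N n ?pos - N n ?neg = N n ?id" unfolding N_def by (simp add: sum_subtractf[symmetric] id)
        moreover have "X n \<beta> ?pos - X n \<beta> ?neg = X n \<beta> ?id"
        proof -
          have "integrable lborel (\<lambda>x. indicator (Lambda n) x * (exp (- \<beta> * hr x \<gamma>) * ?pos (hr x \<gamma>)))"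
            "integrable lborel (\<lambda>x. indicator (Lambda n) x * (exp (- \<beta> * hr x \<gamma>) * ?neg (hr x \<gamma>)))"
            by (intro int_dom[OF \<beta>S]; auto)+
          from Bochner_Integration.integral_diff[OF this] show ?thesis
            unfolding X_def by (simp only: right_diff_distrib[symmetric] id)
        qed
        ultimately show ?thesis by (simp add: c_def diff_divide_distrib[symmetric] algebra_simps)
      qed
      ultimately show ?thesis by simp
    qed
    define q where "q n = est n \<gamma>" for n
    have qD: "q n \<in> D" for n using elim by (simp add: q_def)
    have min: "(c n (q n) ?one)\<^sup>2 + (c n (q n) ?id)\<^sup>2 \<le> (c n ?p ?one)\<^sup>2 + (c n ?p ?id)\<^sup>2" for n
    proof -
      have "pl_contrast H R n (q n) \<gamma> \<le> pl_contrast H R n ?p \<gamma>" using elim(5) D(3) by (simp add: q_def)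
      then show ?thesis unfolding contrast[OF qD] contrast[OF D(3)] by simp
    qed
    \<comment> \<open>It majorises the square root of the contrast at the true parameter, hence by
      minimality both innovations at the estimator.\<close>
    define u where "u n = \<bar>c n ?p ?one\<bar> + \<bar>c n ?p ?id\<bar>" for n
    have u: "\<bar>c n (q n) ?one\<bar> \<le> u n" "\<bar>c n (q n) ?id\<bar> \<le> u n" for n
    proof -
      have "(c n ?p ?one)\<^sup>2 + (c n ?p ?id)\<^sup>2 \<le> (u n)\<^sup>2" by (simp add: u_def power2_sum)
      then have "(c n (q n) ?one)\<^sup>2 \<le> (u n)\<^sup>2" "(c n (q n) ?id)\<^sup>2 \<le> (u n)\<^sup>2"
        using min[of n] zero_le_power2[of "c n (q n) ?one"] zero_le_power2[of "c n (q n) ?id"] by linarith+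
      then show "\<bar>c n (q n) ?one\<bar> \<le> u n" "\<bar>c n (q n) ?id\<bar> \<le> u n"
        unfolding abs_le_square_iff[symmetric] by (simp_all add: u_def)
    qed
    have u_lim: "(\<lambda>n. u n / a n) \<longlonglongrightarrow> 0"
    proof -
      have "(\<lambda>n. \<bar>c n ?p ?one / a n\<bar> + \<bar>c n ?p ?id / a n\<bar>) \<longlonglongrightarrow> 0 + 0"
        by (intro tendsto_add tendsto_rabs_zero c1 ch)
      then show ?thesis by (simp add: u_def a_def abs_divide add_divide_distrib)
    qed
    obtain M where M: "\<And>p. p \<in> D \<Longrightarrow> norm p \<le> M" using D(1) by (auto simp: bounded_iff)
    define b where "b = 2 * M"
    have b: "\<bar>snd p - \<beta>\<bar> \<le> b" if "p \<in> D" for p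
      using norm_snd_le[where x = "fst p" and y = "snd p"] norm_snd_le[where x = z and y = \<beta>] M[OF that] M[OF D(3)]
      unfolding prod.collapse real_norm_def b_def by linarith
    have b0: "b \<ge> 0" using b[OF D(3)] by simp
    have q0: "fst (q n) > 0" for n using qD[of n] D(2) by auto
    show "(\<lambda>n. est n \<gamma>) \<longlonglongrightarrow> (z, \<beta>)"
    proof (rule tendstoI)
      fix \<epsilon> :: real assume "\<epsilon> > 0"
      then have \<epsilon>: "\<epsilon> / 2 > 0" by simp
      let ?J = "{t. \<eta> \<le> \<bar>t - ?h0\<bar> \<and> \<bar>t - ?h0\<bar> \<le> 1 / \<eta>}"
      define l where "l n = ln (fst (q n) / z)" for n
      define \<delta> where "\<delta> n = snd (q n) - \<beta>" for n
      define \<psi> where "\<psi> n t = exp (- \<beta> * t) * (\<delta> n * t - l n) * (1 - exp (- (\<delta> n * t - l n)))" for n t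
      \<comment> \<open>\<open>c'\<close> is the same for all \<open>n\<close>; only the choice
        between the two value sets varies with \<open>n\<close>. For this reason
        \<open>\<rho>\<close> below is the smaller of the two densities.\<close>
      obtain c' where c': "c' > 0" and sep: "\<And>n. \<not> (\<bar>\<delta> n\<bar> < \<epsilon> / 2 \<and> \<bar>fst (q n) - z\<bar> < \<epsilon> / 2) \<Longrightarrow>
          (\<forall>t\<in>{?h0}. c' * (1 + \<bar>l n\<bar>) \<le> \<psi> n t) \<or> (\<forall>t\<in>?J. c' * (1 + \<bar>l n\<bar>) \<le> \<psi> n t)"
      proof (rule affine_separation[OF z_pos \<eta> \<epsilon> b0, where \<beta> = \<beta> and v = ?h0])
        fix c' assume c': "c' > 0" "\<And>z' \<delta>. z' > 0 \<Longrightarrow> \<bar>\<delta>\<bar> \<le> b \<Longrightarrow> \<not> (\<bar>\<delta>\<bar> < \<epsilon> / 2 \<and> \<bar>z' - z\<bar> < \<epsilon> / 2) \<Longrightarrow>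
          (\<forall>t\<in>{?h0}. c' * (1 + \<bar>ln (z' / z)\<bar>) \<le> exp (- \<beta> * t) * (\<delta> * t - ln (z' / z)) * (1 - exp (- (\<delta> * t - ln (z' / z))))) \<or>
          (\<forall>t. \<eta> \<le> \<bar>t - ?h0\<bar> \<and> \<bar>t - ?h0\<bar> \<le> 1 / \<eta> \<longrightarrow>
            c' * (1 + \<bar>ln (z' / z)\<bar>) \<le> exp (- \<beta> * t) * (\<delta> * t - ln (z' / z)) * (1 - exp (- (\<delta> * t - ln (z' / z)))))"
        show ?thesis
        proof (rule that[OF c'(1)])
          fix n assume "\<not> (\<bar>\<delta> n\<bar> < \<epsilon> / 2 \<and> \<bar>fst (q n) - z\<bar> < \<epsilon> / 2)"
          from c'(2)[OF q0 b[OF qD, folded \<delta>_def] this]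
          show "(\<forall>t\<in>{?h0}. c' * (1 + \<bar>l n\<bar>) \<le> \<psi> n t) \<or> (\<forall>t\<in>?J. c' * (1 + \<bar>l n\<bar>) \<le> \<psi> n t)"
            unfolding \<psi>_def l_def mem_Collect_eq Ball_def by blast
        qed
      qed
      obtain \<rho>1 where \<rho>1: "\<rho>1 > 0" "\<forall>\<^sub>F n in sequentially. ennreal (\<rho>1 * a n)
        \<le> (\<integral>\<^sup>+x. indicator (Lambda n) x * indicator {?h0} (hr x \<gamma>) \<partial>lborel)"
        using elim(7) unfolding a_def by blast
      obtain \<rho>2 where \<rho>2: "\<rho>2 > 0" "\<forall>\<^sub>F n in sequentially. ennreal (\<rho>2 * a n)
        \<le> (\<integral>\<^sup>+x. indicator (Lambda n) x * indicator ?J (hr x \<gamma>) \<partial>lborel)"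
        using elim(8) unfolding a_def by blast
      define \<rho> where "\<rho> = min \<rho>1 \<rho>2"
      have \<rho>: "\<rho> > 0" "\<rho> \<le> \<rho>1" "\<rho> \<le> \<rho>2" using \<rho>1 \<rho>2 by (auto simp: \<rho>_def)
      have \<psi>0: "\<psi> n t \<ge> 0" for n t
        unfolding \<psi>_def mult.assoc by (intro mult_nonneg_nonneg mult_one_minus_exp_nonneg) simp
      \<comment> \<open>The logarithm makes \<open>z * exp (- \<beta> * t)\<close> times
        \<open>exp (- L)\<close> the intensity at the estimator, where \<open>L\<close> is
        \<open>\<delta> n * t - l n\<close>; the product then expands into differences of
        intensities with weights \<open>t\<close> and \<open>1\<close>.\<close>
      have \<psi>_eq: "z * \<psi> n t = \<delta> n * (z * (exp (- \<beta> * t) * t) - fst (q n) * (exp (- snd (q n) * t) * t))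
        - l n * (z * (exp (- \<beta> * t) * 1) - fst (q n) * (exp (- snd (q n) * t) * 1))" for n t
      proof -
        have "exp (- (\<delta> n * t - l n)) = exp (- \<delta> n * t) * (fst (q n) / z)"
          using q0[of n] z_pos by (simp add: l_def exp_diff exp_minus field_simps)
        then have "exp (- \<beta> * t) * exp (- (\<delta> n * t - l n)) = exp (- snd (q n) * t) * (fst (q n) / z)"
          by (simp add: \<delta>_def mult.assoc[symmetric] exp_add[symmetric] algebra_simps)
        then have *: "z * (exp (- \<beta> * t) * exp (- (\<delta> n * t - l n))) = fst (q n) * exp (- snd (q n) * t)"
          using z_pos by simp
        have "z * \<psi> n t = (\<delta> n * t - l n) * (z * exp (- \<beta> * t) - z * (exp (- \<beta> * t) * exp (- (\<delta> n * t - l n))))"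
          unfolding \<psi>_def by (simp only: algebra_simps)
        also have "\<dots> = (\<delta> n * t - l n) * (z * exp (- \<beta> * t) - fst (q n) * exp (- snd (q n) * t))"
          unfolding * ..
        finally show ?thesis by (simp add: algebra_simps)
      qed
      let ?X = "\<lambda>n b f x. indicator (Lambda n) x * (exp (- b * hr x \<gamma>) * f (hr x \<gamma>))"
      have \<psi>_dec: "indicator (Lambda n) x * (z * \<psi> n (hr x \<gamma>))
        = \<delta> n * (z * ?X n \<beta> ?id x - fst (q n) * ?X n (snd (q n)) ?id x)
        - l n * (z * ?X n \<beta> ?one x - fst (q n) * ?X n (snd (q n)) ?one x)" for n x
        unfolding \<psi>_eq by (simp add: indicator_def)
      have qS: "snd (q n) \<in> S" for n by (rule inS[OF qD])
      have int\<psi>: "integrable lborel (\<lambda>x. indicator (Lambda n) x * (z * \<psi> n (hr x \<gamma>)))" for n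
        unfolding \<psi>_dec
        by (intro Bochner_Integration.integrable_diff integrable_mult_right int1 inth \<beta>S qS)
      \<comment> \<open>The point sums \<open>N\<close> do not depend on the parameter, so they
        cancel in differences of innovations.\<close>
      have I\<psi>: "(\<integral>x. indicator (Lambda n) x * (z * \<psi> n (hr x \<gamma>)) \<partial>lborel)
        = \<delta> n * (c n (q n) ?id - c n ?p ?id) - l n * (c n (q n) ?one - c n ?p ?one)" for n
      proof -
        have "(\<integral>x. indicator (Lambda n) x * (z * \<psi> n (hr x \<gamma>)) \<partial>lborel)
          = \<delta> n * (z * X n \<beta> ?id - fst (q n) * X n (snd (q n)) ?id) - l n * (z * X n \<beta> ?one - fst (q n) * X n (snd (q n)) ?one)"
          unfolding \<psi>_dec X_def using int1[OF \<beta>S, of n] inth[OF \<beta>S, of n] int1[OF qS, of n n] inth[OF qS, of n n]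
          by (simp only: Bochner_Integration.integral_diff Bochner_Integration.integrable_diff integrable_mult_right integral_mult_right_zero)
        then show ?thesis by (simp add: c_def algebra_simps)
      qed
      \<comment> \<open>\<open>\<delta> n\<close> is bounded since \<open>D\<close> is, but
        \<open>l n\<close> need not be, as the estimated activity may approach \<open>0\<close>. The
        factor \<open>1 + \<bar>l n\<bar>\<close> cancels against the one in
        \<open>lower\<close>.\<close>
      have upper: "(\<integral>x. indicator (Lambda n) x * (z * \<psi> n (hr x \<gamma>)) \<partial>lborel) \<le> 2 * (b + 1) * u n * (1 + \<bar>l n\<bar>)" for n
      proof -
        have v: "\<bar>c n (q n) ?id - c n ?p ?id\<bar> \<le> 2 * u n" "\<bar>c n (q n) ?one - c n ?p ?one\<bar> \<le> 2 * u n"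
          using u[of n] by (auto simp: u_def)
        have un: "u n \<ge> 0" by (simp add: u_def)
        have "\<bar>\<delta> n * (c n (q n) ?id - c n ?p ?id)\<bar> \<le> b * (2 * u n)"
          unfolding abs_mult using v b[OF qD, of n] b0 by (intro mult_mono) (auto simp: \<delta>_def)
        moreover have "\<bar>l n * (c n (q n) ?one - c n ?p ?one)\<bar> \<le> \<bar>l n\<bar> * (2 * u n)"
          unfolding abs_mult using v by (intro mult_left_mono) auto
        ultimately have "(\<integral>x. indicator (Lambda n) x * (z * \<psi> n (hr x \<gamma>)) \<partial>lborel) \<le> b * (2 * u n) + \<bar>l n\<bar> * (2 * u n)"
          unfolding I\<psi> by linarith
        also have "\<dots> \<le> 2 * (b + 1) * u n * (1 + \<bar>l n\<bar>)"
          using mult_nonneg_nonneg[OF mult_nonneg_nonneg[OF b0 un] abs_ge_zero[of "l n"]] un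
          by (simp add: algebra_simps)
        finally show ?thesis .
      qed
      have lower: "z * c' * (1 + \<bar>l n\<bar>) * (\<rho> * a n) \<le> (\<integral>x. indicator (Lambda n) x * (z * \<psi> n (hr x \<gamma>)) \<partial>lborel)"
        if [measurable]: "J \<in> sets borel" and J: "\<forall>t\<in>J. c' * (1 + \<bar>l n\<bar>) \<le> \<psi> n t"
          and dens: "ennreal (\<rho> * a n) \<le> (\<integral>\<^sup>+x. indicator (Lambda n) x * indicator J (hr x \<gamma>) \<partial>lborel)" for n J
      proof -
        have "ennreal (z * c' * (1 + \<bar>l n\<bar>) * (\<rho> * a n)) = ennreal (z * c' * (1 + \<bar>l n\<bar>)) * ennreal (\<rho> * a n)"
          using z_pos c' \<rho> by (intro ennreal_mult) (auto simp: a_def)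
        also have "\<dots> \<le> ennreal (z * c' * (1 + \<bar>l n\<bar>)) * (\<integral>\<^sup>+x. indicator (Lambda n) x * indicator J (hr x \<gamma>) \<partial>lborel)"
          by (intro mult_left_mono dens) simp
        also have "\<dots> = (\<integral>\<^sup>+x. ennreal (z * c' * (1 + \<bar>l n\<bar>)) * (indicator (Lambda n) x * indicator J (hr x \<gamma>)) \<partial>lborel)"
          by (rule nn_integral_cmult[symmetric]) measurable
        also have "\<dots> \<le> (\<integral>\<^sup>+x. ennreal (indicator (Lambda n) x * (z * \<psi> n (hr x \<gamma>))) \<partial>lborel)"
        proof (intro nn_integral_mono)
          fix x
          have "z * c' * (1 + \<bar>l n\<bar>) \<le> z * \<psi> n (hr x \<gamma>)" if "hr x \<gamma> \<in> J"
            using J that z_pos by (simp add: mult.assoc)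
          then show "ennreal (z * c' * (1 + \<bar>l n\<bar>)) * (indicator (Lambda n) x * indicator J (hr x \<gamma>))
            \<le> ennreal (indicator (Lambda n) x * (z * \<psi> n (hr x \<gamma>)))"
            by (auto simp: indicator_def intro: ennreal_leI)
        qed
        also have "\<dots> = ennreal (\<integral>x. indicator (Lambda n) x * (z * \<psi> n (hr x \<gamma>)) \<partial>lborel)"
          using z_pos \<psi>0 by (intro nn_integral_eq_integral int\<psi>) auto
        finally show ?thesis
          using z_pos \<psi>0 by (subst (asm) ennreal_le_iff) (auto intro!: integral_nonneg_AE)
      qed
      \<comment> \<open>The threshold is the quotient of the constants in \<open>lower\<close> and
        \<open>upper\<close>.\<close>
      have "\<forall>\<^sub>F n in sequentially. u n / a n < z * c' * \<rho> / (2 * (b + 1))"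
        using u_lim z_pos c' \<rho> b0 by (intro order_tendstoD) auto
      then show "\<forall>\<^sub>F n in sequentially. dist (est n \<gamma>) (z, \<beta>) < \<epsilon>"
        using \<rho>1(2) \<rho>2(2) eventually_gt_at_top[of 0]
      proof eventually_elim
        case n: (elim n)
        have an: "a n > 0" using a n(4) .
        have le: "ennreal (\<rho> * a n) \<le> ennreal (\<rho>1 * a n)" "ennreal (\<rho> * a n) \<le> ennreal (\<rho>2 * a n)"
          using \<rho> an by (auto intro!: ennreal_leI mult_right_mono)
        have "\<bar>\<delta> n\<bar> < \<epsilon> / 2 \<and> \<bar>fst (q n) - z\<bar> < \<epsilon> / 2"
        proof (rule ccontr)
          assume "\<not> ?thesis"
          from sep[OF this] have "z * c' * (1 + \<bar>l n\<bar>) * (\<rho> * a n) \<le> (\<integral>x. indicator (Lambda n) x * (z * \<psi> n (hr x \<gamma>)) \<partial>lborel)"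
          proof
            assume "\<forall>t\<in>{?h0}. c' * (1 + \<bar>l n\<bar>) \<le> \<psi> n t"
            then show ?thesis by (rule lower[rotated]) (use le n(2) in \<open>auto intro: order_trans\<close>)
          next
            assume *: "\<forall>t\<in>?J. c' * (1 + \<bar>l n\<bar>) \<le> \<psi> n t"
            have "?J \<in> sets borel" by measurable
            then show ?thesis by (rule lower[OF _ *]) (rule order_trans[OF le(2) n(3)])
          qed
          also have "\<dots> \<le> 2 * (b + 1) * u n * (1 + \<bar>l n\<bar>)" by (rule upper)
          finally have "(1 + \<bar>l n\<bar>) * (z * c' * \<rho> * a n) \<le> (1 + \<bar>l n\<bar>) * (2 * (b + 1) * u n)"
            by (simp add: mult_ac)
          then have "z * c' * \<rho> * a n \<le> 2 * (b + 1) * u n"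
            by (rule mult_left_le_imp_le) simp
          then have "z * c' * \<rho> / (2 * (b + 1)) \<le> u n / a n"
            using an b0 by (simp add: field_simps)
          then show False using n(1) by linarith
        qed
        moreover have "dist (q n) (z, \<beta>) \<le> \<bar>fst (q n) - z\<bar> + \<bar>snd (q n) - \<beta>\<bar>"
          using norm_Pair_le[of "fst (q n) - z" "snd (q n) - \<beta>"]
          by (cases "q n") (simp add: dist_norm)
        ultimately show ?case by (simp add: q_def \<delta>_def)
      qed
    qed
  qed
qed

end

theorem theorem8:
  fixes H :: "'a::euclidean_space set \<Rightarrow> ereal"
    and R zs \<beta>s :: real
    and P :: "'a set measure"
    and D :: "(real \<times> real) set"
    and est :: "nat \<Rightarrow> 'a set \<Rightarrow> real \<times> real"
  assumes H: "energy_function H" "stationary_energy H" "finite_range H R" "R > 0"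
    and par: "zs > 0" "\<beta>s \<ge> 0"
    and gibbs: "gibbs_pp H R zs \<beta>s P"
    and D: "bounded D" "D \<subseteq> {0<..} \<times> {0..}" "(zs, \<beta>s) \<in> D"
    and est: "AE \<gamma> in P. \<forall>n. est n \<gamma> \<in> D \<and>
                 (\<forall>p\<in>D. pl_contrast H R n (est n \<gamma>) \<gamma> \<le> pl_contrast H R n p \<gamma>)"
    and moment: "(\<integral>\<^sup>+ \<gamma>. e2ennreal (1 + (h_loc H R 0 \<gamma>)\<^sup>2) *
                     (SUP p\<in>D. ennreal (ewt (snd p) (h_loc H R 0 \<gamma>))) \<partial>P) < \<infinity>"
    and nondeg: "measure P {\<gamma> \<in> space P. h_loc H R 0 \<gamma> = h_loc H R 0 {}} < 1"
  shows "AE \<gamma> in P. (\<lambda>n. est n \<gamma>) \<longlonglongrightarrow> (zs, \<beta>s)"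
proof -
  obtain m :: nat where m: "R + 1 \<le> real m" using real_arch_simple by blast
  interpret prob_space P using gibbs by (simp add: gibbs_pp_def)
  interpret gibbs_window H R P zs \<beta>s m
    using H par(1) gibbs m by unfold_locales (simp_all add: gibbs_pp_def)
  show ?thesis
    by (rule consistency[OF D(1) _ D(3) est moment nondeg]) (use D(2) in auto)
qed

end
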